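(* Let $A$ be a unital algebra over $\mathbb{C}$ and let $L$ be a weak left line module over $A$. Then the tensor algebra $T_{\mathbb{Z}}(L)$ is a $\mathbb{C}\mathbb{Z}$ Hopf-Galois extension of $A$ if and only if $L$ is a left line module.
   Context: For an $A$-bimodule $E$, $E^\circ={}_A\mathrm{Hom}(E,A)$ (left module maps), a bimodule with $(\alpha.a)(e)=\alpha(e)a$ and $(a.\alpha)(e)=\alpha(e.a)$. If $E$ is finitely generated projective as a left module, with dual basis $e^i\in E$, $e_i\in E^\circ$ ($f=\sum_i e_i(f).e^i$ for all $f\in E$), there are bimodule maps $\mathrm{ev}:E\otimes_A E^\circ\to A$, $\mathrm{ev}(e\otimes\alpha)=\alpha(e)$, and $\mathrm{coev}:A\to E^\circ\otimes_A E$, $\mathrm{coev}(1)=\sum_i e_i\otimes e^i$. A weak left line module is an $A$-bimodule $L$, finitely generated projective as a left $A$-module, such that $\mathrm{coev}:A\to L^\circ\otimes_A L$ is an isomorphism; it is a left line module if in addition $\mathrm{ev}:L\otimes_A L^\circ\to A$ is an isomorphism. $T_{\mathbb{Z}}(L)=\bigoplus_{n\in\mathbb{Z}}L^n$ with $L^0=A$, $L^n=L^{\otimes_A n}$ and $L^{-n}=(L^\circ)^{\otimes_A n}$ for $n\ge1$. Define recursively $\mathrm{ev}^1=\mathrm{ev}$, $\mathrm{ev}^{n+1}=\mathrm{ev}(\mathrm{id}\otimes\mathrm{ev}^n\otimes\mathrm{id}):L^{n+1}\otimes_A L^{-n-1}\to A$ and $\tilde{\mathrm{ev}}^1=\mathrm{coev}^{-1}$,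 $\tilde{\mathrm{ev}}^{n+1}=\mathrm{coev}^{-1}(\mathrm{id}\otimes\tilde{\mathrm{ev}}^n\otimes\mathrm{id}):L^{-n-1}\otimes_A L^{n+1}\to A$. The (associative) product $L^n\otimes_A L^m\to L^{n+m}$ is $\otimes_A$ if $n,m$ have the same sign (and the $A$-action if one is $0$). For $n,m>0$ it is, on $L^{-n}\otimes_A L^m$, $\tilde{\mathrm{ev}}^n\otimes\mathrm{id}$ if $m\ge n$ and $\mathrm{id}\otimes\tilde{\mathrm{ev}}^m$ if $m\le n$; on $L^n\otimes_A L^{-m}$, $\mathrm{ev}^n\otimes\mathrm{id}$ if $m\ge n$ and $\mathrm{id}\otimes\mathrm{ev}^m$ if $m\le n$. A $\mathbb{Z}$-graded algebra $C=\bigoplus_n C_n$ is a comodule algebra over the group algebra $\mathbb{C}\mathbb{Z}$ by $c\mapsto c\otimes\underline{n}$ for $c\in C_n$, where $\underline n$ is the basis element of $\mathbb{C}\mathbb{Z}$ corresponding to $n$. It is a $\mathbb{C}\mathbb{Z}$ Hopf-Galois extension of $C_0$ if the canonical map $C\otimes_{C_0}C\to C\otimes\mathbb{C}\mathbb{Z}$, $c\otimes c'\mapsto cc'\otimes\underline{m}$ for $c'\in C_m$, is bijective. *)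

theory Defs
  imports "HOL-Algebra.Algebra" "HOL-Library.Poly_Mapping"
begin

section \<open>Algebras over the complex numbers, bimodules\<close>

definition complex_ring :: "complex ring" where
  "complex_ring = \<lparr>carrier = UNIV, monoid.mult = (*), one = 1, ring.zero = 0, ring.add = (+)\<rparr>"

text \<open>
  The locale \<^locale>\<open>algebra\<close> of the library is about commutative algebras, so unital associative
  complex algebras are introduced here. The record field \<^const>\<open>smult\<close> is the scalar
  multiplication by complex numbers.
\<close>

locale complex_algebra = ring A + module complex_ring A for A :: "(complex, 'a) module" (structure) +
  assumes smult_mult_left:
      "\<lbrakk>x \<in> carrier A; y \<in> carrier A\<rbrakk> \<Longrightarrow> (c \<odot> x) \<otimes> y = c \<odot> (x \<otimes> y)"
    and smult_mult_right:
      "\<lbrakk>x \<in> carrier A; y \<in> carrier A\<rbrakk> \<Longrightarrow> x \<otimes> (c \<odot> y) = c \<odot> (x \<otimes> y)"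

text \<open>
  As for \<^typ>\<open>('a, 'b) module\<close>, the multiplication and unit fields of the record are irrelevant
  for bimodules.
\<close>

record ('a, 'm) bimodule = "('a, 'm) module" +
  rsmult :: "['m, 'a] \<Rightarrow> 'm" (infixl \<open>\<triangleleft>\<index>\<close> 70)

locale bimodule = A?: complex_algebra A + E?: abelian_group E
  for A :: "(complex, 'a) module" and E :: "('a, 'm) bimodule" +
  assumes left_closed: "\<lbrakk>a \<in> carrier A; e \<in> carrier E\<rbrakk> \<Longrightarrow> a \<odot>\<^bsub>E\<^esub> e \<in> carrier E"
    and left_add_scalar: "\<lbrakk>a \<in> carrier A; b \<in> carrier A; e \<in> carrier E\<rbrakk> \<Longrightarrow>
      (a \<oplus>\<^bsub>A\<^esub> b) \<odot>\<^bsub>E\<^esub> e = a \<odot>\<^bsub>E\<^esub> e \<oplus>\<^bsub>E\<^esub> b \<odot>\<^bsub>E\<^esub> e"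
    and left_add: "\<lbrakk>a \<in> carrier A; e \<in> carrier E; f \<in> carrier E\<rbrakk> \<Longrightarrow>
      a \<odot>\<^bsub>E\<^esub> (e \<oplus>\<^bsub>E\<^esub> f) = a \<odot>\<^bsub>E\<^esub> e \<oplus>\<^bsub>E\<^esub> a \<odot>\<^bsub>E\<^esub> f"
    and left_assoc: "\<lbrakk>a \<in> carrier A; b \<in> carrier A; e \<in> carrier E\<rbrakk> \<Longrightarrow>
      (a \<otimes>\<^bsub>A\<^esub> b) \<odot>\<^bsub>E\<^esub> e = a \<odot>\<^bsub>E\<^esub> (b \<odot>\<^bsub>E\<^esub> e)"
    and left_one: "e \<in> carrier E \<Longrightarrow> \<one>\<^bsub>A\<^esub> \<odot>\<^bsub>E\<^esub> e = e"
    and right_closed: "\<lbrakk>a \<in> carrier A; e \<in> carrier E\<rbrakk> \<Longrightarrow> e \<triangleleft>\<^bsub>E\<^esub> a \<in> carrier E"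
    and right_add_scalar: "\<lbrakk>a \<in> carrier A; b \<in> carrier A; e \<in> carrier E\<rbrakk> \<Longrightarrow>
      e \<triangleleft>\<^bsub>E\<^esub> (a \<oplus>\<^bsub>A\<^esub> b) = e \<triangleleft>\<^bsub>E\<^esub> a \<oplus>\<^bsub>E\<^esub> e \<triangleleft>\<^bsub>E\<^esub> b"
    and right_add: "\<lbrakk>a \<in> carrier A; e \<in> carrier E; f \<in> carrier E\<rbrakk> \<Longrightarrow>
      (e \<oplus>\<^bsub>E\<^esub> f) \<triangleleft>\<^bsub>E\<^esub> a = e \<triangleleft>\<^bsub>E\<^esub> a \<oplus>\<^bsub>E\<^esub> f \<triangleleft>\<^bsub>E\<^esub> a"
    and right_assoc: "\<lbrakk>a \<in> carrier A; b \<in> carrier A; e \<in> carrier E\<rbrakk> \<Longrightarrow>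
      e \<triangleleft>\<^bsub>E\<^esub> (a \<otimes>\<^bsub>A\<^esub> b) = (e \<triangleleft>\<^bsub>E\<^esub> a) \<triangleleft>\<^bsub>E\<^esub> b"
    and right_one: "e \<in> carrier E \<Longrightarrow> e \<triangleleft>\<^bsub>E\<^esub> \<one>\<^bsub>A\<^esub> = e"
    and left_right: "\<lbrakk>a \<in> carrier A; b \<in> carrier A; e \<in> carrier E\<rbrakk> \<Longrightarrow>
      (a \<odot>\<^bsub>E\<^esub> e) \<triangleleft>\<^bsub>E\<^esub> b = a \<odot>\<^bsub>E\<^esub> (e \<triangleleft>\<^bsub>E\<^esub> b)"
    and complex_central: "e \<in> carrier E \<Longrightarrow>
      (c \<odot>\<^bsub>A\<^esub> \<one>\<^bsub>A\<^esub>) \<odot>\<^bsub>E\<^esub> e = e \<triangleleft>\<^bsub>E\<^esub> (c \<odot>\<^bsub>A\<^esub> \<one>\<^bsub>A\<^esub>)"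

definition regular_bimodule :: "('a, 'x) ring_scheme \<Rightarrow> ('a, 'a) bimodule" where
  "regular_bimodule A =
    \<lparr>carrier = carrier A, monoid.mult = monoid.mult A, one = one A, ring.zero = ring.zero A, ring.add = ring.add A,
     smult = monoid.mult A, rsmult = monoid.mult A\<rparr>"

definition left_module_maps ::
    "('a, 'x) ring_scheme \<Rightarrow> ('a, 'm, 'y) module_scheme \<Rightarrow> ('a, 'n, 'z) module_scheme \<Rightarrow> ('m \<Rightarrow> 'n) set"
  where
  "left_module_maps A M N = {h \<in> carrier M \<rightarrow> carrier N.
     (\<forall>x\<in>carrier M. \<forall>y\<in>carrier M. h (x \<oplus>\<^bsub>M\<^esub> y) = h x \<oplus>\<^bsub>N\<^esub> h y) \<and>
     (\<forall>a\<in>carrier A. \<forall>x\<in>carrier M. h (a \<odot>\<^bsub>M\<^esub> x) = a \<odot>\<^bsub>N\<^esub> h x)}"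

definition dual_bimodule ::
    "('a, 'x) ring_scheme \<Rightarrow> ('a, 'm) bimodule \<Rightarrow> ('a, 'm \<Rightarrow> 'a) bimodule" where
  "dual_bimodule A E =
    \<lparr>carrier = left_module_maps A E (regular_bimodule A) \<inter> extensional (carrier E),
     monoid.mult = (\<lambda>_ _. undefined), one = undefined,
     ring.zero = (\<lambda>e\<in>carrier E. \<zero>\<^bsub>A\<^esub>),
     ring.add = (\<lambda>\<alpha> \<beta>. \<lambda>e\<in>carrier E. \<alpha> e \<oplus>\<^bsub>A\<^esub> \<beta> e),
     smult = (\<lambda>a \<alpha>. \<lambda>e\<in>carrier E. \<alpha> (e \<triangleleft>\<^bsub>E\<^esub> a)),
     rsmult = (\<lambda>\<alpha> a. \<lambda>e\<in>carrier E. \<alpha> e \<otimes>\<^bsub>A\<^esub> a)\<rparr>"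

section \<open>Finitely generated projective modules\<close>

definition free_left_module :: "('a, 'x) ring_scheme \<Rightarrow> 'i set \<Rightarrow> ('a, 'i \<Rightarrow> 'a) module" where
  "free_left_module A I =
    \<lparr>carrier = {f \<in> I \<rightarrow>\<^sub>E carrier A. finite {i \<in> I. f i \<noteq> \<zero>\<^bsub>A\<^esub>}},
     monoid.mult = (\<lambda>_ _. undefined), one = undefined,
     ring.zero = (\<lambda>i\<in>I. \<zero>\<^bsub>A\<^esub>),
     ring.add = (\<lambda>f g. \<lambda>i\<in>I. f i \<oplus>\<^bsub>A\<^esub> g i),
     smult = (\<lambda>a f. \<lambda>i\<in>I. a \<otimes>\<^bsub>A\<^esub> f i)\<rparr>"

definition finitely_generated_left :: "('a, 'x) ring_scheme \<Rightarrow> ('a, 'm, 'y) module_scheme \<Rightarrow> bool"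
  where
  "finitely_generated_left A M \<longleftrightarrow>
    (\<exists>S. finite S \<and> S \<subseteq> carrier M \<and>
      (\<forall>x\<in>carrier M. \<exists>c\<in>S \<rightarrow> carrier A. x = (\<Oplus>\<^bsub>M\<^esub>s\<in>S. c s \<odot>\<^bsub>M\<^esub> s)))"

text \<open>
  Projective means direct summand of a free module. Index sets of the free module can be taken in
  the type of elements of \<open>M\<close>: a module that is a direct summand of some free module is a direct
  summand of the free module on its own elements.
\<close>

definition projective_left :: "('a, 'x) ring_scheme \<Rightarrow> ('a, 'm, 'y) module_scheme \<Rightarrow> bool" where
  "projective_left A M \<longleftrightarrow>
    (\<exists>I :: 'm set. \<exists>i \<in> left_module_maps A M (free_left_module A I).
      \<exists>p \<in> left_module_maps A (free_left_module A I) M. \<forall>x\<in>carrier M. p (i x) = x)"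

definition fgp_left :: "('a, 'x) ring_scheme \<Rightarrow> ('a, 'm, 'y) module_scheme \<Rightarrow> bool" where
  "fgp_left A M \<longleftrightarrow> finitely_generated_left A M \<and> projective_left A M"

section \<open>Tensor products\<close>

subsection \<open>Abelian groups given by generators and relations\<close>

text \<open>
  \<^typ>\<open>'g \<Rightarrow>\<^sub>0 int\<close> is the free abelian group on \<^typ>\<open>'g\<close>. Elements of the presented group are cosets
  of the subgroup spanned by the relations.
\<close>

inductive_set int_span :: "('g \<Rightarrow>\<^sub>0 int) set \<Rightarrow> ('g \<Rightarrow>\<^sub>0 int) set" for R where
  int_span_zero: "0 \<in> int_span R"
| int_span_gen: "r \<in> R \<Longrightarrow> r \<in> int_span R"
| int_span_diff: "\<lbrakk>x \<in> int_span R; y \<in> int_span R\<rbrakk> \<Longrightarrow> x - y \<in> int_span R"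

abbreviation gen :: "'g \<Rightarrow> ('g \<Rightarrow>\<^sub>0 int)" where
  "gen g \<equiv> Poly_Mapping.single g 1"

definition rel_class :: "('g \<Rightarrow>\<^sub>0 int) set \<Rightarrow> ('g \<Rightarrow>\<^sub>0 int) \<Rightarrow> ('g \<Rightarrow>\<^sub>0 int) set" where
  "rel_class R z = {w. w - z \<in> int_span R}"

definition presented_group :: "'g set \<Rightarrow> ('g \<Rightarrow>\<^sub>0 int) set \<Rightarrow> ('g \<Rightarrow>\<^sub>0 int) set ring" where
  "presented_group G R =
    \<lparr>carrier = {rel_class R z | z. Poly_Mapping.keys z \<subseteq> G},
     monoid.mult = (\<lambda>_ _. undefined), one = undefined,
     ring.zero = rel_class R 0,
     ring.add = (\<lambda>P Q. {p + q | p q. p \<in> P \<and> q \<in> Q})\<rparr>"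

text \<open>
  The additive map to \<open>G\<close> determined by its values \<open>f g\<close> on generators. It is evaluated on an
  arbitrary representative, and does not depend on it when \<open>f\<close> respects the relations.
\<close>

definition extend_additively ::
    "('b, 'x) ring_scheme \<Rightarrow> ('g \<Rightarrow> 'b) \<Rightarrow> ('g \<Rightarrow>\<^sub>0 int) set \<Rightarrow> 'b" where
  "extend_additively G f P =
    (let z = (SOME z. z \<in> P)
     in \<Oplus>\<^bsub>G\<^esub>g\<in>Poly_Mapping.keys z. [Poly_Mapping.lookup z g] \<cdot>\<^bsub>G\<^esub> f g)"

subsection \<open>The tensor product of a right module and a left module\<close>

text \<open>
  \<open>M \<otimes>\<^bsub>S\<^esub> N\<close>, for a set \<open>S\<close> of scalars acting on \<open>M\<close> from the right by \<open>rs\<close> and on \<open>N\<close> from the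
  left by \<open>ls\<close>.
\<close>

definition tensor_relations ::
    "'s set \<Rightarrow> ('m, 'x) ring_scheme \<Rightarrow> ('m \<Rightarrow> 's \<Rightarrow> 'm) \<Rightarrow> ('n, 'y) ring_scheme \<Rightarrow> ('s \<Rightarrow> 'n \<Rightarrow> 'n)
      \<Rightarrow> ('m \<times> 'n \<Rightarrow>\<^sub>0 int) set" where
  "tensor_relations S M rs N ls =
     {gen (x \<oplus>\<^bsub>M\<^esub> x', y) - gen (x, y) - gen (x', y) | x x' y.
        x \<in> carrier M \<and> x' \<in> carrier M \<and> y \<in> carrier N} \<union>
     {gen (x, y \<oplus>\<^bsub>N\<^esub> y') - gen (x, y) - gen (x, y') | x y y'.
        x \<in> carrier M \<and> y \<in> carrier N \<and> y' \<in> carrier N} \<union>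
     {gen (rs x s, y) - gen (x, ls s y) | x s y.
        x \<in> carrier M \<and> s \<in> S \<and> y \<in> carrier N}"

definition tensor ::
    "'s set \<Rightarrow> ('m, 'x) ring_scheme \<Rightarrow> ('m \<Rightarrow> 's \<Rightarrow> 'm) \<Rightarrow> ('n, 'y) ring_scheme \<Rightarrow> ('s \<Rightarrow> 'n \<Rightarrow> 'n)
      \<Rightarrow> ('m \<times> 'n \<Rightarrow>\<^sub>0 int) set ring" where
  "tensor S M rs N ls =
     presented_group (carrier M \<times> carrier N) (tensor_relations S M rs N ls)"

definition pure_tensor ::
    "'s set \<Rightarrow> ('m, 'x) ring_scheme \<Rightarrow> ('m \<Rightarrow> 's \<Rightarrow> 'm) \<Rightarrow> ('n, 'y) ring_scheme \<Rightarrow> ('s \<Rightarrow> 'n \<Rightarrow> 'n)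
      \<Rightarrow> 'm \<Rightarrow> 'n \<Rightarrow> ('m \<times> 'n \<Rightarrow>\<^sub>0 int) set" where
  "pure_tensor S M rs N ls x y = rel_class (tensor_relations S M rs N ls) (gen (x, y))"

section \<open>Evaluation, coevaluation and line modules\<close>

abbreviation bimodule_tensor ::
    "('a, 'x) ring_scheme \<Rightarrow> ('a, 'm) bimodule \<Rightarrow> ('a, 'n) bimodule \<Rightarrow> ('m \<times> 'n \<Rightarrow>\<^sub>0 int) set ring"
  where
  "bimodule_tensor A M N \<equiv> tensor (carrier A) M (rsmult M) N (smult N)"

abbreviation bimodule_pure_tensor ::
    "('a, 'x) ring_scheme \<Rightarrow> ('a, 'm) bimodule \<Rightarrow> ('a, 'n) bimodule \<Rightarrow> 'm \<Rightarrow> 'n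
      \<Rightarrow> ('m \<times> 'n \<Rightarrow>\<^sub>0 int) set"
  where
  "bimodule_pure_tensor A M N \<equiv> pure_tensor (carrier A) M (rsmult M) N (smult N)"

definition ev :: "('a, 'x) ring_scheme \<Rightarrow> ('a, 'm) bimodule \<Rightarrow> ('m \<times> ('m \<Rightarrow> 'a) \<Rightarrow>\<^sub>0 int) set \<Rightarrow> 'a"
  where
  "ev A E = extend_additively A (\<lambda>(e, \<alpha>). \<alpha> e)"

definition is_dual_basis ::
    "('a, 'x) ring_scheme \<Rightarrow> ('a, 'm) bimodule \<Rightarrow> nat \<times> (nat \<Rightarrow> 'm) \<times> (nat \<Rightarrow> 'm \<Rightarrow> 'a) \<Rightarrow> bool" where
  "is_dual_basis A E = (\<lambda>(n, u, d).
     u \<in> {..<n} \<rightarrow> carrier E \<and> d \<in> {..<n} \<rightarrow> carrier (dual_bimodule A E) \<and>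
     (\<forall>f\<in>carrier E. f = (\<Oplus>\<^bsub>E\<^esub>i\<in>{..<n}. d i f \<odot>\<^bsub>E\<^esub> u i)))"

text \<open>
  \<open>coev\<close> is the left module map with \<open>coev(1) = \<Sum>\<^sub>i e\<^sub>i \<otimes> e\<^sup>i\<close> for a dual basis, that is
  \<open>coev(a) = \<Sum>\<^sub>i a.e\<^sub>i \<otimes> e\<^sup>i\<close>. It does not depend on the dual basis.
\<close>

definition coev ::
    "('a, 'x) ring_scheme \<Rightarrow> ('a, 'm) bimodule \<Rightarrow> 'a \<Rightarrow> (('m \<Rightarrow> 'a) \<times> 'm \<Rightarrow>\<^sub>0 int) set" where
  "coev A E a =
    (let D = dual_bimodule A E; (n, u, d) = (SOME b. is_dual_basis A E b)
     in \<Oplus>\<^bsub>bimodule_tensor A D E\<^esub>i\<in>{..<n}. bimodule_pure_tensor A D E (a \<odot>\<^bsub>D\<^esub> d i) (u i))"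

definition weak_left_line_module :: "(complex, 'a) module \<Rightarrow> ('a, 'l) bimodule \<Rightarrow> bool" where
  "weak_left_line_module A L \<longleftrightarrow> bimodule A L \<and> fgp_left A L \<and>
     bij_betw (coev A L) (carrier A) (carrier (bimodule_tensor A (dual_bimodule A L) L))"

definition left_line_module :: "(complex, 'a) module \<Rightarrow> ('a, 'l) bimodule \<Rightarrow> bool" where
  "left_line_module A L \<longleftrightarrow> weak_left_line_module A L \<and>
     bij_betw (ev A L) (carrier (bimodule_tensor A L (dual_bimodule A L))) (carrier A)"

section \<open>The tensor algebra\<close>

subsection \<open>Simple tensors and their products\<close>

text \<open>
  \<open>Scalar a\<close> stands for the element \<open>a\<close> of \<open>A = L\<^sup>0\<close>, \<open>Vectors [x\<^sub>1, \<dots>, x\<^sub>n]\<close> for the simple tensor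
  \<open>x\<^sub>1 \<otimes> \<cdots> \<otimes> x\<^sub>n\<close> in \<open>L\<^sup>n\<close>, and \<open>Covectors [\<alpha>\<^sub>1, \<dots>, \<alpha>\<^sub>n]\<close> for \<open>\<alpha>\<^sub>1 \<otimes> \<cdots> \<otimes> \<alpha>\<^sub>n\<close> in \<open>L\<^sup>-\<^sup>n\<close>.
\<close>

datatype ('a, 'l) simple =
  Scalar 'a | Vectors "'l list" | Covectors "('l \<Rightarrow> 'a) list"

text \<open>The values of \<open>ev\<^sup>n\<close> and of its counterpart built from \<open>coev\<^sup>-\<^sup>1\<close> on simple tensors; the value
  \<open>1\<close> for \<open>n = 0\<close> makes the recursions start at \<open>ev\<close> and \<open>coev\<^sup>-\<^sup>1\<close> for \<open>n = 1\<close>.\<close>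

primrec ev_power ::
    "('a, 'x) ring_scheme \<Rightarrow> ('a, 'l) bimodule \<Rightarrow> 'l list \<Rightarrow> ('l \<Rightarrow> 'a) list \<Rightarrow> 'a" where
  "ev_power A L [] \<alpha>s = \<one>\<^bsub>A\<^esub>"
| "ev_power A L (x # xs) \<alpha>s =
     ev A L (bimodule_pure_tensor A L (dual_bimodule A L)
       (x \<triangleleft>\<^bsub>L\<^esub> ev_power A L xs (butlast \<alpha>s)) (last \<alpha>s))"

definition coev_inv ::
    "('a, 'x) ring_scheme \<Rightarrow> ('a, 'l) bimodule \<Rightarrow> (('l \<Rightarrow> 'a) \<times> 'l \<Rightarrow>\<^sub>0 int) set \<Rightarrow> 'a" where
  "coev_inv A L = inv_into (carrier A) (coev A L)"

primrec coev_inv_power ::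
    "('a, 'x) ring_scheme \<Rightarrow> ('a, 'l) bimodule \<Rightarrow> ('l \<Rightarrow> 'a) list \<Rightarrow> 'l list \<Rightarrow> 'a" where
  "coev_inv_power A L [] xs = \<one>\<^bsub>A\<^esub>"
| "coev_inv_power A L (\<alpha> # \<alpha>s) xs =
     coev_inv A L (bimodule_pure_tensor A (dual_bimodule A L) L
       (\<alpha> \<triangleleft>\<^bsub>dual_bimodule A L\<^esub> coev_inv_power A L \<alpha>s (butlast xs)) (last xs))"

text \<open>The left and right actions of \<open>A\<close>, with the empty tensor read as \<open>1\<close>.\<close>

fun left_act ::
    "('a, 'x) ring_scheme \<Rightarrow> ('a, 'l) bimodule \<Rightarrow> 'a \<Rightarrow> ('a, 'l) simple \<Rightarrow> ('a, 'l) simple" where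
  "left_act A L a (Scalar b) = Scalar (a \<otimes>\<^bsub>A\<^esub> b)"
| "left_act A L a (Vectors []) = Scalar a"
| "left_act A L a (Vectors (x # xs)) = Vectors (a \<odot>\<^bsub>L\<^esub> x # xs)"
| "left_act A L a (Covectors []) = Scalar a"
| "left_act A L a (Covectors (\<alpha> # \<alpha>s)) = Covectors (a \<odot>\<^bsub>dual_bimodule A L\<^esub> \<alpha> # \<alpha>s)"

definition right_act ::
    "('a, 'x) ring_scheme \<Rightarrow> ('a, 'l) bimodule \<Rightarrow> ('a, 'l) simple \<Rightarrow> 'a \<Rightarrow> ('a, 'l) simple" where
  "right_act A L w a = (case w of
     Scalar b \<Rightarrow> Scalar (b \<otimes>\<^bsub>A\<^esub> a)
   | Vectors xs \<Rightarrow>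
       (if xs = [] then Scalar a else Vectors (butlast xs @ [last xs \<triangleleft>\<^bsub>L\<^esub> a]))
   | Covectors \<alpha>s \<Rightarrow>
       (if \<alpha>s = [] then Scalar a
        else Covectors (butlast \<alpha>s @ [last \<alpha>s \<triangleleft>\<^bsub>dual_bimodule A L\<^esub> a])))"

fun simple_mult ::
    "('a, 'x) ring_scheme \<Rightarrow> ('a, 'l) bimodule \<Rightarrow> ('a, 'l) simple \<Rightarrow> ('a, 'l) simple \<Rightarrow> ('a, 'l) simple"
  where
  "simple_mult A L (Scalar a) w = left_act A L a w"
| "simple_mult A L (Vectors xs) (Scalar a) = right_act A L (Vectors xs) a"
| "simple_mult A L (Covectors \<alpha>s) (Scalar a) = right_act A L (Covectors \<alpha>s) a"
| "simple_mult A L (Vectors xs) (Vectors ys) = Vectors (xs @ ys)"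
| "simple_mult A L (Covectors \<alpha>s) (Covectors \<beta>s) = Covectors (\<alpha>s @ \<beta>s)"
| "simple_mult A L (Covectors \<alpha>s) (Vectors xs) =
    (let n = length \<alpha>s; m = length xs
     in if m \<ge> n then left_act A L (coev_inv_power A L \<alpha>s (take n xs)) (Vectors (drop n xs))
        else right_act A L (Covectors (take (n - m) \<alpha>s)) (coev_inv_power A L (drop (n - m) \<alpha>s) xs))"
| "simple_mult A L (Vectors xs) (Covectors \<alpha>s) =
    (let n = length xs; m = length \<alpha>s
     in if m \<ge> n then left_act A L (ev_power A L xs (take n \<alpha>s)) (Covectors (drop n \<alpha>s))
        else right_act A L (Vectors (take (n - m) xs)) (ev_power A L (drop (n - m) xs) \<alpha>s))"

subsection \<open>The tensor powers\<close>

text \<open>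
  The \<open>n\<close>-fold tensor power of \<open>M\<close> over \<open>A\<close> is realised without bracketing, as the abelian group
  generated by the \<open>n\<close>-tuples subject to additivity in each entry and to
  \<open>\<cdots> \<otimes> x.a \<otimes> y \<otimes> \<cdots> = \<cdots> \<otimes> x \<otimes> a.y \<otimes> \<cdots>\<close>. The injection \<open>W\<close> tags the tuples.
\<close>

definition power_gens :: "('m list \<Rightarrow> 'g) \<Rightarrow> ('a, 'm) bimodule \<Rightarrow> nat \<Rightarrow> 'g set" where
  "power_gens W M n = {W xs | xs. length xs = n \<and> set xs \<subseteq> carrier M}"

definition power_relations ::
    "('m list \<Rightarrow> 'g) \<Rightarrow> ('a, 'x) ring_scheme \<Rightarrow> ('a, 'm) bimodule \<Rightarrow> nat \<Rightarrow> ('g \<Rightarrow>\<^sub>0 int) set" where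
  "power_relations W A M n =
     {gen (W (us @ (x \<oplus>\<^bsub>M\<^esub> y) # vs)) - gen (W (us @ x # vs)) - gen (W (us @ y # vs)) | us x y vs.
        set us \<subseteq> carrier M \<and> x \<in> carrier M \<and> y \<in> carrier M \<and> set vs \<subseteq> carrier M \<and>
        length us + 1 + length vs = n} \<union>
     {gen (W (us @ (x \<triangleleft>\<^bsub>M\<^esub> a) # y # vs)) - gen (W (us @ x # (a \<odot>\<^bsub>M\<^esub> y) # vs)) | us x a y vs.
        set us \<subseteq> carrier M \<and> x \<in> carrier M \<and> a \<in> carrier A \<and> y \<in> carrier M \<and> set vs \<subseteq> carrier M \<and>
        length us + 2 + length vs = n}"

text \<open>\<open>L\<^sup>n\<close> for an integer \<open>n\<close>; in degree \<open>0\<close> the presentation gives a copy of the additive group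
  of \<open>A\<close>.\<close>

definition line_gens ::
    "('a, 'x) ring_scheme \<Rightarrow> ('a, 'l) bimodule \<Rightarrow> int \<Rightarrow> ('a, 'l) simple set" where
  "line_gens A L n =
    (if n = 0 then Scalar ` carrier A
     else if n > 0 then power_gens Vectors L (nat n)
     else power_gens Covectors (dual_bimodule A L) (nat (- n)))"

definition line_relations ::
    "('a, 'x) ring_scheme \<Rightarrow> ('a, 'l) bimodule \<Rightarrow> int \<Rightarrow> (('a, 'l) simple \<Rightarrow>\<^sub>0 int) set" where
  "line_relations A L n =
    (if n = 0 then
       {gen (Scalar (a \<oplus>\<^bsub>A\<^esub> b)) - gen (Scalar a) - gen (Scalar b) | a b.
          a \<in> carrier A \<and> b \<in> carrier A}
     else if n > 0 then power_relations Vectors A L (nat n)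
     else power_relations Covectors A (dual_bimodule A L) (nat (- n)))"

definition line_power ::
    "('a, 'x) ring_scheme \<Rightarrow> ('a, 'l) bimodule \<Rightarrow> int \<Rightarrow> (('a, 'l) simple \<Rightarrow>\<^sub>0 int) set ring" where
  "line_power A L n = presented_group (line_gens A L n) (line_relations A L n)"

definition simple_tensor ::
    "('a, 'x) ring_scheme \<Rightarrow> ('a, 'l) bimodule \<Rightarrow> int \<Rightarrow> ('a, 'l) simple
      \<Rightarrow> (('a, 'l) simple \<Rightarrow>\<^sub>0 int) set" where
  "simple_tensor A L n w = rel_class (line_relations A L n) (gen w)"

definition line_power_mult ::
    "('a, 'x) ring_scheme \<Rightarrow> ('a, 'l) bimodule \<Rightarrow> int \<Rightarrow> int
      \<Rightarrow> (('a, 'l) simple \<Rightarrow>\<^sub>0 int) set \<Rightarrow> (('a, 'l) simple \<Rightarrow>\<^sub>0 int) set \<Rightarrow> (('a, 'l) simple \<Rightarrow>\<^sub>0 int) set"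
  where
  "line_power_mult A L n m P Q =
     extend_additively (line_power A L (n + m))
       (\<lambda>v. extend_additively (line_power A L (n + m))
          (\<lambda>w. simple_tensor A L (n + m) (simple_mult A L v w)) Q) P"

definition line_power_smult ::
    "(complex, 'a) module \<Rightarrow> ('a, 'l) bimodule \<Rightarrow> int \<Rightarrow> complex
      \<Rightarrow> (('a, 'l) simple \<Rightarrow>\<^sub>0 int) set \<Rightarrow> (('a, 'l) simple \<Rightarrow>\<^sub>0 int) set" where
  "line_power_smult A L n c =
     extend_additively (line_power A L n)
       (\<lambda>w. simple_tensor A L n (left_act A L (c \<odot>\<^bsub>A\<^esub> \<one>\<^bsub>A\<^esub>) w))"

subsection \<open>The direct sum of the tensor powers as an algebra\<close>

definition tensor_algebra_inject ::
    "(complex, 'a) module \<Rightarrow> ('a, 'l) bimodule \<Rightarrow> 'a \<Rightarrow> int \<Rightarrow> (('a, 'l) simple \<Rightarrow>\<^sub>0 int) set" where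
  "tensor_algebra_inject A L a =
     (\<lambda>n. if n = 0 then simple_tensor A L 0 (Scalar a) else \<zero>\<^bsub>line_power A L n\<^esub>)"

definition tensor_algebra ::
    "(complex, 'a) module \<Rightarrow> ('a, 'l) bimodule
      \<Rightarrow> (complex, int \<Rightarrow> (('a, 'l) simple \<Rightarrow>\<^sub>0 int) set) module" where
  "tensor_algebra A L =
    \<lparr>carrier = {f. (\<forall>n. f n \<in> carrier (line_power A L n)) \<and>
                   finite {n. f n \<noteq> \<zero>\<^bsub>line_power A L n\<^esub>}},
     monoid.mult = (\<lambda>f g k. \<Oplus>\<^bsub>line_power A L k\<^esub>n\<in>{n. f n \<noteq> \<zero>\<^bsub>line_power A L n\<^esub>}.
                       line_power_mult A L n (k - n) (f n) (g (k - n))),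
     one = tensor_algebra_inject A L \<one>\<^bsub>A\<^esub>,
     ring.zero = (\<lambda>n. \<zero>\<^bsub>line_power A L n\<^esub>),
     ring.add = (\<lambda>f g n. f n \<oplus>\<^bsub>line_power A L n\<^esub> g n),
     smult = (\<lambda>c f n. line_power_smult A L n c (f n))\<rparr>"

definition tensor_algebra_degree ::
    "(complex, 'a) module \<Rightarrow> ('a, 'l) bimodule \<Rightarrow> int
      \<Rightarrow> (int \<Rightarrow> (('a, 'l) simple \<Rightarrow>\<^sub>0 int) set) set" where
  "tensor_algebra_degree A L n =
     {f \<in> carrier (tensor_algebra A L). \<forall>k. k \<noteq> n \<longrightarrow> f k = \<zero>\<^bsub>line_power A L k\<^esub>}"

section \<open>Hopf-Galois extensions for the group algebra of the integers\<close>

definition homogeneous_decomposition ::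
    "(complex, 'c) module \<Rightarrow> (int \<Rightarrow> 'c set) \<Rightarrow> 'c \<Rightarrow> (int \<Rightarrow> 'c) \<Rightarrow> bool" where
  "homogeneous_decomposition C gr c f \<longleftrightarrow>
     (\<forall>n. f n \<in> gr n) \<and> finite {n. f n \<noteq> \<zero>\<^bsub>C\<^esub>} \<and> c = (\<Oplus>\<^bsub>C\<^esub>n\<in>{n. f n \<noteq> \<zero>\<^bsub>C\<^esub>}. f n)"

definition homogeneous_component ::
    "(complex, 'c) module \<Rightarrow> (int \<Rightarrow> 'c set) \<Rightarrow> 'c \<Rightarrow> int \<Rightarrow> 'c" where
  "homogeneous_component C gr c = (THE f. homogeneous_decomposition C gr c f)"

definition graded_algebra :: "(complex, 'c) module \<Rightarrow> (int \<Rightarrow> 'c set) \<Rightarrow> bool" where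
  "graded_algebra C gr \<longleftrightarrow> complex_algebra C \<and>
     (\<forall>n. gr n \<subseteq> carrier C \<and> \<zero>\<^bsub>C\<^esub> \<in> gr n \<and>
        (\<forall>x\<in>gr n. \<forall>y\<in>gr n. x \<oplus>\<^bsub>C\<^esub> y \<in> gr n) \<and> (\<forall>z. \<forall>x\<in>gr n. z \<odot>\<^bsub>C\<^esub> x \<in> gr n)) \<and>
     \<one>\<^bsub>C\<^esub> \<in> gr 0 \<and>
     (\<forall>m n. \<forall>x\<in>gr m. \<forall>y\<in>gr n. x \<otimes>\<^bsub>C\<^esub> y \<in> gr (m + n)) \<and>
     (\<forall>c\<in>carrier C. \<exists>!f. homogeneous_decomposition C gr c f)"

text \<open>
  The multiplication of \<^typ>\<open>int \<Rightarrow>\<^sub>0 complex\<close> is convolution, so this type is the group algebra of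
  the integers; \<^term>\<open>Poly_Mapping.single n (1 :: complex)\<close> is the basis element of \<open>n\<close>.
\<close>

definition int_group_algebra :: "(complex, int \<Rightarrow>\<^sub>0 complex) module" where
  "int_group_algebra =
    \<lparr>carrier = UNIV, monoid.mult = (*), one = 1, ring.zero = 0, ring.add = (+),
     smult = (\<lambda>z p. Poly_Mapping.single 0 z * p)\<rparr>"

abbreviation galois_source ::
    "(complex, 'c) module \<Rightarrow> (int \<Rightarrow> 'c set) \<Rightarrow> ('c \<times> 'c \<Rightarrow>\<^sub>0 int) set ring" where
  "galois_source C gr \<equiv> tensor (gr 0) C (monoid.mult C) C (monoid.mult C)"

abbreviation galois_target ::
    "(complex, 'c) module \<Rightarrow> ('c \<times> (int \<Rightarrow>\<^sub>0 complex) \<Rightarrow>\<^sub>0 int) set ring" where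
  "galois_target C \<equiv>
     tensor (UNIV :: complex set) C (\<lambda>c z. z \<odot>\<^bsub>C\<^esub> c) int_group_algebra (smult int_group_algebra)"

abbreviation galois_target_pure ::
    "(complex, 'c) module \<Rightarrow> 'c \<Rightarrow> (int \<Rightarrow>\<^sub>0 complex) \<Rightarrow> ('c \<times> (int \<Rightarrow>\<^sub>0 complex) \<Rightarrow>\<^sub>0 int) set" where
  "galois_target_pure C \<equiv>
     pure_tensor (UNIV :: complex set) C (\<lambda>c z. z \<odot>\<^bsub>C\<^esub> c) int_group_algebra (smult int_group_algebra)"

definition canonical_map ::
    "(complex, 'c) module \<Rightarrow> (int \<Rightarrow> 'c set) \<Rightarrow> ('c \<times> 'c \<Rightarrow>\<^sub>0 int) set
      \<Rightarrow> ('c \<times> (int \<Rightarrow>\<^sub>0 complex) \<Rightarrow>\<^sub>0 int) set" where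
  "canonical_map C gr =
     extend_additively (galois_target C)
       (\<lambda>(c, c'). \<Oplus>\<^bsub>galois_target C\<^esub>m\<in>{m. homogeneous_component C gr c' m \<noteq> \<zero>\<^bsub>C\<^esub>}.
          galois_target_pure C (c \<otimes>\<^bsub>C\<^esub> homogeneous_component C gr c' m) (Poly_Mapping.single m 1))"

text \<open>\<open>j\<close> is the identification of \<open>A\<close> with the degree zero part of \<open>C\<close>.\<close>

definition hopf_galois_extension ::
    "(complex, 'a) module \<Rightarrow> ('a \<Rightarrow> 'c) \<Rightarrow> (complex, 'c) module \<Rightarrow> (int \<Rightarrow> 'c set) \<Rightarrow> bool" where
  "hopf_galois_extension A j C gr \<longleftrightarrow>
     graded_algebra C gr \<and>
     j \<in> ring_iso A (C\<lparr>carrier := gr 0\<rparr>) \<and>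
     (\<forall>z. \<forall>a\<in>carrier A. j (z \<odot>\<^bsub>A\<^esub> a) = z \<odot>\<^bsub>C\<^esub> j a) \<and>
     bij_betw (canonical_map C gr) (carrier (galois_source C gr)) (carrier (galois_target C))"

end

theory Submission
  imports Defs
begin

text \<open>
  For a weak left line module, \<open>\<langle>\<alpha>, x\<rangle> = coev\<^sup>-\<^sup>1(\<alpha> \<otimes> x)\<close> is the unique \<open>a\<close> with \<open>y.a = \<alpha>(y).x\<close> for all
  \<open>y\<close>, so it forms with \<open>ev\<close> a Morita context whose pairing \<open>\<langle>_, _\<rangle>\<close> attains \<open>1\<close>. The identities of this
  context make the tensor algebra \<open>T\<close> associative. All calculations are done on integer combinations
  of words, modulo the span of the defining relations.

  The canonical map is bijective if for every \<open>m\<close> there are \<open>u\<^sub>i \<in> T\<^sub>-\<^sub>m\<close> and \<open>v\<^sub>i \<in> T\<^sub>m\<close> with \<open>\<Sum>\<^sub>i u\<^sub>i v\<^sub>i = 1\<close>,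
  the inverse being \<open>c \<otimes> m \<mapsto> \<Sum>\<^sub>i c u\<^sub>i \<otimes> v\<^sub>i\<close>; conversely its surjectivity provides such elements. The
  condition is inherited by sums of degrees and holds for \<open>m = 1\<close> by the dual basis, so only
  \<open>m = -1\<close> matters, where it says that \<open>ev\<close> attains \<open>1\<close>. By the usual Morita argument this is
  equivalent to the bijectivity of \<open>ev\<close>.
\<close>

section \<open>Presented abelian groups\<close>

text \<open>The powers \<open>L^n\<close> are presented one degree at a time, whereas associativity
  mixes degrees of both signs and, with the product given by lengths, splits into many cases. So all
  words go into one free abelian group and all relations into one span; relations are homogeneous,
  hence projecting to a degree recovers the separate presentations. There the product is rewritten
  as letters acting one at a time, each cancelling against an opposite first letter. What remains is
  how a letter passes a scalar and how two opposite letters cancel. Weakness of the line module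
  enters twice: surjectivity of \<open>coev\<close> produces the pairing, and injectivity makes the
  right action of \<open>A\<close> on \<open>L\<close> faithful, so that identities can be tested on
  elements of \<open>L\<close>. For the canonical map, the degrees of \<open>u_i\<close> and
  \<open>v_i\<close> are what matters: for \<open>y\<close> of degree \<open>m\<close> the product
  \<open>y u_i\<close> has degree 0, so it may cross the tensor sign over the degree zero
  part.\<close>

abbreviation supported :: "('g \<Rightarrow>\<^sub>0 'z::zero) \<Rightarrow> 'g set \<Rightarrow> bool" (infix "upon" 50) where
  "z upon S \<equiv> Poly_Mapping.keys z \<subseteq> S"

lemma int_span_uminus: "x \<in> int_span R \<Longrightarrow> - x \<in> int_span R"
  using int_span_diff[OF int_span_zero, of x R] by simp

lemma int_span_add: "x \<in> int_span R \<Longrightarrow> y \<in> int_span R \<Longrightarrow> x + y \<in> int_span R"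
  using int_span_diff[OF _ int_span_uminus, of x R y] by simp

text \<open>Classes are cosets in the free group on the whole type. This keeps every representative
  of a class, in particular the one chosen by \<open>extend_additively\<close>, on the intended
  generators.\<close>

lemma keys_int_span:
  assumes "x \<in> int_span R" and "\<And>r. r \<in> R \<Longrightarrow> r upon G"
  shows "x upon G"
  using assms(1)
proof induction
  case (int_span_diff x y)
  then show ?case using keys_diff[of x y] by blast
qed (use assms(2) in auto)

lemma rel_class_eq_iff: "rel_class R z = rel_class R w \<longleftrightarrow> z - w \<in> int_span R"
proof
  assume "rel_class R z = rel_class R w"
  moreover have "z \<in> rel_class R z" by (simp add: rel_class_def int_span_zero)
  ultimately show "z - w \<in> int_span R" by (simp add: rel_class_def)
next
  assume *: "z - w \<in> int_span R"
  have "x - w \<in> int_span R \<longleftrightarrow> x - z \<in> int_span R" for x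
    using int_span_add[OF _ *, of "x - z"] int_span_diff[OF _ *, of "x - w"] by auto
  then show "rel_class R z = rel_class R w" by (auto simp: rel_class_def)
qed

text \<open>Equality of classes serves as congruence modulo the span from here on, so that
  calculations with representatives become chains of equations.\<close>

lemma rel_class_add_cong:
  "rel_class R z = rel_class R z' \<Longrightarrow> rel_class R w = rel_class R w' \<Longrightarrow>
    rel_class R (z + w) = rel_class R (z' + w')"
  using int_span_add[of "z - z'" R "w - w'"] by (simp add: rel_class_eq_iff algebra_simps)

lemma rel_class_diff_cong:
  "rel_class R z = rel_class R z' \<Longrightarrow> rel_class R w = rel_class R w' \<Longrightarrow>
    rel_class R (z - w) = rel_class R (z' - w')"
  using int_span_diff[of "z - z'" R "w - w'"] by (simp add: rel_class_eq_iff algebra_simps)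

lemma rel_class_sum_cong:
  "(\<And>i. i \<in> I \<Longrightarrow> rel_class R (f i) = rel_class R (g i)) \<Longrightarrow>
    rel_class R (sum f I) = rel_class R (sum g I)"
proof (induction I rule: infinite_finite_induct)
  case (insert i I)
  then have "rel_class R (f i) = rel_class R (g i)" "rel_class R (sum f I) = rel_class R (sum g I)"
    by simp_all
  then show ?case unfolding sum.insert[OF insert.hyps] by (rule rel_class_add_cong)
qed simp_all

lemma frag_extend_cong_class:
  assumes "z upon G"
    and "\<And>g. g \<in> G \<Longrightarrow> rel_class R (\<phi> g) = rel_class R (\<psi> g)"
  shows "rel_class R (frag_extend \<phi> z) = rel_class R (frag_extend \<psi> z)"
  using assms(1)
proof (induction z rule: frag_induction)
  case (diff a b)
  then show ?case by (simp only: frag_extend_diff) (rule rel_class_diff_cong)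
qed (simp_all add: assms(2))

text \<open>\<open>frag_extend\<close> is the additive extension to the free abelian group. This is
  the criterion for such an extension to descend to the presented groups.\<close>

lemma frag_extend_int_span:
  assumes "\<And>r. r \<in> R \<Longrightarrow> frag_extend \<phi> r \<in> int_span R'" and "z \<in> int_span R"
  shows "frag_extend \<phi> z \<in> int_span R'"
  using assms(2)
  by induction (auto simp: frag_extend_diff assms(1) intro: int_span.intros)

lemma frag_extend_class_cong:
  assumes "\<And>r. r \<in> R \<Longrightarrow> frag_extend \<phi> r \<in> int_span R'" and "rel_class R z = rel_class R w"
  shows "rel_class R' (frag_extend \<phi> z) = rel_class R' (frag_extend \<phi> w)"
  using frag_extend_int_span[OF assms(1), of R "z - w"] assms(2)
  by (simp add: rel_class_eq_iff frag_extend_diff)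

lemma frag_extend_subset:
  assumes "z upon G" and "\<And>g. g \<in> G \<Longrightarrow> (\<phi> g) upon G'"
  shows "(frag_extend \<phi> z) upon G'"
  using keys_frag_extend[of \<phi> z] assms by blast

lemma keys_sum_subset:
  "(\<And>i. i \<in> I \<Longrightarrow> (f i) upon G) \<Longrightarrow> (sum f I) upon G"
  using keys_sum[of f I] by blast

lemma keys_add_subset:
  "z upon G \<Longrightarrow> w upon G \<Longrightarrow> (z + w) upon G"
  using Poly_Mapping.keys_add[of z w] by blast

lemma keys_diff_subset:
  "z upon G \<Longrightarrow> w upon G \<Longrightarrow> (z - w) upon G"
  using keys_diff[of z w] by blast

section \<open>Presented groups are abelian groups\<close>

lemma presented_carrier:
  "carrier (presented_group G R) = rel_class R ` {z. z upon G}"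
  by (auto simp: presented_group_def)

lemma presented_zero: "\<zero>\<^bsub>presented_group G R\<^esub> = rel_class R 0"
  by (simp add: presented_group_def)

lemma presented_add: "rel_class R z \<oplus>\<^bsub>presented_group G R\<^esub> rel_class R w = rel_class R (z + w)"
proof -
  have "{p + q |p q. p \<in> rel_class R z \<and> q \<in> rel_class R w} = rel_class R (z + w)"
  proof (intro subset_antisym subsetI)
    fix x assume "x \<in> {p + q |p q. p \<in> rel_class R z \<and> q \<in> rel_class R w}"
    then obtain p q where "x = p + q" "p - z \<in> int_span R" "q - w \<in> int_span R"
      by (auto simp: rel_class_def)
    then show "x \<in> rel_class R (z + w)"
      using int_span_add[of "p - z" R "q - w"] by (simp add: rel_class_def algebra_simps)
  next
    \<comment> \<open>One summand may be taken to be \<open>w\<close> itself; the rest then lies in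
      the class of \<open>z\<close>.\<close>
    fix x assume "x \<in> rel_class R (z + w)"
    then have "x - w \<in> rel_class R z" "w \<in> rel_class R w"
      by (auto simp: rel_class_def int_span_zero algebra_simps)
    then show "x \<in> {p + q |p q. p \<in> rel_class R z \<and> q \<in> rel_class R w}"
      by (metis (mono_tags, lifting) diff_add_cancel mem_Collect_eq)
  qed
  then show ?thesis by (simp add: presented_group_def)
qed

lemma presented_closed:
  "z upon G \<Longrightarrow> rel_class R z \<in> carrier (presented_group G R)"
  by (auto simp: presented_carrier)

lemma presented_abelian_group: "abelian_group (presented_group G R)"
proof (rule abelian_groupI)
  fix x assume "x \<in> carrier (presented_group G R)"
  then obtain z where z: "x = rel_class R z" "z upon G"
    by (auto simp: presented_carrier)
  show "\<exists>y\<in>carrier (presented_group G R). y \<oplus>\<^bsub>presented_group G R\<^esub> x = \<zero>\<^bsub>presented_group G R\<^esub>"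
    by (rule bexI[of _ "rel_class R (- z)"])
      (simp_all add: z presented_add presented_zero presented_closed)
next
  fix x y :: "('a \<Rightarrow>\<^sub>0 int) set"
  assume "x \<in> carrier (presented_group G R)" "y \<in> carrier (presented_group G R)"
  then obtain z w where "x = rel_class R z" "y = rel_class R w"
    "z upon G" "w upon G"
    by (auto simp: presented_carrier)
  then show "x \<oplus>\<^bsub>presented_group G R\<^esub> y \<in> carrier (presented_group G R)"
    by (simp add: presented_add presented_closed keys_add_subset)
qed (auto simp: presented_carrier presented_add presented_zero ac_simps)

lemma presented_uminus:
  assumes "z upon G"
  shows "\<ominus>\<^bsub>presented_group G R\<^esub> rel_class R z = rel_class R (- z)"
proof -
  interpret abelian_group "presented_group G R" by (rule presented_abelian_group)
  show ?thesis
    by (rule minus_equality) (use assms in \<open>auto simp: presented_add presented_zero intro!: presented_closed\<close>)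
qed

lemma presented_minus:
  assumes "w upon G"
  shows "rel_class R z \<ominus>\<^bsub>presented_group G R\<^esub> rel_class R w = rel_class R (z - w)"
  by (simp add: a_minus_def presented_uminus[OF assms] presented_add)

lemma presented_finsum:
  assumes "finite I" "\<And>i. i \<in> I \<Longrightarrow> (f i) upon G"
  shows "(\<Oplus>\<^bsub>presented_group G R\<^esub>i\<in>I. rel_class R (f i)) = rel_class R (sum f I)"
proof -
  interpret abelian_group "presented_group G R" by (rule presented_abelian_group)
  show ?thesis using assms
  proof (induction I rule: finite_induct)
    case (insert i I)
    then show ?case
      by (subst finsum_insert) (auto simp: presented_add intro!: presented_closed)
  qed (simp add: presented_zero)
qed

lemma presented_finsum_eq:
  assumes "finite I" "\<And>i. i \<in> I \<Longrightarrow> (f i) upon G"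
    and "\<And>i. i \<in> I \<Longrightarrow> h i = rel_class R (f i)"
  shows "(\<Oplus>\<^bsub>presented_group G R\<^esub>i\<in>I. h i) = rel_class R (sum f I)"
proof -
  interpret abelian_group "presented_group G R" by (rule presented_abelian_group)
  have "(\<Oplus>\<^bsub>presented_group G R\<^esub>i\<in>I. h i) = (\<Oplus>\<^bsub>presented_group G R\<^esub>i\<in>I. rel_class R (f i))"
    by (rule finsum_cong') (use assms in \<open>auto intro!: presented_closed\<close>)
  with presented_finsum[OF assms(1,2)] show ?thesis by simp
qed

section \<open>Additive extension of functions on generators\<close>

text \<open>This is \<open>extend_additively\<close> before a representative is chosen. Unlike the
  latter it is visibly additive, and it applies to functions that are not yet known to respect
  relations.\<close>

definition additive_ext :: "('b, 'x) ring_scheme \<Rightarrow> ('g \<Rightarrow> 'b) \<Rightarrow> ('g \<Rightarrow>\<^sub>0 int) \<Rightarrow> 'b" where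
  "additive_ext H f z =
    (\<Oplus>\<^bsub>H\<^esub>g\<in>Poly_Mapping.keys z. [Poly_Mapping.lookup z g] \<cdot>\<^bsub>H\<^esub> f g)"

lemma add_pow_int_zero: "[(0::int)] \<cdot>\<^bsub>H\<^esub> x = \<zero>\<^bsub>H\<^esub>"
  by (simp add: add_pow_def)

context abelian_group
begin

lemma additive_ext_superset:
  assumes "finite K" "z upon K" "f \<in> K \<rightarrow> carrier G"
  shows "additive_ext G f z = (\<Oplus>g\<in>K. [Poly_Mapping.lookup z g] \<cdot> f g)"
  unfolding additive_ext_def
  by (rule add.finprod_mono_neutral_cong_left)
    (use assms in \<open>auto simp: in_keys_iff Pi_iff add_pow_int_zero intro!: add.int_pow_closed\<close>)

lemma additive_ext_closed:
  assumes "z upon S" "f \<in> S \<rightarrow> carrier G"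
  shows "additive_ext G f z \<in> carrier G"
  unfolding additive_ext_def using assms by (auto intro!: finsum_closed add.int_pow_closed)

lemma additive_ext_zero [simp]: "additive_ext G f 0 = \<zero>"
  by (simp add: additive_ext_def)

lemma additive_ext_gen: "f g \<in> carrier G \<Longrightarrow> additive_ext G f (gen g) = f g"
  by (simp add: additive_ext_def finsum_insert add.int_pow_1)

lemma additive_ext_add:
  assumes "z upon S" "w upon S" "f \<in> S \<rightarrow> carrier G"
  shows "additive_ext G f (z + w) = additive_ext G f z \<oplus> additive_ext G f w"
proof -
  \<comment> \<open>Cancellation can make the keys of \<open>z + w\<close> smaller than this union,
    so all three sums are taken over the union.\<close>
  define K where "K = Poly_Mapping.keys z \<union> Poly_Mapping.keys w"
  have K: "finite K" "z upon K" "w upon K"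
    "(z + w) upon K" "f \<in> K \<rightarrow> carrier G"
    using Poly_Mapping.keys_add[of z w] assms by (auto simp: K_def)
  have "additive_ext G f (z + w) = (\<Oplus>g\<in>K. [Poly_Mapping.lookup (z + w) g] \<cdot> f g)"
    by (rule additive_ext_superset) (use K in auto)
  also have "\<dots> = (\<Oplus>g\<in>K. [Poly_Mapping.lookup z g] \<cdot> f g \<oplus> [Poly_Mapping.lookup w g] \<cdot> f g)"
    by (rule finsum_cong') (use K(5) in \<open>auto simp: lookup_add add.int_pow_mult Pi_iff intro!: add.int_pow_closed\<close>)
  also have "\<dots> = (\<Oplus>g\<in>K. [Poly_Mapping.lookup z g] \<cdot> f g) \<oplus> (\<Oplus>g\<in>K. [Poly_Mapping.lookup w g] \<cdot> f g)"
    by (rule finsum_addf) (use K(5) in \<open>auto intro!: add.int_pow_closed\<close>)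
  also have "\<dots> = additive_ext G f z \<oplus> additive_ext G f w"
    using additive_ext_superset[OF K(1) K(2) K(5)] additive_ext_superset[OF K(1) K(3) K(5)] by simp
  finally show ?thesis .
qed

lemma additive_ext_uminus:
  assumes "z upon S" "f \<in> S \<rightarrow> carrier G"
  shows "additive_ext G f (- z) = \<ominus> additive_ext G f z"
proof -
  have "additive_ext G f (- z) \<oplus> additive_ext G f z = \<zero>"
    using additive_ext_add[of "- z" S z f] assms by simp
  then show ?thesis
    using assms by (metis additive_ext_closed keys_minus minus_equality)
qed

lemma additive_ext_diff:
  assumes "z upon S" "w upon S" "f \<in> S \<rightarrow> carrier G"
  shows "additive_ext G f (z - w) = additive_ext G f z \<ominus> additive_ext G f w"
  using additive_ext_add[of z S "- w" f] additive_ext_uminus[of w S f] assms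
  by (simp add: a_minus_def)

lemma additive_ext_sum:
  assumes "finite I" "\<And>i. i \<in> I \<Longrightarrow> (z i) upon S" "f \<in> S \<rightarrow> carrier G"
  shows "additive_ext G f (sum z I) = (\<Oplus>i\<in>I. additive_ext G f (z i))"
  using assms(1,2)
proof (induction I rule: finite_induct)
  case (insert i I)
  have "additive_ext G f (z i + sum z I) = additive_ext G f (z i) \<oplus> additive_ext G f (sum z I)"
    by (rule additive_ext_add[OF _ _ assms(3)]) (use insert in \<open>auto intro!: keys_sum_subset\<close>)
  moreover have "(\<lambda>i. additive_ext G f (z i)) \<in> I \<rightarrow> carrier G" "additive_ext G f (z i) \<in> carrier G"
    using insert.prems assms(3) by (auto intro!: additive_ext_closed)
  ultimately show ?case using insert by (simp add: finsum_insert)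
qed simp

lemma additive_ext_int_span:
  assumes f: "f \<in> S \<rightarrow> carrier G" and R: "\<And>r. r \<in> R \<Longrightarrow> r upon S"
    and "\<And>r. r \<in> R \<Longrightarrow> additive_ext G f r = \<zero>" and "z \<in> int_span R"
  shows "additive_ext G f z = \<zero>"
  using assms(4)
proof induction
  case (int_span_diff x y)
  then show ?case
    using additive_ext_diff[OF keys_int_span[of x, OF _ R] keys_int_span[of y, OF _ R] f]
    by (simp add: a_minus_def)
qed (use assms in auto)

text \<open>The chosen representative differs from \<open>z\<close> by an element of the span, on
  which the extension vanishes.\<close>

lemma extend_additively_class:
  assumes f: "f \<in> S \<rightarrow> carrier G" and R: "\<And>r. r \<in> R \<Longrightarrow> r upon S"
    and "\<And>r. r \<in> R \<Longrightarrow> additive_ext G f r = \<zero>" and z: "z upon S"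
  shows "extend_additively G f (rel_class R z) = additive_ext G f z"
proof -
  define w where "w = (SOME w. w \<in> rel_class R z)"
  have "z \<in> rel_class R z" by (simp add: rel_class_def int_span_zero)
  then have "w \<in> rel_class R z" unfolding w_def by (rule someI)
  then have d: "w - z \<in> int_span R" by (simp add: rel_class_def)
  have "additive_ext G f w = additive_ext G f ((w - z) + z)" by simp
  also have "\<dots> = additive_ext G f z"
    using additive_ext_add[OF keys_int_span[OF d R] z f] additive_ext_int_span[OF f R assms(3) d]
      additive_ext_closed[OF z f] by simp
  finally show ?thesis by (simp add: extend_additively_def additive_ext_def Let_def w_def)
qed

lemma finsum_additive_hom:
  assumes "abelian_group H" "finite I" "f \<in> I \<rightarrow> carrier G"
    and "h \<in> carrier G \<rightarrow> carrier H"
    and "\<And>x y. x \<in> carrier G \<Longrightarrow> y \<in> carrier G \<Longrightarrow> h (x \<oplus> y) = h x \<oplus>\<^bsub>H\<^esub> h y"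
  shows "h (\<Oplus>i\<in>I. f i) = (\<Oplus>\<^bsub>H\<^esub>i\<in>I. h (f i))"
proof -
  interpret H: abelian_group H by fact
  have "h \<zero> \<oplus>\<^bsub>H\<^esub> h \<zero> = h \<zero> \<oplus>\<^bsub>H\<^esub> \<zero>\<^bsub>H\<^esub>"
    using assms(4) assms(5)[of \<zero> \<zero>] by (simp add: Pi_iff)
  then have h0: "h \<zero> = \<zero>\<^bsub>H\<^esub>" using assms(4) by (simp add: Pi_iff)
  show ?thesis using assms(2,3)
  proof (induction I rule: finite_induct)
    case (insert i I)
    then have "f i \<in> carrier G" "f \<in> I \<rightarrow> carrier G" "(\<lambda>i. h (f i)) \<in> I \<rightarrow> carrier H" "h (f i) \<in> carrier H"
      using assms(4) by auto
    with insert show ?case by (simp add: finsum_insert H.finsum_insert assms(5))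
  qed (simp add: h0)
qed

end

text \<open>When the target is presented as well, the extension is computed upstairs by
  \<open>frag_extend\<close>. This is what reduces all later maps to integer combinations of
  generators.\<close>

lemma additive_ext_presented:
  assumes "z upon G" and "\<And>g. g \<in> G \<Longrightarrow> f g = rel_class R' (\<phi> g)"
    and "\<And>g. g \<in> G \<Longrightarrow> (\<phi> g) upon G'"
  shows "additive_ext (presented_group G' R') f z = rel_class R' (frag_extend \<phi> z)"
proof -
  interpret H: abelian_group "presented_group G' R'" by (rule presented_abelian_group)
  have f: "f \<in> G \<rightarrow> carrier (presented_group G' R')"
    using assms(2,3) by (simp add: presented_closed Pi_iff)
  \<comment> \<open>The support is part of the induction claim because \<open>frag_induction\<close>
    does not supply it for the two terms of a difference. The same device recurs below.\<close>
  have "additive_ext (presented_group G' R') f z = rel_class R' (frag_extend \<phi> z)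
    \<and> z upon G"
    using assms(1)
  proof (induction z rule: frag_induction)
    case zero
    then show ?case by (simp add: presented_zero)
  next
    case (one x)
    then show ?case using f by (simp add: H.additive_ext_gen assms(2) Pi_iff)
  next
    case (diff a b)
    moreover have "(frag_extend \<phi> b) upon G'"
      using diff assms(3) by (intro frag_extend_subset[of b G]) auto
    ultimately show ?case
      using H.additive_ext_diff[OF _ _ f, of a b]
      by (simp add: frag_extend_diff keys_diff_subset presented_minus)
  qed
  then show ?thesis ..
qed

lemma extend_additively_presented:
  assumes "z upon G" and "\<And>g. g \<in> G \<Longrightarrow> f g = rel_class R' (\<phi> g)"
    and "\<And>g. g \<in> G \<Longrightarrow> (\<phi> g) upon G'"
    and R: "\<And>r. r \<in> R \<Longrightarrow> r upon G"
    and "\<And>r. r \<in> R \<Longrightarrow> frag_extend \<phi> r \<in> int_span R'"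
  shows "extend_additively (presented_group G' R') f (rel_class R z) = rel_class R' (frag_extend \<phi> z)"
proof -
  interpret H: abelian_group "presented_group G' R'" by (rule presented_abelian_group)
  have f: "f \<in> G \<rightarrow> carrier (presented_group G' R')"
    using assms(2,3) by (simp add: presented_closed Pi_iff)
  have "additive_ext (presented_group G' R') f r = \<zero>\<^bsub>presented_group G' R'\<^esub>" if "r \<in> R" for r
    using additive_ext_presented[OF R[OF that] assms(2,3)] assms(5)[OF that]
    by (simp add: presented_zero rel_class_eq_iff)
  from H.extend_additively_class[OF f R this assms(1)] show ?thesis
    using additive_ext_presented[OF assms(1-3)] by simp
qed

section \<open>Tensor products\<close>

text \<open>Only closure of the two actions is assumed, so one locale covers the tensor products
  over \<open>A\<close> of the bimodule and its dual in both orders, and the source and the target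
  of the canonical map.\<close>

locale tensor_product = M: abelian_group M + N: abelian_group N
  for M :: "('m, 'x) ring_scheme" and N :: "('n, 'y) ring_scheme" +
  fixes S :: "'s set" and rs :: "'m \<Rightarrow> 's \<Rightarrow> 'm" and ls :: "'s \<Rightarrow> 'n \<Rightarrow> 'n"
  assumes rs_closed: "\<lbrakk>x \<in> carrier M; s \<in> S\<rbrakk> \<Longrightarrow> rs x s \<in> carrier M"
    and ls_closed: "\<lbrakk>s \<in> S; y \<in> carrier N\<rbrakk> \<Longrightarrow> ls s y \<in> carrier N"
begin

abbreviation "rels \<equiv> tensor_relations S M rs N ls"
abbreviation "tens \<equiv> tensor S M rs N ls"
abbreviation "gens \<equiv> carrier M \<times> carrier N"

lemma tens_eq: "tens = presented_group gens rels"
  by (simp add: tensor_def)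

lemma rels_cases:
  assumes "r \<in> rels"
  obtains (left) x x' y where "x \<in> carrier M" "x' \<in> carrier M" "y \<in> carrier N"
      "r = gen (x \<oplus>\<^bsub>M\<^esub> x', y) - gen (x, y) - gen (x', y)"
    | (right) x y y' where "x \<in> carrier M" "y \<in> carrier N" "y' \<in> carrier N"
      "r = gen (x, y \<oplus>\<^bsub>N\<^esub> y') - gen (x, y) - gen (x, y')"
    | (middle) x s y where "x \<in> carrier M" "s \<in> S" "y \<in> carrier N"
      "r = gen (rs x s, y) - gen (x, ls s y)"
  using assms(1) unfolding tensor_relations_def
  by (elim UnE CollectE exE conjE) (use left right middle in \<open>simp_all\<close>)

lemma keys_rels: "r \<in> rels \<Longrightarrow> r upon gens"
  by (elim rels_cases) (simp_all add: keys_diff_subset rs_closed ls_closed)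

lemma class_add_left:
  "\<lbrakk>x \<in> carrier M; x' \<in> carrier M; y \<in> carrier N\<rbrakk> \<Longrightarrow>
    rel_class rels (gen (x \<oplus>\<^bsub>M\<^esub> x', y)) = rel_class rels (gen (x, y) + gen (x', y))"
  unfolding rel_class_eq_iff diff_diff_eq[symmetric]
  by (rule int_span_gen) (auto simp: tensor_relations_def)

lemma class_add_right:
  "\<lbrakk>x \<in> carrier M; y \<in> carrier N; y' \<in> carrier N\<rbrakk> \<Longrightarrow>
    rel_class rels (gen (x, y \<oplus>\<^bsub>N\<^esub> y')) = rel_class rels (gen (x, y) + gen (x, y'))"
  unfolding rel_class_eq_iff diff_diff_eq[symmetric]
  by (rule int_span_gen) (auto simp: tensor_relations_def)

lemma class_balanced:
  "\<lbrakk>x \<in> carrier M; s \<in> S; y \<in> carrier N\<rbrakk> \<Longrightarrow>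
    rel_class rels (gen (rs x s, y)) = rel_class rels (gen (x, ls s y))"
  unfolding rel_class_eq_iff by (rule int_span_gen) (auto simp: tensor_relations_def)

lemma class_zero_left:
  assumes "y \<in> carrier N"
  shows "rel_class rels (gen (\<zero>\<^bsub>M\<^esub>, y)) = rel_class rels 0"
  using class_add_left[of "\<zero>\<^bsub>M\<^esub>" "\<zero>\<^bsub>M\<^esub>" y] int_span_uminus[of "- gen (\<zero>\<^bsub>M\<^esub>, y)" rels] assms
  by (simp add: rel_class_eq_iff)

lemma class_zero_right:
  assumes "x \<in> carrier M"
  shows "rel_class rels (gen (x, \<zero>\<^bsub>N\<^esub>)) = rel_class rels 0"
  using class_add_right[of x "\<zero>\<^bsub>N\<^esub>" "\<zero>\<^bsub>N\<^esub>"] int_span_uminus[of "- gen (x, \<zero>\<^bsub>N\<^esub>)" rels] assms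
  by (simp add: rel_class_eq_iff)

lemma class_finsum_left:
  assumes "finite I" "f \<in> I \<rightarrow> carrier M" "y \<in> carrier N"
  shows "rel_class rels (gen (\<Oplus>\<^bsub>M\<^esub>i\<in>I. f i, y)) = rel_class rels (\<Sum>i\<in>I. gen (f i, y))"
  using assms(1,2)
proof (induction I rule: finite_induct)
  case (insert i I)
  then have *: "f i \<in> carrier M" "f \<in> I \<rightarrow> carrier M" by auto
  have "rel_class rels (gen (\<Oplus>\<^bsub>M\<^esub>i\<in>insert i I. f i, y))
      = rel_class rels (gen (f i, y) + gen (\<Oplus>\<^bsub>M\<^esub>i\<in>I. f i, y))"
    using insert.hyps * assms(3)
    by (simp add: M.finsum_insert class_add_left M.finsum_closed)
  also have "\<dots> = rel_class rels (gen (f i, y) + (\<Sum>i\<in>I. gen (f i, y)))"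
    by (rule rel_class_add_cong[OF refl insert.IH[OF *(2)]])
  finally show ?case using insert.hyps by simp
qed (simp add: class_zero_left assms(3))

lemma class_finsum_right:
  assumes "finite I" "f \<in> I \<rightarrow> carrier N" "x \<in> carrier M"
  shows "rel_class rels (gen (x, \<Oplus>\<^bsub>N\<^esub>i\<in>I. f i)) = rel_class rels (\<Sum>i\<in>I. gen (x, f i))"
  using assms(1,2)
proof (induction I rule: finite_induct)
  case (insert i I)
  then have *: "f i \<in> carrier N" "f \<in> I \<rightarrow> carrier N" by auto
  have "rel_class rels (gen (x, \<Oplus>\<^bsub>N\<^esub>i\<in>insert i I. f i))
      = rel_class rels (gen (x, f i) + gen (x, \<Oplus>\<^bsub>N\<^esub>i\<in>I. f i))"
    using insert.hyps * assms(3)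
    by (simp add: N.finsum_insert class_add_right N.finsum_closed)
  also have "\<dots> = rel_class rels (gen (x, f i) + (\<Sum>i\<in>I. gen (x, f i)))"
    by (rule rel_class_add_cong[OF refl insert.IH[OF *(2)]])
  finally show ?case using insert.hyps by simp
qed (simp add: class_zero_right assms(3))

text \<open>The universal property of the tensor product: biadditivity and balancing say exactly
  that the three families of relations are sent to zero.\<close>

lemma extend_additively_tens:
  assumes "abelian_group H"
    and closed: "\<And>x y. \<lbrakk>x \<in> carrier M; y \<in> carrier N\<rbrakk> \<Longrightarrow> f (x, y) \<in> carrier H"
    and "\<And>x x' y. \<lbrakk>x \<in> carrier M; x' \<in> carrier M; y \<in> carrier N\<rbrakk> \<Longrightarrow>
      f (x \<oplus>\<^bsub>M\<^esub> x', y) = f (x, y) \<oplus>\<^bsub>H\<^esub> f (x', y)"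
    and "\<And>x y y'. \<lbrakk>x \<in> carrier M; y \<in> carrier N; y' \<in> carrier N\<rbrakk> \<Longrightarrow>
      f (x, y \<oplus>\<^bsub>N\<^esub> y') = f (x, y) \<oplus>\<^bsub>H\<^esub> f (x, y')"
    and "\<And>x s y. \<lbrakk>x \<in> carrier M; s \<in> S; y \<in> carrier N\<rbrakk> \<Longrightarrow> f (rs x s, y) = f (x, ls s y)"
    and z: "z upon gens"
  shows "extend_additively H f (rel_class rels z) = additive_ext H f z"
proof -
  interpret H: abelian_group H by fact
  have f: "f \<in> gens \<rightarrow> carrier H" using closed by auto
  have gen: "additive_ext H f (gen g) = f g" if "g \<in> gens" for g
    using closed that by (auto intro!: H.additive_ext_gen)
  have diff: "additive_ext H f (u - v) = additive_ext H f u \<ominus>\<^bsub>H\<^esub> additive_ext H f v"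
    if "u upon gens" "v upon gens" for u v
    by (rule H.additive_ext_diff[OF that f])
  have "additive_ext H f r = \<zero>\<^bsub>H\<^esub>" if "r \<in> rels" for r
    using that
  proof (cases rule: rels_cases)
    case (left x x' y)
    then have "f (x, y) \<in> carrier H" "f (x', y) \<in> carrier H" using closed by auto
    with left show ?thesis using assms(3)[of x x' y]
      by (simp add: diff gen keys_diff_subset a_minus_def H.a_ac H.r_neg H.r_neg2)
  next
    case (right x y y')
    then have "f (x, y) \<in> carrier H" "f (x, y') \<in> carrier H" using closed by auto
    with right show ?thesis using assms(4)[of x y y']
      by (simp add: diff gen keys_diff_subset a_minus_def H.a_ac H.r_neg H.r_neg2)
  next
    case (middle x s y)
    then have "f (x, ls s y) \<in> carrier H" using closed ls_closed by auto
    with middle show ?thesis using assms(5)[of x s y]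
      by (simp add: diff gen a_minus_def H.r_neg rs_closed ls_closed)
  qed
  from H.extend_additively_class[OF f keys_rels this z] show ?thesis .
qed

lemma extend_additively_tens_presented:
  assumes closed: "\<And>x y. \<lbrakk>x \<in> carrier M; y \<in> carrier N\<rbrakk> \<Longrightarrow>
      f (x, y) = rel_class R' (\<phi> (x, y)) \<and> (\<phi> (x, y)) upon G'"
    and "\<And>x x' y. \<lbrakk>x \<in> carrier M; x' \<in> carrier M; y \<in> carrier N\<rbrakk> \<Longrightarrow>
      rel_class R' (\<phi> (x \<oplus>\<^bsub>M\<^esub> x', y)) = rel_class R' (\<phi> (x, y) + \<phi> (x', y))"
    and "\<And>x y y'. \<lbrakk>x \<in> carrier M; y \<in> carrier N; y' \<in> carrier N\<rbrakk> \<Longrightarrow>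
      rel_class R' (\<phi> (x, y \<oplus>\<^bsub>N\<^esub> y')) = rel_class R' (\<phi> (x, y) + \<phi> (x, y'))"
    and "\<And>x s y. \<lbrakk>x \<in> carrier M; s \<in> S; y \<in> carrier N\<rbrakk> \<Longrightarrow>
      rel_class R' (\<phi> (rs x s, y)) = rel_class R' (\<phi> (x, ls s y))"
    and z: "z upon gens"
  shows "extend_additively (presented_group G' R') f (rel_class rels z)
    = rel_class R' (frag_extend \<phi> z)"
proof -
  have "extend_additively (presented_group G' R') f (rel_class rels z)
    = additive_ext (presented_group G' R') f z"
    by (rule extend_additively_tens)
      (use assms in \<open>simp_all add: presented_abelian_group presented_closed presented_add rs_closed ls_closed\<close>)
  also have "\<dots> = rel_class R' (frag_extend \<phi> z)"
    by (rule additive_ext_presented[OF z]) (use closed in auto)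
  finally show ?thesis .
qed

end

section \<open>The dual bimodule and the Morita context of a weak line module\<close>

locale bimodule_pair = M: bimodule A M + N: bimodule A N
  for A :: "(complex, 'a) module" and M :: "('a, 'm) bimodule" and N :: "('a, 'n) bimodule"

sublocale bimodule_pair \<subseteq> tensor_product M N "carrier A" "rsmult M" "smult N"
  by unfold_locales (simp_all add: M.right_closed N.left_closed)

lemma dual_carrier:
  "\<alpha> \<in> carrier (dual_bimodule A E) \<longleftrightarrow> \<alpha> \<in> extensional (carrier E) \<and>
    \<alpha> \<in> carrier E \<rightarrow> carrier A \<and>
    (\<forall>x\<in>carrier E. \<forall>y\<in>carrier E. \<alpha> (x \<oplus>\<^bsub>E\<^esub> y) = \<alpha> x \<oplus>\<^bsub>A\<^esub> \<alpha> y) \<and>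
    (\<forall>a\<in>carrier A. \<forall>x\<in>carrier E. \<alpha> (a \<odot>\<^bsub>E\<^esub> x) = a \<otimes>\<^bsub>A\<^esub> \<alpha> x)"
  by (auto simp: dual_bimodule_def left_module_maps_def regular_bimodule_def)

lemma dual_apply:
  assumes "e \<in> carrier E"
  shows dual_apply_zero: "\<zero>\<^bsub>dual_bimodule A E\<^esub> e = \<zero>\<^bsub>A\<^esub>"
    and dual_apply_add: "(\<alpha> \<oplus>\<^bsub>dual_bimodule A E\<^esub> \<beta>) e = \<alpha> e \<oplus>\<^bsub>A\<^esub> \<beta> e"
    and dual_apply_left: "(a \<odot>\<^bsub>dual_bimodule A E\<^esub> \<alpha>) e = \<alpha> (e \<triangleleft>\<^bsub>E\<^esub> a)"
    and dual_apply_right: "(\<alpha> \<triangleleft>\<^bsub>dual_bimodule A E\<^esub> a) e = \<alpha> e \<otimes>\<^bsub>A\<^esub> a"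
  using assms by (simp_all add: dual_bimodule_def)

context bimodule
begin

abbreviation "D \<equiv> dual_bimodule A E"

lemma dual_closed: "\<alpha> \<in> carrier D \<Longrightarrow> e \<in> carrier E \<Longrightarrow> \<alpha> e \<in> carrier A"
  by (auto simp: dual_carrier)

lemma dual_add: "\<alpha> \<in> carrier D \<Longrightarrow> x \<in> carrier E \<Longrightarrow> y \<in> carrier E \<Longrightarrow>
    \<alpha> (x \<oplus>\<^bsub>E\<^esub> y) = \<alpha> x \<oplus>\<^bsub>A\<^esub> \<alpha> y"
  by (auto simp: dual_carrier)

lemma dual_left: "\<alpha> \<in> carrier D \<Longrightarrow> a \<in> carrier A \<Longrightarrow> x \<in> carrier E \<Longrightarrow>
    \<alpha> (a \<odot>\<^bsub>E\<^esub> x) = a \<otimes>\<^bsub>A\<^esub> \<alpha> x"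
  by (auto simp: dual_carrier)

text \<open>Functionals are extensional by definition of the dual, hence every identity in the dual
  can be checked pointwise.\<close>

lemma dual_eqI:
  assumes "\<alpha> \<in> carrier D" "\<beta> \<in> carrier D" and "\<And>e. e \<in> carrier E \<Longrightarrow> \<alpha> e = \<beta> e"
  shows "\<alpha> = \<beta>"
  using assms by (auto simp: dual_carrier intro: extensionalityI)

lemma dual_zero_closed: "\<zero>\<^bsub>D\<^esub> \<in> carrier D"
  by (auto simp: dual_carrier dual_apply left_closed) (simp add: dual_bimodule_def)

lemma dual_add_closed: "\<alpha> \<in> carrier D \<Longrightarrow> \<beta> \<in> carrier D \<Longrightarrow> \<alpha> \<oplus>\<^bsub>D\<^esub> \<beta> \<in> carrier D"
  unfolding dual_carrier[of "\<alpha> \<oplus>\<^bsub>D\<^esub> \<beta>"]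
  by (auto simp: dual_apply left_closed dual_closed dual_add dual_left A.a_ac A.r_distr)
    (simp add: dual_bimodule_def)

lemma dual_left_closed: "a \<in> carrier A \<Longrightarrow> \<alpha> \<in> carrier D \<Longrightarrow> a \<odot>\<^bsub>D\<^esub> \<alpha> \<in> carrier D"
  unfolding dual_carrier[of "a \<odot>\<^bsub>D\<^esub> \<alpha>"]
  by (auto simp: dual_apply left_closed dual_closed dual_add dual_left right_closed right_add left_right)
    (simp add: dual_bimodule_def)

lemma dual_right_closed: "a \<in> carrier A \<Longrightarrow> \<alpha> \<in> carrier D \<Longrightarrow> \<alpha> \<triangleleft>\<^bsub>D\<^esub> a \<in> carrier D"
  unfolding dual_carrier[of "\<alpha> \<triangleleft>\<^bsub>D\<^esub> a"]
  by (auto simp: dual_apply left_closed dual_closed dual_add dual_left A.l_distr A.m_assoc)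
    (simp add: dual_bimodule_def)

lemma dual_abelian_group: "abelian_group D"
proof (rule abelian_groupI)
  fix \<alpha> assume \<alpha>: "\<alpha> \<in> carrier D"
  define \<beta> where "\<beta> = (\<lambda>e\<in>carrier E. \<ominus>\<^bsub>A\<^esub> \<alpha> e)"
  have "\<beta> \<in> carrier D"
    unfolding dual_carrier using \<alpha>
    by (auto simp: \<beta>_def left_closed dual_closed dual_add dual_left A.minus_add A.r_minus)
  moreover have "\<beta> \<oplus>\<^bsub>D\<^esub> \<alpha> = \<zero>\<^bsub>D\<^esub>"
    by (rule dual_eqI) (use \<alpha> calculation in
        \<open>auto simp: dual_add_closed dual_zero_closed dual_apply \<beta>_def dual_closed A.l_neg\<close>)
  ultimately show "\<exists>\<beta>\<in>carrier D. \<beta> \<oplus>\<^bsub>D\<^esub> \<alpha> = \<zero>\<^bsub>D\<^esub>" by blast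
qed (auto intro!: dual_eqI simp: dual_apply dual_zero_closed dual_add_closed dual_closed A.a_ac)

lemma dual_is_bimodule: "bimodule A D"
proof (intro bimodule.intro bimodule_axioms.intro dual_abelian_group)
  show "complex_algebra A" by (rule complex_algebra_axioms)
  fix \<alpha> c assume \<alpha>: "\<alpha> \<in> carrier D"
  have c: "c \<odot>\<^bsub>A\<^esub> \<one>\<^bsub>A\<^esub> \<in> carrier A" by (simp add: complex_ring_def)
  show "(c \<odot>\<^bsub>A\<^esub> \<one>\<^bsub>A\<^esub>) \<odot>\<^bsub>D\<^esub> \<alpha> = \<alpha> \<triangleleft>\<^bsub>D\<^esub> (c \<odot>\<^bsub>A\<^esub> \<one>\<^bsub>A\<^esub>)"
  proof (rule dual_eqI)
    fix e assume e: "e \<in> carrier E"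
    \<comment> \<open>The scalar changes sides first on \<open>E\<close>, where it is central by
      assumption, and then in \<open>A\<close>, where it multiplies the value of
      \<open>\<alpha>\<close>.\<close>
    have "\<alpha> (e \<triangleleft>\<^bsub>E\<^esub> (c \<odot>\<^bsub>A\<^esub> \<one>\<^bsub>A\<^esub>)) = \<alpha> ((c \<odot>\<^bsub>A\<^esub> \<one>\<^bsub>A\<^esub>) \<odot>\<^bsub>E\<^esub> e)"
      using complex_central[OF e] by simp
    also have "\<dots> = (c \<odot>\<^bsub>A\<^esub> \<one>\<^bsub>A\<^esub>) \<otimes>\<^bsub>A\<^esub> \<alpha> e" by (rule dual_left[OF \<alpha> c e])
    also have "\<dots> = \<alpha> e \<otimes>\<^bsub>A\<^esub> (c \<odot>\<^bsub>A\<^esub> \<one>\<^bsub>A\<^esub>)"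
      using dual_closed[OF \<alpha> e] by (simp add: smult_mult_left smult_mult_right)
    finally show "((c \<odot>\<^bsub>A\<^esub> \<one>\<^bsub>A\<^esub>) \<odot>\<^bsub>D\<^esub> \<alpha>) e = (\<alpha> \<triangleleft>\<^bsub>D\<^esub> (c \<odot>\<^bsub>A\<^esub> \<one>\<^bsub>A\<^esub>)) e"
      by (simp add: dual_apply e)
  qed (use \<alpha> c in \<open>simp_all add: dual_left_closed dual_right_closed\<close>)
qed (auto intro!: dual_eqI simp: dual_apply dual_left_closed dual_right_closed dual_add_closed dual_closed
      right_closed right_add_scalar dual_add right_assoc right_one A.l_distr A.r_distr A.m_assoc)

end

section \<open>Dual bases of finitely generated projective modules\<close>

context bimodule
begin

lemma right_finsum:
  assumes "e \<in> carrier E" "finite I" "f \<in> I \<rightarrow> carrier A"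
  shows "e \<triangleleft>\<^bsub>E\<^esub> (\<Oplus>\<^bsub>A\<^esub>i\<in>I. f i) = (\<Oplus>\<^bsub>E\<^esub>i\<in>I. e \<triangleleft>\<^bsub>E\<^esub> f i)"
  by (rule A.finsum_additive_hom)
    (use assms in \<open>auto simp: right_closed right_add_scalar E.abelian_group_axioms\<close>)

lemma dual_finsum:
  assumes "\<alpha> \<in> carrier D" "finite I" "f \<in> I \<rightarrow> carrier E"
  shows "\<alpha> (\<Oplus>\<^bsub>E\<^esub>i\<in>I. f i) = (\<Oplus>\<^bsub>A\<^esub>i\<in>I. \<alpha> (f i))"
  by (rule E.finsum_additive_hom)
    (use assms in \<open>auto simp: dual_closed dual_add A.abelian_group_axioms\<close>)

text \<open>The free module of which \<open>E\<close> is a summand may have infinite rank. But the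
  coordinates of finitely many generators involve only finitely many indices, and by linearity no
  element of \<open>E\<close> has a coordinate outside them. Coordinate functionals and images of
  unit vectors at these indices form the dual basis.\<close>

lemma dual_basis_exists:
  assumes "fgp_left A E"
  shows "\<exists>b. is_dual_basis A E b"
proof -
  obtain S where S: "finite S" "S \<subseteq> carrier E"
    "\<And>x. x \<in> carrier E \<Longrightarrow> \<exists>c\<in>S \<rightarrow> carrier A. x = (\<Oplus>\<^bsub>E\<^esub>s\<in>S. c s \<odot>\<^bsub>E\<^esub> s)"
    using assms unfolding fgp_left_def finitely_generated_left_def by blast
  obtain I :: "'m set" and i p where i: "i \<in> left_module_maps A E (free_left_module A I)"
    and p: "p \<in> left_module_maps A (free_left_module A I) E"
    and pi: "\<forall>x\<in>carrier E. p (i x) = x"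
    using assms unfolding fgp_left_def projective_left_def by (elim conjE exE bexE) (rule that)
  define F where "F = free_left_module A I"
  have F_carrier: "f \<in> carrier F \<longleftrightarrow> f \<in> I \<rightarrow>\<^sub>E carrier A \<and> finite {j \<in> I. f j \<noteq> \<zero>\<^bsub>A\<^esub>}" for f
    by (simp add: F_def free_left_module_def)
  have F_add: "f \<oplus>\<^bsub>F\<^esub> g = (\<lambda>j\<in>I. f j \<oplus>\<^bsub>A\<^esub> g j)" for f g
    by (simp add: F_def free_left_module_def)
  have F_smult: "a \<odot>\<^bsub>F\<^esub> f = (\<lambda>j\<in>I. a \<otimes>\<^bsub>A\<^esub> f j)" for a f
    by (simp add: F_def free_left_module_def)
  have i_closed: "i x \<in> carrier F" if "x \<in> carrier E" for x
    using i that by (auto simp: left_module_maps_def F_def)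
  have p_closed: "p f \<in> carrier E" if "f \<in> carrier F" for f
    using p that by (auto simp: left_module_maps_def F_def)
  have p_add: "p (f \<oplus>\<^bsub>F\<^esub> g) = p f \<oplus>\<^bsub>E\<^esub> p g" if "f \<in> carrier F" "g \<in> carrier F" for f g
    using p that by (auto simp: left_module_maps_def F_def)
  have p_smult: "p (a \<odot>\<^bsub>F\<^esub> f) = a \<odot>\<^bsub>E\<^esub> p f" if "a \<in> carrier A" "f \<in> carrier F" for a f
    using p that by (auto simp: left_module_maps_def F_def)
  \<comment> \<open>Coordinate functionals of the embedding \<open>i\<close>, restricted to make
    them extensional.\<close>
  define \<delta> where "\<delta> j = (\<lambda>x\<in>carrier E. i x j)" for j
  have \<delta>: "\<delta> j \<in> carrier D" if "j \<in> I" for j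
  proof -
    have "i x j \<in> carrier A" if "x \<in> carrier E" for x
      using i_closed[OF that] \<open>j \<in> I\<close> by (auto simp: F_carrier)
    moreover have "i (x \<oplus>\<^bsub>E\<^esub> y) j = i x j \<oplus>\<^bsub>A\<^esub> i y j" if "x \<in> carrier E" "y \<in> carrier E" for x y
      using i that \<open>j \<in> I\<close> by (auto simp: left_module_maps_def F_add[unfolded F_def])
    moreover have "i (a \<odot>\<^bsub>E\<^esub> x) j = a \<otimes>\<^bsub>A\<^esub> i x j" if "a \<in> carrier A" "x \<in> carrier E" for a x
      using i that \<open>j \<in> I\<close> by (auto simp: left_module_maps_def F_smult[unfolded F_def])
    ultimately show ?thesis by (auto simp: dual_carrier \<delta>_def left_closed)
  qed
  define e where "e j = (\<lambda>k\<in>I. if k = j then \<one>\<^bsub>A\<^esub> else \<zero>\<^bsub>A\<^esub>)" for j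
  have e: "e j \<in> carrier F" if "j \<in> I" for j
  proof -
    have "finite {k \<in> I. e j k \<noteq> \<zero>\<^bsub>A\<^esub>}" by (rule finite_subset[of _ "{j}"]) (auto simp: e_def)
    then show ?thesis by (auto simp: F_carrier e_def)
  qed
  have p_expand: "p f = (\<Oplus>\<^bsub>E\<^esub>j\<in>K. f j \<odot>\<^bsub>E\<^esub> p (e j))"
    if "finite K" "K \<subseteq> I" "f \<in> carrier F" "\<And>j. j \<in> I - K \<Longrightarrow> f j = \<zero>\<^bsub>A\<^esub>" for f K
    using that
  proof (induction K arbitrary: f rule: finite_induct)
    case empty
    \<comment> \<open>Here \<open>f\<close> is zero, and this is used in the form
      \<open>f + f = f\<close>, from which additivity of \<open>p\<close> yields
      \<open>p f = 0\<close>.\<close>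
    then have "f \<oplus>\<^bsub>F\<^esub> f = f"
      by (auto simp: F_add F_carrier PiE_def fun_eq_iff extensional_def)
    then have "p f \<oplus>\<^bsub>E\<^esub> p f = p f" using p_add[of f f] empty by simp
    then show ?case using p_closed[of f] empty by (simp add: E.add.l_cancel_one')
  next
    case (insert j K)
    \<comment> \<open>\<open>f\<close> with its coordinate at \<open>j\<close> erased, so that the
      remaining support lies in \<open>K\<close>.\<close>
    define g where "g = (\<lambda>k\<in>I. if k = j then \<zero>\<^bsub>A\<^esub> else f k)"
    have fA: "f k \<in> carrier A" if "k \<in> I" for k
      using insert.prems(2) that by (auto simp: F_carrier)
    have "finite {k \<in> I. g k \<noteq> \<zero>\<^bsub>A\<^esub>}"
      by (rule finite_subset[of _ "{k \<in> I. f k \<noteq> \<zero>\<^bsub>A\<^esub>}"])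
        (use insert.prems(2) in \<open>auto simp: g_def F_carrier\<close>)
    then have g: "g \<in> carrier F" by (auto simp: F_carrier g_def fA)
    have j: "j \<in> I" using insert.prems by auto
    have "finite {k \<in> I. (f j \<odot>\<^bsub>F\<^esub> e j) k \<noteq> \<zero>\<^bsub>A\<^esub>}"
      by (rule finite_subset[of _ "{j}"]) (auto simp: e_def F_smult fA j)
    then have fe: "f j \<odot>\<^bsub>F\<^esub> e j \<in> carrier F"
      by (auto simp: F_carrier F_smult e_def fA j)
    have "f = f j \<odot>\<^bsub>F\<^esub> e j \<oplus>\<^bsub>F\<^esub> g"
    proof
      fix k show "f k = (f j \<odot>\<^bsub>F\<^esub> e j \<oplus>\<^bsub>F\<^esub> g) k"
        using insert.prems(2) j fA[of k] fA[of j]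
        by (cases "k \<in> I") (auto simp: F_add F_smult g_def e_def F_carrier PiE_def extensional_def)
    qed
    then have "p f = p (f j \<odot>\<^bsub>F\<^esub> e j) \<oplus>\<^bsub>E\<^esub> p g" using p_add[OF fe g] by simp
    also have "p (f j \<odot>\<^bsub>F\<^esub> e j) = f j \<odot>\<^bsub>E\<^esub> p (e j)" by (rule p_smult[OF fA[OF j] e[OF j]])
    also have "p g = (\<Oplus>\<^bsub>E\<^esub>k\<in>K. g k \<odot>\<^bsub>E\<^esub> p (e k))"
    proof (rule insert.IH[OF _ g])
      show "g k = \<zero>\<^bsub>A\<^esub>" if "k \<in> I - K" for k using insert.prems(3)[of k] that by (auto simp: g_def)
    qed (use insert.prems in auto)
    also have "\<dots> = (\<Oplus>\<^bsub>E\<^esub>k\<in>K. f k \<odot>\<^bsub>E\<^esub> p (e k))"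
    proof (rule E.finsum_cong')
      fix k assume "k \<in> K"
      then have "k \<in> I" "k \<noteq> j" using insert by auto
      then show "g k \<odot>\<^bsub>E\<^esub> p (e k) = f k \<odot>\<^bsub>E\<^esub> p (e k)" by (simp add: g_def)
    qed (use insert.prems in \<open>auto intro!: left_closed fA p_closed e\<close>)
    finally show ?case
      using insert.hyps insert.prems j
      by (subst E.finsum_insert) (auto intro!: left_closed fA p_closed e)
  qed
  \<comment> \<open>The indices that occur in the coordinates of the generators.\<close>
  define J where "J = (\<Union>s\<in>S. {j \<in> I. i s j \<noteq> \<zero>\<^bsub>A\<^esub>})"
  have J: "finite J" "J \<subseteq> I"
    using S(1,2) i_closed by (auto simp: J_def F_carrier)
  have supp: "i x j = \<zero>\<^bsub>A\<^esub>" if x: "x \<in> carrier E" and j: "j \<in> I - J" for x j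
  proof -
    obtain c where c: "c \<in> S \<rightarrow> carrier A" "x = (\<Oplus>\<^bsub>E\<^esub>s\<in>S. c s \<odot>\<^bsub>E\<^esub> s)" using S(3)[OF x] by blast
    have jI: "j \<in> I" using j by auto
    have "\<delta> j (\<Oplus>\<^bsub>E\<^esub>s\<in>S. c s \<odot>\<^bsub>E\<^esub> s) = (\<Oplus>\<^bsub>A\<^esub>s\<in>S. \<delta> j (c s \<odot>\<^bsub>E\<^esub> s))"
      by (rule dual_finsum[OF \<delta>[OF jI] S(1)]) (use c S(2) in \<open>auto intro!: left_closed\<close>)
    also have "\<dots> = (\<Oplus>\<^bsub>A\<^esub>s\<in>S. \<zero>\<^bsub>A\<^esub>)"
    proof (rule A.finsum_cong')
      fix s assume s: "s \<in> S"
      then have "\<delta> j (c s \<odot>\<^bsub>E\<^esub> s) = c s \<otimes>\<^bsub>A\<^esub> \<delta> j s"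
        using c(1) S(2) by (intro dual_left[OF \<delta>[OF jI]]) auto
      also have "\<delta> j s = \<zero>\<^bsub>A\<^esub>" using j s S(2) by (auto simp: J_def \<delta>_def)
      finally show "\<delta> j (c s \<odot>\<^bsub>E\<^esub> s) = \<zero>\<^bsub>A\<^esub>" using Pi_mem[OF c(1) s] by simp
    qed auto
    finally show ?thesis using x by (simp add: c(2)[symmetric] \<delta>_def A.finsum_zero)
  qed
  have expand: "x = (\<Oplus>\<^bsub>E\<^esub>j\<in>J. \<delta> j x \<odot>\<^bsub>E\<^esub> p (e j))" if x: "x \<in> carrier E" for x
    using p_expand[OF J i_closed[OF x] supp[OF x]] pi x by (simp add: \<delta>_def)
  \<comment> \<open>\<open>is_dual_basis\<close> asks for families indexed by an initial segment of
    the natural numbers.\<close>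
  obtain h where h: "bij_betw h {0..<card J} J" using ex_bij_betw_nat_finite[OF J(1)] by blast
  then have h': "inj_on h {..<card J}" "h ` {..<card J} = J"
    by (simp_all add: bij_betw_def lessThan_atLeast0)
  have hI: "h k \<in> I" if "k < card J" for k using h'(2) that J(2) by auto
  have "is_dual_basis A E (card J, (\<lambda>k. p (e (h k))), (\<lambda>k. \<delta> (h k)))"
    unfolding is_dual_basis_def
  proof (clarsimp, intro conjI ballI)
    fix x assume x: "x \<in> carrier E"
    have "(\<Oplus>\<^bsub>E\<^esub>j\<in>h ` {..<card J}. \<delta> j x \<odot>\<^bsub>E\<^esub> p (e j))
      = (\<Oplus>\<^bsub>E\<^esub>k\<in>{..<card J}. \<delta> (h k) x \<odot>\<^bsub>E\<^esub> p (e (h k)))"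
      by (rule E.finsum_reindex[OF _ h'(1)])
        (use hI x in \<open>auto simp: left_closed p_closed e dual_closed[OF \<delta>]\<close>)
    then show "x = (\<Oplus>\<^bsub>E\<^esub>k\<in>{..<card J}. \<delta> (h k) x \<odot>\<^bsub>E\<^esub> p (e (h k)))"
      using expand[OF x] h'(2) by simp
  qed (use hI in \<open>auto intro!: p_closed e \<delta>\<close>)
  then show ?thesis by blast
qed

end

section \<open>Morita contexts\<close>

text \<open>Both pairings are given on pairs of elements, as balanced bilinear functions, which
  suits calculations with words. \<open>p_q\<close> and \<open>q_p\<close> are the two associativity
  laws of the context.\<close>

locale morita_context = M: bimodule A M + N: bimodule A N
  for A :: "(complex, 'a) module" (structure) and M :: "('a, 'm) bimodule" and N :: "('a, 'n) bimodule" +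
  fixes p :: "'m \<Rightarrow> 'n \<Rightarrow> 'a" and q :: "'n \<Rightarrow> 'm \<Rightarrow> 'a"
  assumes p_closed: "\<lbrakk>x \<in> carrier M; \<alpha> \<in> carrier N\<rbrakk> \<Longrightarrow> p x \<alpha> \<in> carrier A"
    and p_add_left: "\<lbrakk>x \<in> carrier M; y \<in> carrier M; \<alpha> \<in> carrier N\<rbrakk> \<Longrightarrow>
      p (x \<oplus>\<^bsub>M\<^esub> y) \<alpha> = p x \<alpha> \<oplus> p y \<alpha>"
    and p_add_right: "\<lbrakk>x \<in> carrier M; \<alpha> \<in> carrier N; \<beta> \<in> carrier N\<rbrakk> \<Longrightarrow>
      p x (\<alpha> \<oplus>\<^bsub>N\<^esub> \<beta>) = p x \<alpha> \<oplus> p x \<beta>"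
    and p_left: "\<lbrakk>a \<in> carrier A; x \<in> carrier M; \<alpha> \<in> carrier N\<rbrakk> \<Longrightarrow> p (a \<odot>\<^bsub>M\<^esub> x) \<alpha> = a \<otimes> p x \<alpha>"
    and p_right: "\<lbrakk>a \<in> carrier A; x \<in> carrier M; \<alpha> \<in> carrier N\<rbrakk> \<Longrightarrow> p x (\<alpha> \<triangleleft>\<^bsub>N\<^esub> a) = p x \<alpha> \<otimes> a"
    and p_balanced: "\<lbrakk>a \<in> carrier A; x \<in> carrier M; \<alpha> \<in> carrier N\<rbrakk> \<Longrightarrow> p (x \<triangleleft>\<^bsub>M\<^esub> a) \<alpha> = p x (a \<odot>\<^bsub>N\<^esub> \<alpha>)"
    and q_closed: "\<lbrakk>x \<in> carrier M; \<alpha> \<in> carrier N\<rbrakk> \<Longrightarrow> q \<alpha> x \<in> carrier A"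
    and q_add_left: "\<lbrakk>x \<in> carrier M; \<alpha> \<in> carrier N; \<beta> \<in> carrier N\<rbrakk> \<Longrightarrow>
      q (\<alpha> \<oplus>\<^bsub>N\<^esub> \<beta>) x = q \<alpha> x \<oplus> q \<beta> x"
    and q_add_right: "\<lbrakk>x \<in> carrier M; y \<in> carrier M; \<alpha> \<in> carrier N\<rbrakk> \<Longrightarrow>
      q \<alpha> (x \<oplus>\<^bsub>M\<^esub> y) = q \<alpha> x \<oplus> q \<alpha> y"
    and q_left: "\<lbrakk>a \<in> carrier A; x \<in> carrier M; \<alpha> \<in> carrier N\<rbrakk> \<Longrightarrow> q (a \<odot>\<^bsub>N\<^esub> \<alpha>) x = a \<otimes> q \<alpha> x"
    and q_right: "\<lbrakk>a \<in> carrier A; x \<in> carrier M; \<alpha> \<in> carrier N\<rbrakk> \<Longrightarrow> q \<alpha> (x \<triangleleft>\<^bsub>M\<^esub> a) = q \<alpha> x \<otimes> a"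
    and q_balanced: "\<lbrakk>a \<in> carrier A; x \<in> carrier M; \<alpha> \<in> carrier N\<rbrakk> \<Longrightarrow> q (\<alpha> \<triangleleft>\<^bsub>N\<^esub> a) x = q \<alpha> (a \<odot>\<^bsub>M\<^esub> x)"
    and p_q: "\<lbrakk>x \<in> carrier M; \<alpha> \<in> carrier N; y \<in> carrier M\<rbrakk> \<Longrightarrow> p x \<alpha> \<odot>\<^bsub>M\<^esub> y = x \<triangleleft>\<^bsub>M\<^esub> q \<alpha> y"
    and q_p: "\<lbrakk>\<alpha> \<in> carrier N; x \<in> carrier M; \<beta> \<in> carrier N\<rbrakk> \<Longrightarrow> q \<alpha> x \<odot>\<^bsub>N\<^esub> \<beta> = \<alpha> \<triangleleft>\<^bsub>N\<^esub> p x \<beta>"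

text \<open>The axioms are symmetric; thus vectors and covectors need only one set of
  proofs.\<close>

lemma (in morita_context) swap: "morita_context A N M q p"
  by (intro morita_context.intro morita_context_axioms.intro M.bimodule_axioms N.bimodule_axioms)
    (assumption | rule p_closed p_add_left p_add_right p_left p_right p_balanced
      q_closed q_add_left q_add_right q_left q_right q_balanced p_q q_p)+

section \<open>The pairing given by the inverse of coevaluation\<close>

locale weak_line = bimodule A E for A :: "(complex, 'a) module" (structure) and E :: "('a, 'l) bimodule" +
  assumes weak: "weak_left_line_module A E"

sublocale weak_line \<subseteq> DE: bimodule_pair A D E
  using dual_is_bimodule bimodule_axioms by (simp add: bimodule_pair_def)

sublocale weak_line \<subseteq> ED: bimodule_pair A E D
  using dual_is_bimodule bimodule_axioms by (simp add: bimodule_pair_def)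

context weak_line
begin

definition pairing :: "('l \<Rightarrow> 'a) \<Rightarrow> 'l \<Rightarrow> 'a" where
  "pairing \<alpha> x = coev_inv A E (bimodule_pure_tensor A D E \<alpha> x)"

lemma coev_bij: "bij_betw (coev A E) (carrier A) (carrier DE.tens)"
  using weak by (simp add: weak_left_line_module_def)

text \<open>\<open>coev\<close> is defined with one particular dual basis picked by choice. Later
  arguments must use that basis and no other, so it is unpacked once, for all \<open>a\<close>
  simultaneously.\<close>

lemma coev_expand:
  obtains n u d where "is_dual_basis A E (n, u, d)"
    "\<And>a. a \<in> carrier A \<Longrightarrow> coev A E a = rel_class DE.rels (\<Sum>i<n. gen (a \<odot>\<^bsub>D\<^esub> d i, u i))"
proof -
  obtain n u d where b: "(SOME b. is_dual_basis A E b) = (n, u, d)" by (metis prod_cases3)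
  have "is_dual_basis A E (SOME b. is_dual_basis A E b)"
    using dual_basis_exists weak by (simp add: weak_left_line_module_def someI_ex)
  then have basis: "is_dual_basis A E (n, u, d)" by (simp add: b)
  have "coev A E a = rel_class DE.rels (\<Sum>i<n. gen (a \<odot>\<^bsub>D\<^esub> d i, u i))" if "a \<in> carrier A" for a
    unfolding coev_def b Let_def prod.case DE.tens_eq pure_tensor_def
    by (rule presented_finsum)
      (use basis that in \<open>auto simp: is_dual_basis_def Pi_iff intro!: dual_left_closed\<close>)
  with basis that show thesis by blast
qed

text \<open>
  Applying \<open>\<beta> \<otimes> z \<mapsto> \<beta>(y).z\<close> to \<open>coev a = \<alpha> \<otimes> x\<close> gives \<open>y.a = \<alpha>(y).x\<close>. As the right action on \<open>E\<close> is
  faithful, this determines \<open>a\<close>, and all identities for the pairing follow by testing on \<open>y\<close>.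
\<close>

lemma pairing_closed_apply:
  assumes \<alpha>: "\<alpha> \<in> carrier D" and x: "x \<in> carrier E"
  shows "pairing \<alpha> x \<in> carrier A \<and> (\<forall>y\<in>carrier E. y \<triangleleft>\<^bsub>E\<^esub> pairing \<alpha> x = \<alpha> y \<odot>\<^bsub>E\<^esub> x)"
proof -
  define a where "a = pairing \<alpha> x"
  have "bimodule_pure_tensor A D E \<alpha> x \<in> carrier DE.tens"
    unfolding DE.tens_eq pure_tensor_def by (rule presented_closed) (use \<alpha> x in simp)
  then have a: "a \<in> carrier A" "coev A E a = bimodule_pure_tensor A D E \<alpha> x"
    using coev_bij unfolding a_def pairing_def coev_inv_def bij_betw_def
    by (metis inv_into_into, metis f_inv_into_f)
  obtain n u d where basis: "is_dual_basis A E (n, u, d)"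
    and coev: "\<And>a. a \<in> carrier A \<Longrightarrow> coev A E a = rel_class DE.rels (\<Sum>i<n. gen (a \<odot>\<^bsub>D\<^esub> d i, u i))"
    by (rule coev_expand) blast
  have u: "u i \<in> carrier E" and d: "d i \<in> carrier D" if "i < n" for i
    using basis that by (auto simp: is_dual_basis_def)
  have "y \<triangleleft>\<^bsub>E\<^esub> a = \<alpha> y \<odot>\<^bsub>E\<^esub> x" if y: "y \<in> carrier E" for y
  proof -
    define f where "f = (\<lambda>(\<beta>, z). \<beta> y \<odot>\<^bsub>E\<^esub> z)"
    have ext: "extend_additively E f (rel_class DE.rels z) = additive_ext E f z"
      if "z upon carrier D \<times> carrier E" for z
      by (rule DE.extend_additively_tens[OF E.abelian_group_axioms _ _ _ _ that])
        (use y in \<open>auto simp: f_def left_closed dual_closed dual_apply left_add left_add_scalar left_assoc\<close>)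
    have f: "f \<in> carrier D \<times> carrier E \<rightarrow> carrier E"
      using y by (auto simp: f_def left_closed dual_closed)
    \<comment> \<open>The dual basis expansion of \<open>y.a\<close> is term by term the value of
      \<open>f\<close> on the expansion of \<open>coev a\<close>.\<close>
    have "y \<triangleleft>\<^bsub>E\<^esub> a = (\<Oplus>\<^bsub>E\<^esub>i\<in>{..<n}. d i (y \<triangleleft>\<^bsub>E\<^esub> a) \<odot>\<^bsub>E\<^esub> u i)"
      using basis right_closed[OF a(1) y] by (auto simp: is_dual_basis_def)
    also have "\<dots> = (\<Oplus>\<^bsub>E\<^esub>i\<in>{..<n}. additive_ext E f (gen (a \<odot>\<^bsub>D\<^esub> d i, u i)))"
    proof (rule E.finsum_cong'[OF refl])
      fix i assume "i \<in> {..<n}"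
      then have "additive_ext E f (gen (a \<odot>\<^bsub>D\<^esub> d i, u i)) = f (a \<odot>\<^bsub>D\<^esub> d i, u i)"
        using f a(1) u d by (intro E.additive_ext_gen) (auto simp: Pi_iff dual_left_closed)
      then show "d i (y \<triangleleft>\<^bsub>E\<^esub> a) \<odot>\<^bsub>E\<^esub> u i = additive_ext E f (gen (a \<odot>\<^bsub>D\<^esub> d i, u i))"
        using y by (simp add: f_def dual_apply)
    qed (use f a(1) u d in \<open>auto intro!: E.additive_ext_closed dual_left_closed\<close>)
    also have "\<dots> = additive_ext E f (\<Sum>i<n. gen (a \<odot>\<^bsub>D\<^esub> d i, u i))"
      by (rule E.additive_ext_sum[symmetric, OF _ _ f]) (use a(1) u d in \<open>auto simp: dual_left_closed\<close>)
    also have "\<dots> = extend_additively E f (coev A E a)"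
      unfolding coev[OF a(1)]
      by (rule ext[symmetric]) (intro keys_sum_subset, use a(1) u d in \<open>auto simp: dual_left_closed\<close>)
    also have "\<dots> = f (\<alpha>, x)"
      unfolding a(2) pure_tensor_def using f \<alpha> x by (simp add: ext E.additive_ext_gen Pi_iff)
    finally show ?thesis by (simp add: f_def)
  qed
  with a(1) show ?thesis by (simp add: a_def)
qed

lemmas pairing_closed = pairing_closed_apply[THEN conjunct1]
  and pairing_apply = pairing_closed_apply[THEN conjunct2, THEN bspec]

text \<open>The left action on functionals is precomposition with the right action on
  \<open>E\<close>. So elements with the same right action have the same action on the dual, hence
  the same coevaluation, and \<open>coev\<close> is injective.\<close>

lemma right_action_faithful:
  assumes "a \<in> carrier A" "b \<in> carrier A"
    and "\<And>y. y \<in> carrier E \<Longrightarrow> y \<triangleleft>\<^bsub>E\<^esub> a = y \<triangleleft>\<^bsub>E\<^esub> b"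
  shows "a = b"
proof -
  obtain n u d where basis: "is_dual_basis A E (n, u, d)"
    and coev: "\<And>a. a \<in> carrier A \<Longrightarrow> coev A E a = rel_class DE.rels (\<Sum>i<n. gen (a \<odot>\<^bsub>D\<^esub> d i, u i))"
    by (rule coev_expand) blast
  have "a \<odot>\<^bsub>D\<^esub> \<alpha> = b \<odot>\<^bsub>D\<^esub> \<alpha>" if "\<alpha> \<in> carrier D" for \<alpha>
    by (rule dual_eqI) (use that assms in \<open>auto simp: dual_left_closed dual_apply\<close>)
  then have "(\<Sum>i<n. gen (a \<odot>\<^bsub>D\<^esub> d i, u i)) = (\<Sum>i<n. gen (b \<odot>\<^bsub>D\<^esub> d i, u i))"
    using basis by (intro sum.cong) (auto simp: is_dual_basis_def Pi_iff)
  then have "coev A E a = coev A E b" using coev assms by simp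
  then show ?thesis using coev_bij assms by (auto simp: bij_betw_def inj_on_def)
qed

text \<open>The sum acts on \<open>y\<close> by the dual basis expansion of \<open>y\<close>, that
  is, as the identity; faithfulness makes it the unit.\<close>

lemma pairing_unit:
  obtains n u d where "u \<in> {..<n::nat} \<rightarrow> carrier E" "d \<in> {..<n} \<rightarrow> carrier D"
    "\<one> = (\<Oplus>i\<in>{..<n}. pairing (d i) (u i))"
proof -
  obtain n u d where basis: "is_dual_basis A E (n, u, d)" by (rule coev_expand) blast
  then have ud: "u \<in> {..<n} \<rightarrow> carrier E" "d \<in> {..<n} \<rightarrow> carrier D"
    and eq: "\<And>f. f \<in> carrier E \<Longrightarrow> f = (\<Oplus>\<^bsub>E\<^esub>i\<in>{..<n}. d i f \<odot>\<^bsub>E\<^esub> u i)"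
    by (auto simp: is_dual_basis_def)
  have cl: "(\<lambda>i. pairing (d i) (u i)) \<in> {..<n} \<rightarrow> carrier A"
    using ud by (auto intro!: pairing_closed)
  have "\<one> = (\<Oplus>i\<in>{..<n}. pairing (d i) (u i))"
  proof (rule right_action_faithful)
    fix y assume y: "y \<in> carrier E"
    have "y \<triangleleft>\<^bsub>E\<^esub> (\<Oplus>i\<in>{..<n}. pairing (d i) (u i)) = (\<Oplus>\<^bsub>E\<^esub>i\<in>{..<n}. y \<triangleleft>\<^bsub>E\<^esub> pairing (d i) (u i))"
      by (rule right_finsum[OF y _ cl]) simp
    also have "\<dots> = (\<Oplus>\<^bsub>E\<^esub>i\<in>{..<n}. d i y \<odot>\<^bsub>E\<^esub> u i)"
      by (rule E.finsum_cong')
        (use ud y in \<open>auto simp: pairing_apply Pi_iff left_closed dual_closed\<close>)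
    finally show "y \<triangleleft>\<^bsub>E\<^esub> \<one> = y \<triangleleft>\<^bsub>E\<^esub> (\<Oplus>i\<in>{..<n}. pairing (d i) (u i))"
      using eq[OF y] right_one[OF y] by simp
  qed (use cl in auto)
  with ud that show thesis by blast
qed

lemma ev_class:
  assumes "z upon carrier E \<times> carrier D"
  shows "ev A E (rel_class ED.rels z) = additive_ext A (\<lambda>(e, \<alpha>). \<alpha> e) z"
  unfolding ev_def
  by (rule ED.extend_additively_tens[OF A.abelian_group_axioms _ _ _ _ assms])
    (auto simp: dual_closed dual_add dual_apply)

lemma ev_pure:
  assumes "x \<in> carrier E" "\<alpha> \<in> carrier D"
  shows "ev A E (bimodule_pure_tensor A E D x \<alpha>) = \<alpha> x"
  unfolding pure_tensor_def using assms
  by (simp add: ev_class A.additive_ext_gen dual_closed)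

text \<open>The law \<open>p_q\<close> is the defining property \<open>pairing_apply\<close>.
  Linearity and balancing of the pairing are tested through the faithful right action.\<close>

sublocale morita_context A E D "\<lambda>x \<alpha>. \<alpha> x" pairing
proof unfold_locales
  fix a x \<alpha> assume *: "a \<in> carrier A" "x \<in> carrier E" "\<alpha> \<in> carrier D"
  show "pairing (a \<odot>\<^bsub>D\<^esub> \<alpha>) x = a \<otimes> pairing \<alpha> x"
    by (rule right_action_faithful)
      (use * in \<open>simp_all add: pairing_closed dual_left_closed pairing_apply right_assoc right_closed dual_apply\<close>)
  show "pairing \<alpha> (x \<triangleleft>\<^bsub>E\<^esub> a) = pairing \<alpha> x \<otimes> a"
    by (rule right_action_faithful)
      (use * in \<open>simp_all add: pairing_closed dual_closed pairing_apply right_assoc right_closed left_right\<close>)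
  show "pairing (\<alpha> \<triangleleft>\<^bsub>D\<^esub> a) x = pairing \<alpha> (a \<odot>\<^bsub>E\<^esub> x)"
    by (rule right_action_faithful)
      (use * in \<open>simp_all add: pairing_closed dual_closed pairing_apply left_assoc left_closed dual_right_closed dual_apply\<close>)
next
  fix x \<alpha> \<beta> assume *: "x \<in> carrier E" "\<alpha> \<in> carrier D" "\<beta> \<in> carrier D"
  show "pairing (\<alpha> \<oplus>\<^bsub>D\<^esub> \<beta>) x = pairing \<alpha> x \<oplus> pairing \<beta> x"
    by (rule right_action_faithful)
      (use * in \<open>simp_all add: pairing_closed dual_closed pairing_apply right_add_scalar dual_add_closed
        left_add_scalar dual_apply\<close>)
next
  fix x y \<alpha> assume *: "x \<in> carrier E" "y \<in> carrier E" "\<alpha> \<in> carrier D"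
  show "pairing \<alpha> (x \<oplus>\<^bsub>E\<^esub> y) = pairing \<alpha> x \<oplus> pairing \<alpha> y"
    by (rule right_action_faithful)
      (use * in \<open>simp_all add: pairing_closed dual_closed pairing_apply right_add_scalar left_add\<close>)
next
  fix \<alpha> x \<beta> assume *: "\<alpha> \<in> carrier D" "x \<in> carrier E" "\<beta> \<in> carrier D"
  \<comment> \<open>At a point \<open>y\<close> both sides equal the product of
    \<open>\<alpha> y\<close> and \<open>\<beta> x\<close>.\<close>
  show "pairing \<alpha> x \<odot>\<^bsub>D\<^esub> \<beta> = \<alpha> \<triangleleft>\<^bsub>D\<^esub> \<beta> x"
    by (rule dual_eqI)
      (use * in \<open>simp_all add: pairing_closed dual_closed pairing_apply dual_apply dual_left
        dual_left_closed dual_right_closed\<close>)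
qed (simp_all add: dual_closed dual_add dual_left dual_apply pairing_closed pairing_apply)

end

section \<open>Words and their action on the tensor algebra\<close>

text \<open>
  Every word acts on words: a scalar by \<open>lact\<close>, a vector by \<open>mcons\<close>, a covector by \<open>ncons\<close>, and a
  string of vectors or of covectors by composition. On words of the tensor algebra this action is the
  product, so that its associativity reduces to the relations between the three elementary operations.
  The locale is invariant under exchanging vectors and covectors.
\<close>

locale tensor_words = morita_context A M N p q
  for A :: "(complex, 'a) module" (structure) and M :: "('a, 'm) bimodule" and N :: "('a, 'n) bimodule"
    and p :: "'m \<Rightarrow> 'n \<Rightarrow> 'a" and q :: "'n \<Rightarrow> 'm \<Rightarrow> 'a" +
  fixes S :: "'a \<Rightarrow> 'g" and P :: "'m list \<Rightarrow> 'g" and Q :: "'n list \<Rightarrow> 'g"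
    and lact :: "'a \<Rightarrow> 'g \<Rightarrow> 'g" and mcons :: "'m \<Rightarrow> 'g \<Rightarrow> 'g" and ncons :: "'n \<Rightarrow> 'g \<Rightarrow> 'g"
    and opr :: "'g \<Rightarrow> 'g \<Rightarrow> 'g" and R :: "('g \<Rightarrow>\<^sub>0 int) set"
  assumes lact_S: "lact a (S b) = S (a \<otimes> b)"
    and lact_P_Nil: "lact a (P []) = S a"
    and lact_P_Cons: "lact a (P (x # xs)) = P (a \<odot>\<^bsub>M\<^esub> x # xs)"
    and lact_Q_Nil: "lact a (Q []) = S a"
    and lact_Q_Cons: "lact a (Q (\<alpha> # \<alpha>s)) = Q (a \<odot>\<^bsub>N\<^esub> \<alpha> # \<alpha>s)"
    and mcons_S: "mcons x (S a) = P [x \<triangleleft>\<^bsub>M\<^esub> a]"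
    and mcons_P: "mcons x (P xs) = P (x # xs)"
    and mcons_Q: "mcons x (Q (\<alpha> # \<alpha>s)) = lact (p x \<alpha>) (Q \<alpha>s)"
    and ncons_S: "ncons \<alpha> (S a) = Q [\<alpha> \<triangleleft>\<^bsub>N\<^esub> a]"
    and ncons_Q: "ncons \<alpha> (Q \<alpha>s) = Q (\<alpha> # \<alpha>s)"
    and ncons_P: "ncons \<alpha> (P (x # xs)) = lact (q \<alpha> x) (P xs)"
    and opr_S: "opr (S a) w = lact a w"
    and opr_P: "opr (P xs) w = foldr mcons xs w"
    and opr_Q: "opr (Q \<alpha>s) w = foldr ncons \<alpha>s w"
    and R_def: "R = {gen (S (a \<oplus> b)) - gen (S a) - gen (S b) | a b. a \<in> carrier A \<and> b \<in> carrier A} \<union>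
      (\<Union>n\<in>{1..}. power_relations P A M n) \<union> (\<Union>n\<in>{1..}. power_relations Q A N n)"
begin

text \<open>Empty strings are excluded. They arise when a contraction uses up a string, and then
  stand under \<open>lact\<close>, which turns them into scalars.\<close>

definition "G = S ` carrier A \<union> (\<Union>n\<in>{1..}. power_gens P M n) \<union> (\<Union>n\<in>{1..}. power_gens Q N n)"

lemma swap_words: "tensor_words A N M q p S Q P lact ncons mcons opr R"
  by (intro tensor_words.intro tensor_words_axioms.intro swap lact_S lact_P_Nil lact_P_Cons
      lact_Q_Nil lact_Q_Cons mcons_S mcons_P mcons_Q ncons_S ncons_Q ncons_P opr_S opr_P opr_Q)
    (simp add: R_def Un_ac)

lemma S_in_G: "a \<in> carrier A \<Longrightarrow> S a \<in> G"
  by (simp add: G_def)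

lemma P_in_G: "set xs \<subseteq> carrier M \<Longrightarrow> xs \<noteq> [] \<Longrightarrow> P xs \<in> G"
proof -
  assume "set xs \<subseteq> carrier M" "xs \<noteq> []"
  then have "P xs \<in> power_gens P M (length xs)" "length xs \<in> {1..}"
    by (auto simp: power_gens_def Suc_le_eq)
  then show ?thesis unfolding G_def by blast
qed

lemma Q_in_G: "set \<alpha>s \<subseteq> carrier N \<Longrightarrow> \<alpha>s \<noteq> [] \<Longrightarrow> Q \<alpha>s \<in> G"
proof -
  assume "set \<alpha>s \<subseteq> carrier N" "\<alpha>s \<noteq> []"
  then have "Q \<alpha>s \<in> power_gens Q N (length \<alpha>s)" "length \<alpha>s \<in> {1..}"
    by (auto simp: power_gens_def Suc_le_eq)
  then show ?thesis unfolding G_def by blast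
qed

lemma G_cases [consumes 1, case_names scalar vector covector]:
  assumes "w \<in> G"
  obtains a where "w = S a" "a \<in> carrier A"
    | x xs where "w = P (x # xs)" "x \<in> carrier M" "set xs \<subseteq> carrier M"
    | \<alpha> \<alpha>s where "w = Q (\<alpha> # \<alpha>s)" "\<alpha> \<in> carrier N" "set \<alpha>s \<subseteq> carrier N"
proof -
  consider a where "w = S a" "a \<in> carrier A"
    | xs where "w = P xs" "xs \<noteq> []" "set xs \<subseteq> carrier M"
    | \<alpha>s where "w = Q \<alpha>s" "\<alpha>s \<noteq> []" "set \<alpha>s \<subseteq> carrier N"
    using assms unfolding G_def power_gens_def by fastforce
  then show thesis
  proof cases
    case (2 xs) then show thesis using that(2)[of "hd xs" "tl xs"] by (cases xs) auto
  next
    case (3 xs) then show thesis using that(3)[of "hd xs" "tl xs"] by (cases xs) auto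
  qed (rule that(1))
qed

abbreviation "cl \<equiv> rel_class R"

lemma S_add:
  assumes "a \<in> carrier A" "b \<in> carrier A"
  shows "cl (gen (S (a \<oplus> b))) = cl (gen (S a) + gen (S b))"
  unfolding rel_class_eq_iff diff_diff_eq[symmetric]
  by (rule int_span_gen) (use assms in \<open>auto simp: R_def\<close>)

lemma S_zero: "cl (gen (S \<zero>)) = cl 0"
  using S_add[of \<zero> \<zero>] int_span_uminus[of "- gen (S \<zero>)" R] by (simp add: rel_class_eq_iff)

lemma P_add:
  assumes "set us \<subseteq> carrier M" "x \<in> carrier M" "y \<in> carrier M" "set vs \<subseteq> carrier M"
  shows "cl (gen (P (us @ (x \<oplus>\<^bsub>M\<^esub> y) # vs))) = cl (gen (P (us @ x # vs)) + gen (P (us @ y # vs)))"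
proof -
  have "gen (P (us @ (x \<oplus>\<^bsub>M\<^esub> y) # vs)) - gen (P (us @ x # vs)) - gen (P (us @ y # vs))
      \<in> power_relations P A M (length us + 1 + length vs)"
    unfolding power_relations_def using assms by blast
  then show ?thesis
    unfolding rel_class_eq_iff diff_diff_eq[symmetric]
    by (intro int_span_gen) (auto simp: R_def intro!: bexI[of _ "length us + 1 + length vs"])
qed

lemma P_balanced:
  assumes "set us \<subseteq> carrier M" "x \<in> carrier M" "a \<in> carrier A" "y \<in> carrier M" "set vs \<subseteq> carrier M"
  shows "cl (gen (P (us @ (x \<triangleleft>\<^bsub>M\<^esub> a) # y # vs))) = cl (gen (P (us @ x # (a \<odot>\<^bsub>M\<^esub> y) # vs)))"
proof -
  have "gen (P (us @ (x \<triangleleft>\<^bsub>M\<^esub> a) # y # vs)) - gen (P (us @ x # (a \<odot>\<^bsub>M\<^esub> y) # vs))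
      \<in> power_relations P A M (length us + 2 + length vs)"
    unfolding power_relations_def using assms by blast
  then show ?thesis
    unfolding rel_class_eq_iff
    by (intro int_span_gen) (auto simp: R_def intro!: bexI[of _ "length us + 2 + length vs"])
qed

lemma lact_closed: "a \<in> carrier A \<Longrightarrow> w \<in> G \<Longrightarrow> lact a w \<in> G"
  by (elim G_cases)
    (auto simp: lact_S lact_P_Cons lact_Q_Cons M.left_closed N.left_closed intro!: S_in_G P_in_G Q_in_G)

lemma lact_Q_closed: "a \<in> carrier A \<Longrightarrow> set xs \<subseteq> carrier N \<Longrightarrow> lact a (Q xs) \<in> G"
  by (cases xs) (auto simp: lact_Q_Nil intro!: S_in_G lact_closed Q_in_G)

lemma mcons_closed: "x \<in> carrier M \<Longrightarrow> w \<in> G \<Longrightarrow> mcons x w \<in> G"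
  by (elim G_cases)
    (auto simp: mcons_S mcons_P mcons_Q M.right_closed p_closed intro!: P_in_G lact_Q_closed)

lemma foldr_mcons_closed: "set xs \<subseteq> carrier M \<Longrightarrow> w \<in> G \<Longrightarrow> foldr mcons xs w \<in> G"
  by (induction xs) (auto intro: mcons_closed)

lemma foldr_mcons_P: "foldr mcons us (P vs) = P (us @ vs)"
  by (induction us) (simp_all add: mcons_P)

lemma lact_lact: "a \<in> carrier A \<Longrightarrow> b \<in> carrier A \<Longrightarrow> w \<in> G \<Longrightarrow> lact a (lact b w) = lact (a \<otimes> b) w"
  by (elim G_cases)
    (auto simp: lact_S lact_P_Cons lact_Q_Cons M.left_assoc N.left_assoc M.A.m_assoc)

text \<open>The tail left by a contraction may be empty and thus outside \<open>G\<close>, so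
  \<open>lact_lact\<close> does not cover it.\<close>

lemma lact_lact_Q: "a \<in> carrier A \<Longrightarrow> b \<in> carrier A \<Longrightarrow> set \<alpha>s \<subseteq> carrier N \<Longrightarrow>
    lact a (lact b (Q \<alpha>s)) = lact (a \<otimes> b) (Q \<alpha>s)"
  by (cases \<alpha>s) (auto simp: lact_Q_Nil lact_S lact_Q_Cons N.left_assoc)

end

text \<open>Provides the mirror image of each lemma, with vectors and covectors exchanged, over the
  same set of words. The context is closed and reopened below so that the mirror images of lemmas
  just proved become available.\<close>

sublocale tensor_words \<subseteq> swapped: tensor_words A N M q p S Q P lact ncons mcons opr R
  rewrites "tensor_words.G A N M S Q P = G"
proof -
  show 1: "tensor_words A N M q p S Q P lact ncons mcons opr R" by (rule swap_words)
  show "tensor_words.G A N M S Q P = G"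
    by (simp add: G_def tensor_words.G_def[OF 1] Un_ac)
qed

context tensor_words
begin

lemma lact_add:
  assumes "a \<in> carrier A" "b \<in> carrier A" "w \<in> G"
  shows "cl (gen (lact (a \<oplus> b) w)) = cl (gen (lact a w) + gen (lact b w))"
  using assms(3)
proof (cases rule: G_cases)
  case (vector x xs)
  then show ?thesis
    using P_add[of "[]" "a \<odot>\<^bsub>M\<^esub> x" "b \<odot>\<^bsub>M\<^esub> x" xs] assms
    by (simp add: lact_P_Cons M.left_add_scalar M.left_closed)
next
  case (covector x xs)
  then show ?thesis
    using swapped.P_add[of "[]" "a \<odot>\<^bsub>N\<^esub> x" "b \<odot>\<^bsub>N\<^esub> x" xs] assms
    by (simp add: lact_Q_Cons N.left_add_scalar N.left_closed)
qed (use assms in \<open>simp add: lact_S M.A.l_distr S_add\<close>)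

lemma lact_Q_add:
  assumes "a \<in> carrier A" "b \<in> carrier A" "set \<alpha>s \<subseteq> carrier N"
  shows "cl (gen (lact (a \<oplus> b) (Q \<alpha>s))) = cl (gen (lact a (Q \<alpha>s)) + gen (lact b (Q \<alpha>s)))"
  using assms by (cases \<alpha>s) (simp_all add: lact_Q_Nil S_add lact_add Q_in_G)

text \<open>Turns descent of a map on words into five congruences: additivity for scalars, and
  additivity and balancing for strings of either kind.\<close>

lemma respects_relations:
  assumes S: "\<And>a b. \<lbrakk>a \<in> carrier A; b \<in> carrier A\<rbrakk> \<Longrightarrow>
      rel_class R' (\<phi> (S (a \<oplus> b))) = rel_class R' (\<phi> (S a) + \<phi> (S b))"
    and P_add: "\<And>us x y vs. \<lbrakk>set us \<subseteq> carrier M; x \<in> carrier M; y \<in> carrier M; set vs \<subseteq> carrier M\<rbrakk> \<Longrightarrow>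
      rel_class R' (\<phi> (P (us @ (x \<oplus>\<^bsub>M\<^esub> y) # vs))) = rel_class R' (\<phi> (P (us @ x # vs)) + \<phi> (P (us @ y # vs)))"
    and P_balanced: "\<And>us x a y vs. \<lbrakk>set us \<subseteq> carrier M; x \<in> carrier M; a \<in> carrier A; y \<in> carrier M;
        set vs \<subseteq> carrier M\<rbrakk> \<Longrightarrow>
      rel_class R' (\<phi> (P (us @ (x \<triangleleft>\<^bsub>M\<^esub> a) # y # vs))) = rel_class R' (\<phi> (P (us @ x # (a \<odot>\<^bsub>M\<^esub> y) # vs)))"
    and Q_add: "\<And>us x y vs. \<lbrakk>set us \<subseteq> carrier N; x \<in> carrier N; y \<in> carrier N; set vs \<subseteq> carrier N\<rbrakk> \<Longrightarrow>
      rel_class R' (\<phi> (Q (us @ (x \<oplus>\<^bsub>N\<^esub> y) # vs))) = rel_class R' (\<phi> (Q (us @ x # vs)) + \<phi> (Q (us @ y # vs)))"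
    and Q_balanced: "\<And>us x a y vs. \<lbrakk>set us \<subseteq> carrier N; x \<in> carrier N; a \<in> carrier A; y \<in> carrier N;
        set vs \<subseteq> carrier N\<rbrakk> \<Longrightarrow>
      rel_class R' (\<phi> (Q (us @ (x \<triangleleft>\<^bsub>N\<^esub> a) # y # vs))) = rel_class R' (\<phi> (Q (us @ x # (a \<odot>\<^bsub>N\<^esub> y) # vs)))"
    and "r \<in> R"
  shows "frag_extend \<phi> r \<in> int_span R'"
proof -
  have add: "frag_extend \<phi> (gen u - gen v - gen w) \<in> int_span R'"
    if "rel_class R' (\<phi> u) = rel_class R' (\<phi> v + \<phi> w)" for u v w
    using that by (simp add: frag_extend_diff frag_extend_add rel_class_eq_iff algebra_simps)
  have bal: "frag_extend \<phi> (gen u - gen v) \<in> int_span R'"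
    if "rel_class R' (\<phi> u) = rel_class R' (\<phi> v)" for u v
    using that by (simp add: frag_extend_diff rel_class_eq_iff)
  from \<open>r \<in> R\<close> consider
      a b where "r = gen (S (a \<oplus> b)) - gen (S a) - gen (S b)" "a \<in> carrier A" "b \<in> carrier A"
    | n where "r \<in> power_relations P A M n" | n where "r \<in> power_relations Q A N n"
    unfolding R_def by blast
  then show ?thesis
  proof cases
    case 1 then show ?thesis by (simp only:) (rule add[OF S])
  next
    case (2 n)
    then show ?thesis
      unfolding power_relations_def
      by (elim UnE CollectE exE conjE; hypsubst) (rule add[OF P_add] bal[OF P_balanced]; assumption)+
  next
    case (3 n)
    then show ?thesis
      unfolding power_relations_def
      by (elim UnE CollectE exE conjE; hypsubst) (rule add[OF Q_add] bal[OF Q_balanced]; assumption)+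
  qed
qed

lemma lact_P_add_cong:
  assumes "a \<in> carrier A" "set us \<subseteq> carrier M" "x \<in> carrier M" "y \<in> carrier M" "set vs \<subseteq> carrier M"
  shows "cl (gen (lact a (P (us @ (x \<oplus>\<^bsub>M\<^esub> y) # vs))))
    = cl (gen (lact a (P (us @ x # vs))) + gen (lact a (P (us @ y # vs))))"
proof (cases us)
  case Nil
  then show ?thesis using P_add[of "[]" "a \<odot>\<^bsub>M\<^esub> x" "a \<odot>\<^bsub>M\<^esub> y" vs] assms
    by (simp add: lact_P_Cons M.left_add M.left_closed)
next
  case (Cons u us')
  then show ?thesis using P_add[of "a \<odot>\<^bsub>M\<^esub> u # us'" x y vs] assms
    by (simp add: lact_P_Cons M.left_closed)
qed

lemma lact_P_balanced_cong:
  assumes "b \<in> carrier A" "set us \<subseteq> carrier M" "x \<in> carrier M" "a \<in> carrier A" "y \<in> carrier M"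
    "set vs \<subseteq> carrier M"
  shows "cl (gen (lact b (P (us @ (x \<triangleleft>\<^bsub>M\<^esub> a) # y # vs)))) = cl (gen (lact b (P (us @ x # (a \<odot>\<^bsub>M\<^esub> y) # vs))))"
proof (cases us)
  case Nil
  then show ?thesis using P_balanced[of "[]" "b \<odot>\<^bsub>M\<^esub> x" a y vs] assms
    by (simp add: lact_P_Cons M.left_right M.left_closed)
next
  case (Cons u us')
  then show ?thesis using P_balanced[of "b \<odot>\<^bsub>M\<^esub> u # us'" x a y vs] assms
    by (simp add: lact_P_Cons M.left_closed)
qed

end

section \<open>The elementary operations preserve the relations\<close>

context tensor_words
begin

lemma lact_relations:
  assumes "a \<in> carrier A" "r \<in> R"
  shows "frag_extend (\<lambda>w. gen (lact a w)) r \<in> int_span R"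
  by (rule respects_relations[OF _ _ _ _ _ assms(2)])
    (simp_all add: assms lact_S M.A.r_distr S_add lact_P_add_cong lact_P_balanced_cong
      swapped.lact_P_add_cong swapped.lact_P_balanced_cong)

lemma mcons_add:
  assumes "x \<in> carrier M" "y \<in> carrier M" "w \<in> G"
  shows "cl (gen (mcons (x \<oplus>\<^bsub>M\<^esub> y) w)) = cl (gen (mcons x w) + gen (mcons y w))"
  using assms(3)
proof (cases rule: G_cases)
  case (scalar a)
  then show ?thesis using P_add[of "[]" "x \<triangleleft>\<^bsub>M\<^esub> a" "y \<triangleleft>\<^bsub>M\<^esub> a" "[]"] assms
    by (simp add: mcons_S M.right_add M.right_closed)
next
  case (vector z zs)
  then show ?thesis using P_add[of "[]" x y "z # zs"] assms by (simp add: mcons_P)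
next
  case (covector \<alpha> \<alpha>s)
  then show ?thesis using assms by (simp add: mcons_Q p_add_left lact_Q_add p_closed)
qed

text \<open>Among vectors the new letter merely lengthens the untouched initial segment of a
  relation. Among covectors the first letter is consumed: if the relation sits there, additivity and
  right linearity of \<open>p\<close> take over, and otherwise the relation survives under
  \<open>lact\<close>.\<close>

lemma mcons_relations:
  assumes x: "x \<in> carrier M" and "r \<in> R"
  shows "frag_extend (\<lambda>w. gen (mcons x w)) r \<in> int_span R"
proof (rule respects_relations[OF _ _ _ _ _ assms(2)])
  fix a b assume "a \<in> carrier A" "b \<in> carrier A"
  then show "cl (gen (mcons x (S (a \<oplus> b)))) = cl (gen (mcons x (S a)) + gen (mcons x (S b)))"
    using P_add[of "[]" "x \<triangleleft>\<^bsub>M\<^esub> a" "x \<triangleleft>\<^bsub>M\<^esub> b" "[]"] x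
    by (simp add: mcons_S M.right_add_scalar M.right_closed)
next
  fix us y z vs
  assume "set us \<subseteq> carrier M" "y \<in> carrier M" "z \<in> carrier M" "set vs \<subseteq> carrier M"
  then show "cl (gen (mcons x (P (us @ (y \<oplus>\<^bsub>M\<^esub> z) # vs))))
    = cl (gen (mcons x (P (us @ y # vs))) + gen (mcons x (P (us @ z # vs))))"
    using P_add[of "x # us" y z vs] x by (simp add: mcons_P)
next
  fix us y a z vs
  assume "set us \<subseteq> carrier M" "y \<in> carrier M" "a \<in> carrier A" "z \<in> carrier M" "set vs \<subseteq> carrier M"
  then show "cl (gen (mcons x (P (us @ (y \<triangleleft>\<^bsub>M\<^esub> a) # z # vs))))
    = cl (gen (mcons x (P (us @ y # (a \<odot>\<^bsub>M\<^esub> z) # vs))))"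
    using P_balanced[of "x # us" y a z vs] x by (simp add: mcons_P)
next
  fix us \<alpha> \<beta> vs
  assume *: "set us \<subseteq> carrier N" "\<alpha> \<in> carrier N" "\<beta> \<in> carrier N" "set vs \<subseteq> carrier N"
  show "cl (gen (mcons x (Q (us @ (\<alpha> \<oplus>\<^bsub>N\<^esub> \<beta>) # vs))))
    = cl (gen (mcons x (Q (us @ \<alpha> # vs))) + gen (mcons x (Q (us @ \<beta> # vs))))"
  proof (cases us)
    case Nil
    with * x show ?thesis by (simp add: mcons_Q p_add_right lact_Q_add p_closed)
  next
    case (Cons \<gamma> us')
    with * x show ?thesis
      using swapped.lact_P_add_cong[of "p x \<gamma>" us' \<alpha> \<beta> vs] by (simp add: mcons_Q p_closed)
  qed
next
  fix us \<alpha> a \<beta> vs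
  assume *: "set us \<subseteq> carrier N" "\<alpha> \<in> carrier N" "a \<in> carrier A" "\<beta> \<in> carrier N" "set vs \<subseteq> carrier N"
  show "cl (gen (mcons x (Q (us @ (\<alpha> \<triangleleft>\<^bsub>N\<^esub> a) # \<beta> # vs))))
    = cl (gen (mcons x (Q (us @ \<alpha> # (a \<odot>\<^bsub>N\<^esub> \<beta>) # vs))))"
  proof (cases us)
    case Nil
    with * x show ?thesis by (simp add: mcons_Q lact_Q_Cons p_right N.left_assoc p_closed)
  next
    case (Cons \<gamma> us')
    with * x show ?thesis
      using swapped.lact_P_balanced_cong[of "p x \<gamma>" us' \<alpha> a \<beta> vs] by (simp add: mcons_Q p_closed)
  qed
qed

lemma mcons_cong:
  assumes "x \<in> carrier M" "cl (gen v) = cl (gen w)"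
  shows "cl (gen (mcons x v)) = cl (gen (mcons x w))"
  using frag_extend_class_cong[OF mcons_relations[OF assms(1)] assms(2)] by simp

lemma foldr_mcons_cong:
  assumes "set xs \<subseteq> carrier M" "cl (gen v) = cl (gen w)"
  shows "cl (gen (foldr mcons xs v)) = cl (gen (foldr mcons xs w))"
  using assms
proof (induction xs)
  case (Cons x xs)
  then show ?case by (simp only: foldr.simps o_apply) (intro mcons_cong, auto)
qed simp

lemma lact_mcons:
  assumes "a \<in> carrier A" "x \<in> carrier M" "w \<in> G"
  shows "lact a (mcons x w) = mcons (a \<odot>\<^bsub>M\<^esub> x) w"
  using assms(3)
  by (cases rule: G_cases)
    (use assms in \<open>simp_all add: mcons_S mcons_P mcons_Q lact_P_Cons M.left_right p_left lact_lact_Q p_closed\<close>)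

end

section \<open>Cancellation of opposite letters and associativity\<close>

context tensor_words
begin

text \<open>In contrast to \<open>lact_mcons\<close>, which is an equality of words, a scalar
  between two vectors can be moved only by a balancing relation, hence the congruence.\<close>

lemma mcons_lact:
  assumes "a \<in> carrier A" "x \<in> carrier M" "w \<in> G"
  shows "cl (gen (mcons x (lact a w))) = cl (gen (mcons (x \<triangleleft>\<^bsub>M\<^esub> a) w))"
  using assms(3)
proof (cases rule: G_cases)
  case (vector y ys)
  then show ?thesis
    using P_balanced[of "[]" x a y ys] assms by (simp add: mcons_P lact_P_Cons)
qed (use assms in \<open>simp_all add: mcons_S lact_S M.right_assoc lact_Q_Cons mcons_Q p_balanced\<close>)

text \<open>This is where the Morita identity enters. If \<open>w\<close> begins with a vector
  \<open>y\<close>, then \<open>ncons\<close> contracts \<open>\<alpha>\<close> with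
  \<open>y\<close> and not with \<open>x\<close>, and \<open>p_q\<close> exchanges one contraction
  for the other.\<close>

lemma mcons_ncons:
  assumes "x \<in> carrier M" "\<alpha> \<in> carrier N" "w \<in> G"
  shows "cl (gen (mcons x (ncons \<alpha> w))) = cl (gen (lact (p x \<alpha>) w))"
  using assms(3)
proof (cases rule: G_cases)
  case (vector y ys)
  show ?thesis
  proof (cases ys)
    case Nil
    with vector assms show ?thesis by (simp add: ncons_P lact_P_Nil mcons_S lact_P_Cons p_q)
  next
    case (Cons z zs)
    with vector assms show ?thesis
      using P_balanced[of "[]" x "q \<alpha> y" z zs] by (simp add: ncons_P lact_P_Cons mcons_P p_q q_closed)
  qed
qed (use assms in \<open>simp_all add: ncons_S ncons_Q mcons_Q lact_Q_Nil lact_S p_right\<close>)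

text \<open>Associativity for a single letter on the left. If \<open>w\<close> begins with a
  covector, that letter has disappeared on the left-hand side but still acts on the right-hand side,
  and \<open>mcons_ncons\<close> cancels it there.\<close>

lemma opr_mcons:
  assumes "x \<in> carrier M" "w \<in> G" "u \<in> G"
  shows "cl (gen (opr (mcons x w) u)) = cl (gen (mcons x (opr w u)))"
  using assms(2)
proof (cases rule: G_cases)
  case (scalar b)
  then show ?thesis using assms mcons_lact[of b x u] by (simp add: mcons_S opr_P opr_S)
next
  case (vector y ys)
  then show ?thesis by (simp add: mcons_P opr_P)
next
  case (covector \<alpha> \<alpha>s)
  have "opr (lact (p x \<alpha>) (Q \<alpha>s)) u = lact (p x \<alpha>) (foldr ncons \<alpha>s u)"
    using covector assms
    by (cases \<alpha>s) (simp_all add: lact_Q_Nil opr_S lact_Q_Cons opr_Q swapped.lact_mcons p_closed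
        swapped.foldr_mcons_closed)
  then show ?thesis
    using covector assms mcons_ncons[of x \<alpha> "foldr ncons \<alpha>s u"]
    by (simp add: mcons_Q opr_Q swapped.foldr_mcons_closed)
qed

end

context tensor_words
begin

lemma opr_lact:
  assumes "a \<in> carrier A" "w \<in> G" "u \<in> G"
  shows "opr (lact a w) u = lact a (opr w u)"
  using assms(2)
  by (cases rule: G_cases)
    (use assms in \<open>simp_all add: lact_S opr_S lact_lact lact_P_Cons lact_Q_Cons opr_P opr_Q
      lact_mcons swapped.lact_mcons foldr_mcons_closed swapped.foldr_mcons_closed\<close>)

lemma opr_foldr_mcons:
  assumes "set xs \<subseteq> carrier M" "w \<in> G" "u \<in> G"
  shows "cl (gen (opr (foldr mcons xs w) u)) = cl (gen (foldr mcons xs (opr w u)))"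
  using assms(1)
proof (induction xs)
  case (Cons x xs)
  then have "cl (gen (opr (mcons x (foldr mcons xs w)) u)) = cl (gen (mcons x (opr (foldr mcons xs w) u)))"
    using assms by (intro opr_mcons foldr_mcons_closed) auto
  also have "\<dots> = cl (gen (mcons x (foldr mcons xs (opr w u))))"
    using Cons by (intro mcons_cong) auto
  finally show ?case by simp
qed simp

end

context tensor_words
begin

lemma opr_closed: "v \<in> G \<Longrightarrow> w \<in> G \<Longrightarrow> opr v w \<in> G"
  by (erule G_cases)
    (simp_all add: opr_S opr_P opr_Q lact_closed mcons_closed foldr_mcons_closed
      swapped.mcons_closed swapped.foldr_mcons_closed)

text \<open>A word acts as a composite of single letters, or as one scalar, and each of these is
  already known to commute with multiplication from the right.\<close>

lemma opr_assoc:
  assumes "v \<in> G" "w \<in> G" "u \<in> G"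
  shows "cl (gen (opr (opr v w) u)) = cl (gen (opr v (opr w u)))"
  using assms(1)
proof (cases rule: G_cases)
  case (scalar a)
  then show ?thesis using assms by (simp add: opr_S opr_lact)
next
  case (vector x xs)
  then show ?thesis using assms opr_foldr_mcons[of "x # xs" w u] by (simp add: opr_P)
next
  case (covector x xs)
  then show ?thesis using assms swapped.opr_foldr_mcons[of "x # xs" w u] by (simp add: opr_Q)
qed

text \<open>Formulated for the whole span: after one letter the image of a relation need not be a
  relation, only an element of the span.\<close>

lemma foldr_mcons_relations:
  assumes "set xs \<subseteq> carrier M" "z \<in> int_span R"
  shows "frag_extend (\<lambda>w. gen (foldr mcons xs w)) z \<in> int_span R"
  using assms
proof (induction xs)
  case Nil
  then show ?case using frag_expansion[of z] by simp
next
  case (Cons x xs)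
  have "frag_extend (\<lambda>w. gen (foldr mcons (x # xs) w)) z
    = frag_extend (\<lambda>w. gen (mcons x w)) (frag_extend (\<lambda>w. gen (foldr mcons xs w)) z)"
    using frag_extend_compose[of "\<lambda>w. gen (mcons x w)" "foldr mcons xs" z] by (simp add: o_def)
  also have "\<dots> \<in> int_span R"
    by (rule frag_extend_int_span[OF mcons_relations]) (use Cons in auto)
  finally show ?case .
qed

end

section \<open>The product of words respects relations in both factors\<close>

context tensor_words
begin

lemma opr_right_relations:
  assumes "v \<in> G" "r \<in> R"
  shows "frag_extend (\<lambda>w. gen (opr v w)) r \<in> int_span R"
  using assms(1)
proof (cases rule: G_cases)
  case (scalar a)
  then show ?thesis using lact_relations assms by (simp add: opr_S)
next
  case (vector x xs)
  then show ?thesis using foldr_mcons_relations[of "x # xs" r] assms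
    by (simp only: opr_P) (simp add: int_span_gen)
next
  case (covector x xs)
  then show ?thesis using swapped.foldr_mcons_relations[of "x # xs" r] assms
    by (simp only: opr_Q) (simp add: int_span_gen)
qed

text \<open>The letters behind the relation are absorbed into \<open>w'\<close>, where additivity of
  \<open>mcons\<close> applies. The letters in front then transport the resulting element of the
  span.\<close>

lemma opr_P_add:
  assumes "set us \<subseteq> carrier M" "x \<in> carrier M" "y \<in> carrier M" "set vs \<subseteq> carrier M" "w \<in> G"
  shows "cl (gen (opr (P (us @ (x \<oplus>\<^bsub>M\<^esub> y) # vs)) w))
    = cl (gen (opr (P (us @ x # vs)) w) + gen (opr (P (us @ y # vs)) w))"
proof -
  define w' where "w' = foldr mcons vs w"
  have "gen (mcons (x \<oplus>\<^bsub>M\<^esub> y) w') - (gen (mcons x w') + gen (mcons y w')) \<in> int_span R"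
    using mcons_add[of x y w'] assms by (simp add: rel_class_eq_iff w'_def foldr_mcons_closed)
  from foldr_mcons_relations[OF assms(1) this] show ?thesis
    by (simp add: rel_class_eq_iff frag_extend_diff frag_extend_add opr_P w'_def)
qed

lemma opr_P_balanced:
  assumes "set us \<subseteq> carrier M" "x \<in> carrier M" "a \<in> carrier A" "y \<in> carrier M" "set vs \<subseteq> carrier M"
    "w \<in> G"
  shows "cl (gen (opr (P (us @ (x \<triangleleft>\<^bsub>M\<^esub> a) # y # vs)) w))
    = cl (gen (opr (P (us @ x # (a \<odot>\<^bsub>M\<^esub> y) # vs)) w))"
proof -
  define w' where "w' = foldr mcons vs w"
  have w': "w' \<in> G" using assms by (simp add: w'_def foldr_mcons_closed)
  \<comment> \<open>Both sides agree with letting \<open>a\<close> act on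
    \<open>mcons y w'\<close>.\<close>
  have "cl (gen (mcons (x \<triangleleft>\<^bsub>M\<^esub> a) (mcons y w'))) = cl (gen (mcons x (mcons (a \<odot>\<^bsub>M\<^esub> y) w')))"
    using mcons_lact[of a x "mcons y w'"] assms w' by (simp add: mcons_closed lact_mcons)
  from foldr_mcons_cong[OF assms(1) this] show ?thesis by (simp add: opr_P w'_def)
qed

end

context tensor_words
begin

lemma opr_left_relations:
  assumes "w \<in> G" "r \<in> R"
  shows "frag_extend (\<lambda>v. gen (opr v w)) r \<in> int_span R"
  by (rule respects_relations[OF _ opr_P_add opr_P_balanced swapped.opr_P_add swapped.opr_P_balanced assms(2)])
    (use assms in \<open>simp_all add: opr_S lact_add\<close>)

lemma foldr_mcons_S:
  "xs \<noteq> [] \<Longrightarrow> foldr mcons xs (S a) = P (butlast xs @ [last xs \<triangleleft>\<^bsub>M\<^esub> a])"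
  by (induction xs) (auto simp: mcons_S mcons_P)

text \<open>A scalar that is central on \<open>M\<close> travels through the string one balancing
  relation at a time. It is used for the complex numbers, to make the tensor product an algebra over
  them.\<close>

lemma P_scalar_through:
  assumes "c \<in> carrier A" "\<And>x. x \<in> carrier M \<Longrightarrow> c \<odot>\<^bsub>M\<^esub> x = x \<triangleleft>\<^bsub>M\<^esub> c"
    "set xs \<subseteq> carrier M" "x \<in> carrier M"
  shows "cl (gen (lact c (P (x # xs)))) = cl (gen (foldr mcons (x # xs) (S c)))"
  using assms(3,4)
proof (induction xs arbitrary: x)
  case Nil
  then show ?case by (simp add: lact_P_Cons mcons_S assms)
next
  case (Cons y ys)
  have "cl (gen (lact c (P (x # y # ys)))) = cl (gen (P (x # c \<odot>\<^bsub>M\<^esub> y # ys)))"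
    using P_balanced[of "[]" x c y ys] Cons.prems assms(1,2) by (simp add: lact_P_Cons)
  also have "\<dots> = cl (gen (mcons x (lact c (P (y # ys)))))" by (simp add: mcons_P lact_P_Cons)
  also have "\<dots> = cl (gen (mcons x (foldr mcons (y # ys) (S c))))"
    using Cons by (intro mcons_cong) auto
  finally show ?case by simp
qed

text \<open>The recursion common to \<open>ev_power\<close> and \<open>coev_inv_power\<close>. The
  contractions are nested: the first vector meets the last covector. The guards record where the
  value of \<open>ev\<close> on a pure tensor is known.\<close>

definition is_pairing_power :: "('m list \<Rightarrow> 'n list \<Rightarrow> 'a) \<Rightarrow> bool" where
  "is_pairing_power f \<longleftrightarrow> (\<forall>\<alpha>s. f [] \<alpha>s = \<one>) \<and>
    (\<forall>x xs \<alpha>s. x \<in> carrier M \<longrightarrow> f xs (butlast \<alpha>s) \<in> carrier A \<longrightarrow> \<alpha>s \<noteq> [] \<longrightarrow> set \<alpha>s \<subseteq> carrier N \<longrightarrow>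
      f (x # xs) \<alpha>s = p (x \<triangleleft>\<^bsub>M\<^esub> f xs (butlast \<alpha>s)) (last \<alpha>s))"

text \<open>\<open>foldr\<close> starts with the last vector, so it contracts from the inside
  outwards, just as the nested recursion does.\<close>

lemma foldr_mcons_Q:
  assumes f: "is_pairing_power f"
    and "set xs \<subseteq> carrier M" "set \<alpha>s \<subseteq> carrier N" "xs \<noteq> []" "length xs \<le> length \<alpha>s"
  shows "f xs (take (length xs) \<alpha>s) \<in> carrier A \<and>
    foldr mcons xs (Q \<alpha>s) = lact (f xs (take (length xs) \<alpha>s)) (Q (drop (length xs) \<alpha>s))"
  using assms(2,4,5)
proof (induction xs)
  case (Cons x xs)
  show ?case
  proof (cases "xs = []")
    case True
    obtain \<alpha> \<alpha>s' where \<alpha>s: "\<alpha>s = \<alpha> # \<alpha>s'" using Cons.prems by (cases \<alpha>s) auto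
    with True Cons.prems assms(3) show ?thesis
      by (simp add: f[unfolded is_pairing_power_def] M.right_one mcons_Q p_closed)
  next
    case False
    define n where "n = length xs"
    \<comment> \<open>The scalar produced by the inner contractions. It multiplies the next covector
      \<open>\<beta>\<close> from the left, and \<open>p_balanced\<close> moves it to
      \<open>x\<close>, where the recursion has it.\<close>
    define e where "e = f xs (take n \<alpha>s)"
    have IH: "e \<in> carrier A" "foldr mcons xs (Q \<alpha>s) = lact e (Q (drop n \<alpha>s))"
      using Cons False by (auto simp: n_def e_def)
    have n: "n < length \<alpha>s" using Cons.prems by (simp add: n_def)
    then obtain \<beta> rest where drop: "drop n \<alpha>s = \<beta> # rest" by (cases "drop n \<alpha>s") auto
    then have \<beta>: "\<beta> \<in> carrier N" "set rest \<subseteq> carrier N"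
      using set_drop_subset[of n \<alpha>s] assms(3) by auto
    have take: "take (Suc n) \<alpha>s = take n \<alpha>s @ [\<beta>]"
      using n drop by (metis take_Suc_conv_app_nth nth_via_drop)
    have "drop (Suc n) \<alpha>s = rest" using drop by (metis drop_Suc drop_tl list.sel(3))
    moreover have "set (take (Suc n) \<alpha>s) \<subseteq> carrier N" using assms(3) set_take_subset by fast
    ultimately show ?thesis
      using Cons.prems IH \<beta>
      by (simp add: n_def[symmetric] take drop f[unfolded is_pairing_power_def] e_def[symmetric] lact_Q_Cons mcons_Q p_balanced p_closed
          M.right_closed N.left_closed)
  qed
qed simp

text \<open>The last vectors, as many as there are covectors, leave only a scalar, and the last of
  the remaining vectors absorbs it from the right.\<close>

lemma foldr_mcons_Q_long:
  assumes f: "is_pairing_power f" and xs: "set xs \<subseteq> carrier M"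
    and \<alpha>s: "set \<alpha>s \<subseteq> carrier N" "\<alpha>s \<noteq> []" "length \<alpha>s < length xs"
    and k: "k = length xs - length \<alpha>s"
  shows "foldr mcons xs (Q \<alpha>s)
    = P (butlast (take k xs) @ [last (take k xs) \<triangleleft>\<^bsub>M\<^esub> f (drop k xs) \<alpha>s])"
proof -
  have "length (drop k xs) = length \<alpha>s" "set (drop k xs) \<subseteq> carrier M"
    using k \<alpha>s(3) xs set_drop_subset[of k xs] by auto
  then have "foldr mcons (drop k xs) (Q \<alpha>s) = S (f (drop k xs) \<alpha>s)"
    using foldr_mcons_Q[OF f _ \<alpha>s(1), of "drop k xs"] \<alpha>s(2) by (cases "drop k xs = []") (simp_all add: lact_Q_Nil)
  then have "foldr mcons (take k xs @ drop k xs) (Q \<alpha>s) = foldr mcons (take k xs) (S (f (drop k xs) \<alpha>s))"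
    by (simp only: foldr_append o_apply)
  moreover have "foldr mcons (take k xs) (S (f (drop k xs) \<alpha>s))
      = P (butlast (take k xs) @ [last (take k xs) \<triangleleft>\<^bsub>M\<^esub> f (drop k xs) \<alpha>s])"
    by (rule foldr_mcons_S) (use k \<alpha>s(3) in auto)
  ultimately show ?thesis by (simp only: append_take_drop_id)
qed

end

section \<open>The tensor algebra of a weak line module\<close>

lemma frag_extend_fun_diff: "frag_extend (\<lambda>x. f x - g x) z = frag_extend f z - frag_extend g z"
  using subset_UNIV by (induction z rule: frag_induction) (auto simp: frag_extend_diff)

lemma frag_extend_fun_zero: "frag_extend (\<lambda>x. 0) z = 0"
  by (rule frag_extend_eq_0) simp

lemma power_relations_keys:
  assumes "abelian_group M" "\<And>a x. a \<in> carrier A \<Longrightarrow> x \<in> carrier M \<Longrightarrow> a \<odot>\<^bsub>M\<^esub> x \<in> carrier M"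
    and "\<And>a x. a \<in> carrier A \<Longrightarrow> x \<in> carrier M \<Longrightarrow> x \<triangleleft>\<^bsub>M\<^esub> a \<in> carrier M"
    and "r \<in> power_relations W A M n"
  shows "r upon power_gens W M n"
proof -
  interpret abelian_group M by fact
  have gens: "W xs \<in> power_gens W M n" if "length xs = n" "set xs \<subseteq> carrier M" for xs
    using that by (auto simp: power_gens_def)
  show ?thesis
    using assms(4) unfolding power_relations_def
    by (elim UnE CollectE exE conjE) (simp_all add: keys_diff_subset gens assms(2,3))
qed

fun word_degree :: "('a, 'l) simple \<Rightarrow> int" where
  "word_degree (Scalar a) = 0"
| "word_degree (Vectors xs) = int (length xs)"
| "word_degree (Covectors \<alpha>s) = - int (length \<alpha>s)"

context weak_line
begin

text \<open>The clause for \<open>Covectors []\<close>, which is not a word, reads the empty tensor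
  as the unit; the same convention is used for \<open>covector_cons\<close>.\<close>

fun vector_cons :: "'l \<Rightarrow> ('a, 'l) simple \<Rightarrow> ('a, 'l) simple" where
  "vector_cons x (Scalar a) = Vectors [x \<triangleleft>\<^bsub>E\<^esub> a]"
| "vector_cons x (Vectors xs) = Vectors (x # xs)"
| "vector_cons x (Covectors []) = Vectors [x]"
| "vector_cons x (Covectors (\<alpha> # \<alpha>s)) = left_act A E (\<alpha> x) (Covectors \<alpha>s)"

fun covector_cons :: "('l \<Rightarrow> 'a) \<Rightarrow> ('a, 'l) simple \<Rightarrow> ('a, 'l) simple" where
  "covector_cons \<alpha> (Scalar a) = Covectors [\<alpha> \<triangleleft>\<^bsub>D\<^esub> a]"
| "covector_cons \<alpha> (Covectors \<alpha>s) = Covectors (\<alpha> # \<alpha>s)"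
| "covector_cons \<alpha> (Vectors []) = Covectors [\<alpha>]"
| "covector_cons \<alpha> (Vectors (x # xs)) = left_act A E (pairing \<alpha> x) (Vectors xs)"

fun word_act :: "('a, 'l) simple \<Rightarrow> ('a, 'l) simple \<Rightarrow> ('a, 'l) simple" where
  "word_act (Scalar a) w = left_act A E a w"
| "word_act (Vectors xs) w = foldr vector_cons xs w"
| "word_act (Covectors \<alpha>s) w = foldr covector_cons \<alpha>s w"

abbreviation "lgens \<equiv> line_gens A E"
abbreviation "lrels \<equiv> line_relations A E"
abbreviation "all_rels \<equiv> (\<Union>n. lrels n)"

text \<open>Splits the relations by the sign of the degree, which is the form that
  \<open>tensor_words\<close> expects.\<close>

lemma all_rels_eq: "all_rels =
    {gen (Scalar (a \<oplus> b)) - gen (Scalar a) - gen (Scalar b) | a b. a \<in> carrier A \<and> b \<in> carrier A} \<union>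
    (\<Union>n\<in>{1..}. power_relations Vectors A E n) \<union> (\<Union>n\<in>{1..}. power_relations Covectors A D n)"
proof (intro subset_antisym subsetI)
  fix r assume "r \<in> all_rels"
  then obtain n where n: "r \<in> lrels n" by blast
  consider "n = 0" | "n > 0" "nat n \<in> {1..}" | "n < 0" "nat (- n) \<in> {1..}" by fastforce
  then show "r \<in> {gen (Scalar (a \<oplus> b)) - gen (Scalar a) - gen (Scalar b) | a b. a \<in> carrier A \<and> b \<in> carrier A} \<union>
    (\<Union>n\<in>{1..}. power_relations Vectors A E n) \<union> (\<Union>n\<in>{1..}. power_relations Covectors A D n)"
    using n by cases (unfold line_relations_def, simp, simp, blast, simp, blast)
next
  fix r
  assume "r \<in> {gen (Scalar (a \<oplus> b)) - gen (Scalar a) - gen (Scalar b) | a b. a \<in> carrier A \<and> b \<in> carrier A} \<union>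
    (\<Union>n\<in>{1..}. power_relations Vectors A E n) \<union> (\<Union>n\<in>{1..}. power_relations Covectors A D n)"
  then consider "r \<in> lrels 0" | n where "n \<ge> 1" "r \<in> power_relations Vectors A E n"
    | n where "n \<ge> 1" "r \<in> power_relations Covectors A D n"
    unfolding line_relations_def by (auto simp del: One_nat_def)
  then show "r \<in> all_rels"
  proof cases
    case (2 n)
    then have "r \<in> lrels (int n)" by (simp add: line_relations_def)
    then show ?thesis by blast
  next
    case (3 n)
    then have "r \<in> lrels (- int n)" by (simp add: line_relations_def)
    then show ?thesis by blast
  qed blast
qed

end

sublocale weak_line \<subseteq> words: tensor_words A E D "\<lambda>x \<alpha>. \<alpha> x" pairing Scalar Vectors Covectors
  "left_act A E" vector_cons covector_cons word_act all_rels
  by unfold_locales (simp_all add: all_rels_eq)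

context weak_line
begin

abbreviation "words \<equiv> words.G"

lemma lgens_eq: "lgens n = {w \<in> words. word_degree w = n}"
proof -
  consider "n = 0" | "n > 0" | "n < 0" by linarith
  then show ?thesis
    by cases (auto simp: line_gens_def words.G_def power_gens_def)
qed

lemma lgens_subset: "lgens n \<subseteq> words"
  by (auto simp: lgens_eq)

lemma lrels_keys: "r \<in> lrels n \<Longrightarrow> r upon lgens n"
proof -
  assume r: "r \<in> lrels n"
  consider "n = 0" | "n > 0" | "n < 0" by linarith
  then show ?thesis
  proof cases
    case 1
    with r obtain a b where "a \<in> carrier A" "b \<in> carrier A"
      "r = gen (Scalar (a \<oplus> b)) - gen (Scalar a) - gen (Scalar b)"
      by (auto simp: line_relations_def)
    then show ?thesis using 1 by (simp add: keys_diff_subset line_gens_def)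
  next
    case 2
    with r show ?thesis
      using power_relations_keys[OF E.abelian_group_axioms left_closed right_closed, where r = r and W = Vectors]
      by (simp add: line_relations_def line_gens_def)
  next
    case 3
    with r show ?thesis
      using power_relations_keys[OF dual_abelian_group dual_left_closed dual_right_closed, where r = r and W = Covectors]
      by (simp add: line_relations_def line_gens_def)
  qed
qed

lemma degree_left_act: "word_degree (left_act A E a w) = word_degree w"
  by (cases "(A, E, a, w)" rule: left_act.cases) auto

lemma degree_vector_cons: "word_degree (vector_cons x w) = word_degree w + 1"
  by (cases "(x, w)" rule: vector_cons.cases) (auto simp: degree_left_act)

lemma degree_covector_cons: "word_degree (covector_cons x w) = word_degree w - 1"
  by (cases "(x, w)" rule: covector_cons.cases) (auto simp: degree_left_act)

lemma degree_word_act: "word_degree (word_act v w) = word_degree v + word_degree w"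
proof (cases v)
  case (Vectors xs)
  have "word_degree (foldr vector_cons xs w) = int (length xs) + word_degree w"
    by (induction xs) (auto simp: degree_vector_cons)
  with Vectors show ?thesis by simp
next
  case (Covectors xs)
  have "word_degree (foldr covector_cons xs w) = word_degree w - int (length xs)"
    by (induction xs) (auto simp: degree_covector_cons)
  with Covectors show ?thesis by simp
qed (simp add: degree_left_act)

lemma word_act_lgens: "v \<in> lgens n \<Longrightarrow> w \<in> lgens m \<Longrightarrow> word_act v w \<in> lgens (n + m)"
  by (auto simp: lgens_eq degree_word_act words.opr_closed)

text \<open>Connects the product prescribed by comparing lengths with the action of letters, so that
  everything proved about the action holds for the tensor algebra.\<close>

lemma simple_mult_eq:
  assumes "v \<in> words" "w \<in> words"
  shows "simple_mult A E v w = word_act v w"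
proof -
  have ev: "words.is_pairing_power (ev_power A E)"
  proof -
    have "last \<alpha>s \<in> carrier D" if "\<alpha>s \<noteq> []" "set \<alpha>s \<subseteq> carrier D" for \<alpha>s :: "('l \<Rightarrow> 'a) list"
      using that last_in_set by blast
    then show ?thesis by (auto simp: words.is_pairing_power_def ev_pure right_closed)
  qed
  have coev: "words.swapped.is_pairing_power (coev_inv_power A E)"
    by (simp add: words.swapped.is_pairing_power_def pairing_def)
  \<comment> \<open>Only strings of opposite kind contract; whichever is longer decides between the
    two folding lemmas.\<close>
  have mixed: "simple_mult A E (Vectors xs) (Covectors \<alpha>s) = word_act (Vectors xs) (Covectors \<alpha>s)"
    "simple_mult A E (Covectors \<alpha>s) (Vectors xs) = word_act (Covectors \<alpha>s) (Vectors xs)"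
    if "set xs \<subseteq> carrier E" "xs \<noteq> []" "set \<alpha>s \<subseteq> carrier D" "\<alpha>s \<noteq> []" for xs \<alpha>s
    using that words.foldr_mcons_Q[OF ev that(1,3,2)] words.foldr_mcons_Q_long[OF ev that(1,3,4)]
      words.swapped.foldr_mcons_Q[OF coev that(3,1,4)] words.swapped.foldr_mcons_Q_long[OF coev that(3,1,2)]
    by (auto simp: Let_def right_act_def not_le)
  from assms(1) show ?thesis
  proof (cases rule: words.G_cases)
    case v: (vector x xs)
    from assms(2) show ?thesis
    proof (cases rule: words.G_cases)
      case (covector \<alpha> \<alpha>s)
      then show ?thesis unfolding v(1) covector(1) by (intro mixed) (use v in auto)
    qed (use v in \<open>simp_all del: foldr.simps butlast.simps last.simps
        add: right_act_def words.foldr_mcons_S words.foldr_mcons_P\<close>)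
  next
    case v: (covector x xs)
    from assms(2) show ?thesis
    proof (cases rule: words.G_cases)
      case (vector y ys)
      then show ?thesis unfolding v(1) vector(1) by (intro mixed) (use v in auto)
    qed (use v in \<open>simp_all del: foldr.simps butlast.simps last.simps
        add: right_act_def words.swapped.foldr_mcons_S words.swapped.foldr_mcons_P\<close>)
  qed simp
qed

section \<open>The product of integer combinations of words\<close>

definition word_mult :: "(('a, 'l) simple \<Rightarrow>\<^sub>0 int) \<Rightarrow> (('a, 'l) simple \<Rightarrow>\<^sub>0 int) \<Rightarrow> (('a, 'l) simple \<Rightarrow>\<^sub>0 int)"
  where "word_mult z w = frag_extend (\<lambda>v. frag_extend (\<lambda>u. gen (word_act v u)) w) z"

lemma word_mult_gen: "word_mult (gen v) (gen w) = gen (word_act v w)"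
  by (simp add: word_mult_def)

lemma word_mult_zero [simp]: "word_mult 0 w = 0" "word_mult z 0 = 0"
  by (simp_all add: word_mult_def frag_extend_fun_zero)

lemma word_mult_diff_left: "word_mult (z - z') w = word_mult z w - word_mult z' w"
  by (simp add: word_mult_def frag_extend_diff)

lemma word_mult_diff_right: "word_mult z (w - w') = word_mult z w - word_mult z w'"
  by (simp add: word_mult_def frag_extend_diff frag_extend_fun_diff)

lemma word_mult_add_left: "word_mult (z + z') w = word_mult z w + word_mult z' w"
  by (simp add: word_mult_def frag_extend_add)

lemma word_mult_add_right: "word_mult z (w + w') = word_mult z w + word_mult z w'"
  using word_mult_diff_right[of z "w + w'" w'] by simp

lemma word_mult_sum_left: "word_mult (sum f I) w = (\<Sum>i\<in>I. word_mult (f i) w)"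
  by (induction I rule: infinite_finite_induct) (simp_all add: word_mult_add_left)

lemma word_mult_keys_degree:
  assumes "z upon lgens n" "w upon lgens m"
  shows "(word_mult z w) upon lgens (n + m)"
  unfolding word_mult_def
  by (intro frag_extend_subset[OF assms(1)] frag_extend_subset[OF assms(2)]) (simp add: word_act_lgens)

lemma word_mult_keys:
  assumes "z upon words" "w upon words"
  shows "(word_mult z w) upon words"
  unfolding word_mult_def
  by (intro frag_extend_subset[OF assms(1)] frag_extend_subset[OF assms(2)]) (simp add: words.opr_closed)

lemma word_mult_assoc:
  assumes "x upon words" "y upon words" "z upon words"
  shows "words.cl (word_mult (word_mult x y) z) = words.cl (word_mult x (word_mult y z))"
  using assms(1)
proof (induction x rule: frag_induction)
  case (one u)
  show ?case using assms(2)
  proof (induction y rule: frag_induction)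
    case (one v)
    show ?case using assms(3)
    proof (induction z rule: frag_induction)
      case (one w)
      show ?case using words.opr_assoc[OF \<open>u \<in> words\<close> \<open>v \<in> words\<close> \<open>w \<in> words\<close>] by (simp add: word_mult_gen)
    next
      case (diff a b)
      then show ?case by (simp only: word_mult_diff_right) (rule rel_class_diff_cong)
    qed simp
  next
    case (diff a b)
    then show ?case by (simp only: word_mult_diff_right word_mult_diff_left) (rule rel_class_diff_cong)
  qed simp
next
  case (diff a b)
  then show ?case by (simp only: word_mult_diff_left) (rule rel_class_diff_cong)
qed simp

lemma word_mult_right_rels:
  assumes "z upon words" "r \<in> all_rels"
  shows "word_mult z r \<in> int_span all_rels"
  using assms(1)
proof (induction z rule: frag_induction)
  case (one v)
  then show ?case using words.opr_right_relations[OF one assms(2)] by (simp add: word_mult_def)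
qed (auto simp: word_mult_diff_left intro: int_span.intros)

lemma word_mult_left_rels:
  assumes "z upon words" "r \<in> all_rels"
  shows "word_mult r z \<in> int_span all_rels"
  using assms(1)
proof (induction z rule: frag_induction)
  case (one v)
  then show ?case using words.opr_left_relations[OF one assms(2)] by (simp add: word_mult_def)
qed (auto simp: word_mult_diff_right intro: int_span.intros)

section \<open>Homogeneous parts\<close>

definition part :: "int \<Rightarrow> (('a, 'l) simple \<Rightarrow>\<^sub>0 int) \<Rightarrow> (('a, 'l) simple \<Rightarrow>\<^sub>0 int)" where
  "part n = frag_extend (\<lambda>w. if w \<in> lgens n then gen w else 0)"

lemma part_zero [simp]: "part n 0 = 0"
  by (simp add: part_def)

lemma part_diff: "part n (z - w) = part n z - part n w"
  by (simp add: part_def frag_extend_diff)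

lemma part_add: "part n (z + w) = part n z + part n w"
  by (simp add: part_def frag_extend_add)

lemma part_sum: "part n (sum f I) = (\<Sum>i\<in>I. part n (f i))"
  by (induction I rule: infinite_finite_induct) (simp_all add: part_add)

lemma part_keys: "(part n z) upon lgens n"
  unfolding part_def by (rule frag_extend_subset[OF subset_UNIV]) auto

lemma part_homogeneous:
  assumes "z upon lgens m"
  shows "part n z = (if n = m then z else 0)"
  using assms
proof (induction z rule: frag_induction)
  case (one w)
  then show ?case by (simp add: part_def lgens_eq)
qed (auto simp: part_diff)

text \<open>Every relation is homogeneous, so projecting to degree \<open>n\<close> either keeps it
  or kills it.\<close>

lemma part_int_span: "z \<in> int_span all_rels \<Longrightarrow> part n z \<in> int_span (lrels n)"
  unfolding part_def
proof (rule frag_extend_int_span)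
  fix r assume "r \<in> all_rels"
  then obtain m where "r \<in> lrels m" by blast
  then show "frag_extend (\<lambda>w. if w \<in> lgens n then gen w else 0) r \<in> int_span (lrels n)"
    using part_homogeneous[OF lrels_keys, of r m n]
    by (auto simp: part_def[symmetric] int_span_gen int_span_zero)
qed

text \<open>The transfer back to one degree: associativity and descent are proved modulo all
  relations, whereas \<open>line_power\<close> divides only by those of its own degree.\<close>

lemma int_span_homogeneous:
  "z \<in> int_span all_rels \<Longrightarrow> z upon lgens n \<Longrightarrow> z \<in> int_span (lrels n)"
  using part_int_span[of z n] by (simp add: part_homogeneous)

lemma part_decompose:
  assumes "finite I" "z upon {w \<in> words. word_degree w \<in> I}"
  shows "z = (\<Sum>n\<in>I. part n z)"
  using assms(2)
proof (induction z rule: frag_induction)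
  case (one w)
  have "part n (gen w) = (if n = word_degree w then gen w else 0)" for n
    using one by (auto simp: part_def lgens_eq)
  then show ?case using one assms(1) by simp
next
  case (diff a b)
  then show ?case by (simp add: part_diff sum_subtractf)
qed simp

lemma part_mult:
  assumes "z upon lgens n" "w upon words"
  shows "part k (word_mult z w) = word_mult z (part (k - n) w)"
  using assms(2)
proof (induction w rule: frag_induction)
  case (one v)
  then have v: "(gen v) upon lgens (word_degree v)" by (auto simp: lgens_eq)
  show ?case
    using part_homogeneous[OF word_mult_keys_degree[OF assms(1) v], of k] part_homogeneous[OF v, of "k - n"]
    by auto
qed (simp_all add: word_mult_diff_right part_diff)

end

section \<open>The tensor algebra as a quotient of the combinations of words\<close>

context weak_line
begin

abbreviation "T \<equiv> tensor_algebra A E"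
abbreviation "lpow \<equiv> line_power A E"

text \<open>The quotient map from combinations of mixed degree. With it an element of the direct sum
  has a single representative, and families of cosets need not be handled.\<close>

definition embed :: "(('a, 'l) simple \<Rightarrow>\<^sub>0 int) \<Rightarrow> int \<Rightarrow> (('a, 'l) simple \<Rightarrow>\<^sub>0 int) set" where
  "embed z = (\<lambda>n. rel_class (lrels n) (part n z))"

lemma pow_zero: "\<zero>\<^bsub>lpow n\<^esub> = rel_class (lrels n) 0"
  by (simp add: line_power_def presented_zero)

lemma pow_add: "rel_class (lrels n) z \<oplus>\<^bsub>lpow n\<^esub> rel_class (lrels n) w = rel_class (lrels n) (z + w)"
  by (simp add: line_power_def presented_add)

lemma pow_closed: "z upon lgens n \<Longrightarrow> rel_class (lrels n) z \<in> carrier (lpow n)"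
  by (simp add: line_power_def presented_closed)

lemma pow_abelian_group: "abelian_group (lpow n)"
  by (simp add: line_power_def presented_abelian_group)

lemma embed_homogeneous:
  assumes "z upon lgens n"
  shows "embed z = (\<lambda>k. if k = n then rel_class (lrels n) z else \<zero>\<^bsub>lpow k\<^esub>)"
proof
  fix k show "embed z k = (if k = n then rel_class (lrels n) z else \<zero>\<^bsub>lpow k\<^esub>)"
    using assms by (simp add: embed_def part_homogeneous pow_zero)
qed

lemma embed_cong:
  assumes "words.cl z = words.cl w"
  shows "embed z = embed w"
proof
  fix n show "embed z n = embed w n"
    using part_int_span[of "z - w" n] assms by (simp add: embed_def rel_class_eq_iff part_diff)
qed

lemma T_zero: "\<zero>\<^bsub>T\<^esub> = embed 0"
  by (auto simp: tensor_algebra_def embed_def pow_zero)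

lemma T_add: "embed z \<oplus>\<^bsub>T\<^esub> embed w = embed (z + w)"
  by (auto simp: tensor_algebra_def embed_def pow_add part_add)

lemma embed_support:
  assumes "z upon words"
  shows "{n. embed z n \<noteq> \<zero>\<^bsub>lpow n\<^esub>} \<subseteq> word_degree ` Poly_Mapping.keys z"
proof
  fix n assume n: "n \<in> {n. embed z n \<noteq> \<zero>\<^bsub>lpow n\<^esub>}"
  show "n \<in> word_degree ` Poly_Mapping.keys z"
  proof (rule ccontr)
    assume "n \<notin> word_degree ` Poly_Mapping.keys z"
    then have "part n z = 0"
      unfolding part_def by (intro frag_extend_eq_0) (auto simp: lgens_eq)
    with n show False by (simp add: embed_def pow_zero)
  qed
qed

lemma embed_closed:
  assumes "z upon words"
  shows "embed z \<in> carrier T"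
  using finite_subset[OF embed_support[OF assms]]
  by (auto simp: tensor_algebra_def) (simp add: embed_def pow_closed part_keys)

text \<open>Representatives of the finitely many nonzero components are added up; each component is
  recovered by \<open>part\<close>.\<close>

lemma T_cases:
  assumes "f \<in> carrier T"
  obtains z where "f = embed z" "z upon words"
proof -
  define I where "I = {n. f n \<noteq> \<zero>\<^bsub>lpow n\<^esub>}"
  have f: "f n \<in> carrier (lpow n)" and I: "finite I" for n
    using assms by (auto simp: tensor_algebra_def I_def)
  have "\<forall>n. \<exists>z. f n = rel_class (lrels n) z \<and> z upon lgens n"
    using f by (simp add: line_power_def presented_carrier image_iff conj_commute)
  then obtain z where z: "\<And>n. f n = rel_class (lrels n) (z n)" "\<And>n. (z n) upon lgens n"
    by metis
  have "f = embed (sum z I)"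
  proof
    fix k
    have "part k (sum z I) = (\<Sum>n\<in>I. if k = n then z n else 0)"
      by (simp add: part_sum part_homogeneous[OF z(2)])
    also have "\<dots> = (if k \<in> I then z k else 0)" using I by simp
    finally show "f k = embed (sum z I) k"
      by (auto simp: embed_def z(1)[symmetric] I_def pow_zero)
  qed
  moreover have "(sum z I) upon words"
    using z(2) lgens_subset by (intro keys_sum_subset) blast
  ultimately show thesis by (rule that)
qed

lemma T_abelian_group: "abelian_group T"
proof (rule abelian_groupI)
  fix x y assume "x \<in> carrier T" "y \<in> carrier T"
  then show "x \<oplus>\<^bsub>T\<^esub> y \<in> carrier T"
    by (elim T_cases) (simp add: T_add embed_closed keys_add_subset)
next
  fix x assume "x \<in> carrier T"
  then obtain z where "x = embed z" "z upon words" by (rule T_cases)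
  then show "\<exists>y\<in>carrier T. y \<oplus>\<^bsub>T\<^esub> x = \<zero>\<^bsub>T\<^esub>"
    by (intro bexI[of _ "embed (- z)"]) (simp_all add: T_add T_zero embed_closed)
qed (auto elim!: T_cases simp: T_add T_zero ac_simps intro: embed_closed)

text \<open>The product is defined by two nested additive extensions. The inner one descends by
  \<open>word_mult_right_rels\<close>, the outer one by \<open>word_mult_left_rels\<close>.\<close>

lemma line_power_mult_class:
  assumes z: "z upon lgens n" and w: "w upon lgens m"
  shows "line_power_mult A E n m (rel_class (lrels n) z) (rel_class (lrels m) w)
    = rel_class (lrels (n + m)) (word_mult z w)"
proof -
  have zw: "z upon words" "w upon words"
    using z w lgens_subset by blast+
  have inner: "extend_additively (lpow (n + m))
      (\<lambda>u. simple_tensor A E (n + m) (simple_mult A E v u)) (rel_class (lrels m) w)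
    = rel_class (lrels (n + m)) (frag_extend (\<lambda>u. gen (word_act v u)) w)" if v: "v \<in> lgens n" for v
    unfolding line_power_def
  proof (rule extend_additively_presented[OF w])
    fix u assume "u \<in> lgens m"
    then show "simple_tensor A E (n + m) (simple_mult A E v u) = rel_class (lrels (n + m)) (gen (word_act v u))"
      using v lgens_subset by (simp add: simple_tensor_def simple_mult_eq subset_iff)
  next
    fix r assume r: "r \<in> lrels m"
    have v': "(gen v) upon lgens n" using v by simp
    have "word_mult (gen v) r \<in> int_span (lrels (n + m))"
    proof (rule int_span_homogeneous)
      show "word_mult (gen v) r \<in> int_span all_rels"
        by (rule word_mult_right_rels) (use v lgens_subset r in auto)
      show "(word_mult (gen v) r) upon lgens (n + m)"
        by (rule word_mult_keys_degree[OF v' lrels_keys[OF r]])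
    qed
    then show "frag_extend (\<lambda>u. gen (word_act v u)) r \<in> int_span (lrels (n + m))"
      by (simp add: word_mult_def)
  qed (use v in \<open>simp_all add: word_act_lgens lrels_keys\<close>)
  have "line_power_mult A E n m (rel_class (lrels n) z) (rel_class (lrels m) w)
    = rel_class (lrels (n + m)) (frag_extend (\<lambda>v. frag_extend (\<lambda>u. gen (word_act v u)) w) z)"
    unfolding line_power_mult_def line_power_def
  proof (rule extend_additively_presented[OF z])
    fix v assume v: "v \<in> lgens n"
    show "extend_additively (presented_group (lgens (n + m)) (lrels (n + m)))
      (\<lambda>u. simple_tensor A E (n + m) (simple_mult A E v u)) (rel_class (lrels m) w)
      = rel_class (lrels (n + m)) (frag_extend (\<lambda>u. gen (word_act v u)) w)"
      using inner[OF v] by (simp add: line_power_def)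
    show "(frag_extend (\<lambda>u. gen (word_act v u)) w) upon lgens (n + m)"
      by (rule frag_extend_subset[OF w]) (simp add: word_act_lgens v)
  next
    fix r assume r: "r \<in> lrels n"
    have "word_mult r w \<in> int_span (lrels (n + m))"
    proof (rule int_span_homogeneous)
      show "word_mult r w \<in> int_span all_rels"
        by (rule word_mult_left_rels[OF zw(2)]) (use r in blast)
      show "(word_mult r w) upon lgens (n + m)"
        by (rule word_mult_keys_degree[OF lrels_keys[OF r] w])
    qed
    then show "frag_extend (\<lambda>v. frag_extend (\<lambda>u. gen (word_act v u)) w) r \<in> int_span (lrels (n + m))"
      by (simp add: word_mult_def)
  qed (simp add: lrels_keys)
  then show ?thesis by (simp add: word_mult_def)
qed

lemma T_mult:
  assumes z: "z upon words" and w: "w upon words"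
  shows "embed z \<otimes>\<^bsub>T\<^esub> embed w = embed (word_mult z w)"
proof
  fix k
  interpret pow: abelian_group "lpow k" by (rule pow_abelian_group)
  \<comment> \<open>The product sums over \<open>J\<close>, the degrees with nonzero class. A
    representative may also have parts that are zero only modulo relations, so its own degrees
    \<open>I\<close> can be more; the additional terms vanish.\<close>
  define I where "I = word_degree ` Poly_Mapping.keys z"
  define J where "J = {n. embed z n \<noteq> \<zero>\<^bsub>lpow n\<^esub>}"
  have I: "finite I" "J \<subseteq> I" using embed_support[OF z] by (simp_all add: I_def J_def)
  have step: "line_power_mult A E n (k - n) (embed z n) (embed w (k - n))
      = rel_class (lrels k) (word_mult (part n z) (part (k - n) w))" for n
    using line_power_mult_class[OF part_keys[of n z] part_keys[of "k - n" w]] by (simp add: embed_def)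
  have keys: "(word_mult (part n z) (part (k - n) w)) upon lgens k" for n
    using word_mult_keys_degree[OF part_keys[of n z] part_keys[of "k - n" w]] by simp
  have out: "line_power_mult A E n (k - n) (embed z n) (embed w (k - n)) = \<zero>\<^bsub>lpow k\<^esub>" if "n \<notin> J" for n
  proof -
    have "embed z n = rel_class (lrels n) 0" using that by (simp add: J_def pow_zero)
    then show ?thesis
      using line_power_mult_class[of 0 n "part (k - n) w" "k - n"] part_keys[of "k - n" w]
      by (simp add: embed_def pow_zero)
  qed
  have "(embed z \<otimes>\<^bsub>T\<^esub> embed w) k
      = (\<Oplus>\<^bsub>lpow k\<^esub>n\<in>J. line_power_mult A E n (k - n) (embed z n) (embed w (k - n)))"
    by (simp add: tensor_algebra_def J_def)
  also have "\<dots> = (\<Oplus>\<^bsub>lpow k\<^esub>n\<in>I. line_power_mult A E n (k - n) (embed z n) (embed w (k - n)))"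
    by (rule pow.add.finprod_mono_neutral_cong_left)
      (use I out in \<open>simp_all add: step pow_closed[OF keys]\<close>)
  also have "\<dots> = rel_class (lrels k) (\<Sum>n\<in>I. word_mult (part n z) (part (k - n) w))"
    unfolding line_power_def
    by (rule presented_finsum_eq[OF I(1)]) (simp_all add: keys step)
  also have "(\<Sum>n\<in>I. word_mult (part n z) (part (k - n) w)) = part k (\<Sum>n\<in>I. word_mult (part n z) w)"
    by (simp add: part_sum part_mult[OF part_keys w])
  also have "(\<Sum>n\<in>I. word_mult (part n z) w) = word_mult (\<Sum>n\<in>I. part n z) w"
    by (simp add: word_mult_sum_left)
  also have "(\<Sum>n\<in>I. part n z) = z"
    by (rule part_decompose[OF I(1), symmetric]) (use z in \<open>auto simp: I_def\<close>)
  finally show "(embed z \<otimes>\<^bsub>T\<^esub> embed w) k = embed (word_mult z w) k" by (simp add: embed_def)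
qed

lemma inject_eq: "a \<in> carrier A \<Longrightarrow> tensor_algebra_inject A E a = embed (gen (Scalar a))"
  by (subst embed_homogeneous[of _ 0])
    (simp_all add: tensor_algebra_inject_def simple_tensor_def line_gens_def fun_eq_iff)

lemma T_one: "\<one>\<^bsub>T\<^esub> = embed (gen (Scalar \<one>))"
  using inject_eq[of "\<one>"] by (simp add: tensor_algebra_def)

lemma word_act_one_left: "w \<in> words \<Longrightarrow> word_act (Scalar \<one>) w = w"
  by (erule words.G_cases) (simp_all add: left_one DE.M.left_one)

lemma word_act_one_right: "w \<in> words \<Longrightarrow> word_act w (Scalar \<one>) = w"
proof (erule words.G_cases)
  fix x xs assume w: "w = Vectors (x # xs)" "x \<in> carrier E" "set xs \<subseteq> carrier E"
  then have "last (x # xs) \<in> carrier E" using last_in_set[of "x # xs"] by auto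
  then show ?thesis
    using w words.foldr_mcons_S[of "x # xs" "\<one>"] append_butlast_last_id[of "x # xs"]
    by (simp del: foldr.simps last.simps butlast.simps add: right_one)
next
  fix x xs assume w: "w = Covectors (x # xs)" "x \<in> carrier D" "set xs \<subseteq> carrier D"
  then have "last (x # xs) \<in> carrier D" using last_in_set[of "x # xs"] by auto
  then show ?thesis
    using w words.swapped.foldr_mcons_S[of "x # xs" "\<one>"] append_butlast_last_id[of "x # xs"]
    by (simp del: foldr.simps last.simps butlast.simps add: DE.M.right_one)
qed simp

lemma one_word_keys: "(gen (Scalar \<one>)) upon words"
  by (simp add: words.S_in_G)

lemma word_mult_one_left: "z upon words \<Longrightarrow> word_mult (gen (Scalar \<one>)) z = z"
  by (induction z rule: frag_induction)
    (simp_all del: word_act.simps add: word_mult_gen word_mult_diff_right word_act_one_left)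

lemma word_mult_one_right: "z upon words \<Longrightarrow> word_mult z (gen (Scalar \<one>)) = z"
  by (induction z rule: frag_induction)
    (simp_all add: word_mult_gen word_mult_diff_left word_act_one_right)

lemma T_ring: "ring T"
proof (rule ringI[OF T_abelian_group])
  show "Group.monoid T"
  proof (rule monoidI)
    fix x y z assume "x \<in> carrier T" "y \<in> carrier T" "z \<in> carrier T"
    then show "x \<otimes>\<^bsub>T\<^esub> y \<otimes>\<^bsub>T\<^esub> z = x \<otimes>\<^bsub>T\<^esub> (y \<otimes>\<^bsub>T\<^esub> z)"
      by (elim T_cases) (simp add: T_mult word_mult_keys embed_cong[OF word_mult_assoc])
  next
    fix x y assume "x \<in> carrier T" "y \<in> carrier T"
    then show "x \<otimes>\<^bsub>T\<^esub> y \<in> carrier T"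
      by (elim T_cases) (simp add: T_mult embed_closed word_mult_keys)
  next
    fix x assume "x \<in> carrier T"
    then obtain z where z: "x = embed z" "z upon words" by (rule T_cases)
    show "\<one>\<^bsub>T\<^esub> \<otimes>\<^bsub>T\<^esub> x = x" "x \<otimes>\<^bsub>T\<^esub> \<one>\<^bsub>T\<^esub> = x"
      using T_mult[OF one_word_keys z(2)] T_mult[OF z(2) one_word_keys] z
      by (simp_all add: T_one word_mult_one_left word_mult_one_right)
  qed (simp add: T_one embed_closed words.S_in_G)
qed (auto elim!: T_cases simp: T_mult T_add word_mult_add_left word_mult_add_right keys_add_subset)

text \<open>Complex scalars act as left multiplication by the image of
  \<open>c \<odot> \<one>\<close>. The module axioms thus become ring axioms, together with
  centrality of these elements.\<close>

lemma T_smult: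
  assumes z: "z upon words"
  shows "c \<odot>\<^bsub>T\<^esub> embed z = embed (gen (Scalar (c \<odot> \<one>))) \<otimes>\<^bsub>T\<^esub> embed z"
proof -
  define a where "a = c \<odot> \<one>"
  have a: "a \<in> carrier A" by (simp add: a_def complex_ring_def)
  have ak: "(gen (Scalar a)) upon lgens 0" using a by (simp add: line_gens_def)
  have "line_power_smult A E n c (embed z n) = embed (word_mult (gen (Scalar a)) z) n" for n
  proof -
    have "line_power_smult A E n c (rel_class (lrels n) (part n z))
        = rel_class (lrels n) (frag_extend (\<lambda>w. gen (left_act A E a w)) (part n z))"
      unfolding line_power_smult_def line_power_def a_def[symmetric]
    proof (rule extend_additively_presented[OF part_keys])
      fix w assume "w \<in> lgens n"
      then show "(gen (left_act A E a w)) upon lgens n"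
        using word_act_lgens[of "Scalar a" 0 w n] ak by simp
    next
      fix r assume r: "r \<in> lrels n"
      have "word_mult (gen (Scalar a)) r \<in> int_span (lrels n)"
      proof (rule int_span_homogeneous)
        show "word_mult (gen (Scalar a)) r \<in> int_span all_rels"
          by (rule word_mult_right_rels) (use ak lgens_subset r in blast)+
        show "(word_mult (gen (Scalar a)) r) upon lgens n"
          using word_mult_keys_degree[OF ak lrels_keys[OF r]] by simp
      qed
      then show "frag_extend (\<lambda>w. gen (left_act A E a w)) r \<in> int_span (lrels n)"
        by (simp add: word_mult_def)
    qed (simp_all add: simple_tensor_def lrels_keys)
    then show ?thesis
      using part_mult[OF ak z, of n] by (simp add: embed_def word_mult_def)
  qed
  then have "c \<odot>\<^bsub>T\<^esub> embed z = embed (word_mult (gen (Scalar a)) z)"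
    by (auto simp: tensor_algebra_def)
  also have "\<dots> = embed (gen (Scalar a)) \<otimes>\<^bsub>T\<^esub> embed z"
    by (rule T_mult[symmetric]) (use a z in \<open>simp_all add: words.S_in_G\<close>)
  finally show ?thesis by (simp add: a_def)
qed

lemma smult_one_closed: "c \<odot> \<one> \<in> carrier A"
  by (simp add: complex_ring_def)

lemma word_act_central:
  assumes "w \<in> words"
  shows "words.cl (gen (word_act (Scalar (c \<odot> \<one>)) w)) = words.cl (gen (word_act w (Scalar (c \<odot> \<one>))))"
  using assms
proof (cases rule: words.G_cases)
  case (scalar b)
  then show ?thesis by (simp add: smult_mult_left smult_mult_right)
next
  case (vector x xs)
  then show ?thesis
    using words.P_scalar_through[of "c \<odot> \<one>" xs x]
    by (simp only: word_act.simps) (simp add: smult_one_closed complex_central)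
next
  case (covector x xs)
  then show ?thesis
    using words.swapped.P_scalar_through[of "c \<odot> \<one>" xs x]
    by (simp only: word_act.simps) (simp add: smult_one_closed DE.M.complex_central)
qed

lemma T_complex_algebra: "complex_algebra T"
proof -
  interpret T: ring T by (rule T_ring)
  define s where "s c = embed (gen (Scalar (c \<odot> \<one>)))" for c
  have keys: "(gen (Scalar (c \<odot> \<one>))) upon words" for c
    by (simp add: words.S_in_G smult_one_closed)
  have s: "s c \<in> carrier T" for c unfolding s_def by (rule embed_closed[OF keys])
  have smult: "c \<odot>\<^bsub>T\<^esub> x = s c \<otimes>\<^bsub>T\<^esub> x" if "x \<in> carrier T" for c x
    using that by (elim T_cases) (simp add: T_smult s_def)
  have s_add: "s (c + d) = s c \<oplus>\<^bsub>T\<^esub> s d" for c d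
  proof -
    have "(c + d) \<odot> \<one> = c \<odot> \<one> \<oplus> d \<odot> \<one>"
      using smult_l_distr[of c d "\<one>"] by (simp add: complex_ring_def)
    then show ?thesis
      unfolding s_def T_add by (simp add: embed_cong[OF words.S_add] smult_one_closed)
  qed
  have s_mult: "s (c * d) = s c \<otimes>\<^bsub>T\<^esub> s d" for c d
  proof -
    have "(c * d) \<odot> \<one> = c \<odot> (d \<odot> \<one>)"
      using smult_assoc1[of c d "\<one>"] by (simp add: complex_ring_def)
    also have "\<dots> = (c \<odot> \<one>) \<otimes> (d \<odot> \<one>)"
      by (simp add: smult_mult_left smult_one_closed)
    finally show ?thesis
      unfolding s_def using T_mult[OF keys[of c] keys[of d]] by (simp add: word_mult_gen)
  qed
  have s_one: "s 1 = \<one>\<^bsub>T\<^esub>"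
    using smult_one[of "\<one>"] by (simp add: s_def T_one complex_ring_def)
  have central: "s c \<otimes>\<^bsub>T\<^esub> x = x \<otimes>\<^bsub>T\<^esub> s c" if "x \<in> carrier T" for c x
  proof -
    obtain z where z: "x = embed z" "z upon words" using \<open>x \<in> carrier T\<close> by (rule T_cases)
    have "words.cl (word_mult (gen (Scalar (c \<odot> \<one>))) z) = words.cl (word_mult z (gen (Scalar (c \<odot> \<one>))))"
      using frag_extend_cong_class[OF z(2) word_act_central[where c = c]] by (simp add: word_mult_def)
    from embed_cong[OF this] show ?thesis
      unfolding z(1) s_def T_mult[OF keys z(2)] T_mult[OF z(2) keys] .
  qed
  have "module complex_ring T"
  proof (rule moduleI)
    have "module complex_ring A" by (rule complex_algebra.axioms(2)[OF complex_algebra_axioms])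
    then show "cring complex_ring" by (rule module.axioms(1))
  qed (simp_all add: T_abelian_group smult s s_add s_mult s_one complex_ring_def
      T.l_distr T.r_distr T.m_assoc)
  moreover have "complex_algebra_axioms T"
  proof
    fix x y c assume xy: "x \<in> carrier T" "y \<in> carrier T"
    then show "c \<odot>\<^bsub>T\<^esub> x \<otimes>\<^bsub>T\<^esub> y = c \<odot>\<^bsub>T\<^esub> (x \<otimes>\<^bsub>T\<^esub> y)"
      by (simp add: smult s T.m_assoc)
    have "x \<otimes>\<^bsub>T\<^esub> (s c \<otimes>\<^bsub>T\<^esub> y) = s c \<otimes>\<^bsub>T\<^esub> (x \<otimes>\<^bsub>T\<^esub> y)"
      using xy s central[OF xy(1), of c] by (metis T.m_assoc)
    then show "x \<otimes>\<^bsub>T\<^esub> (c \<odot>\<^bsub>T\<^esub> y) = c \<odot>\<^bsub>T\<^esub> (x \<otimes>\<^bsub>T\<^esub> y)"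
      using xy by (simp add: smult)
  qed
  ultimately show ?thesis by (intro complex_algebra.intro T_ring)
qed

section \<open>The grading\<close>

abbreviation "gr \<equiv> tensor_algebra_degree A E"

lemma gr_eq: "gr n = embed ` {z. z upon lgens n}"
proof (intro subset_antisym subsetI)
  fix f assume f: "f \<in> gr n"
  then obtain z where z: "f = embed z" "z upon words"
    unfolding tensor_algebra_degree_def by (auto elim: T_cases)
  have "embed z = embed (part n z)"
    unfolding embed_homogeneous[OF part_keys]
  proof
    fix k show "embed z k = (if k = n then rel_class (lrels n) (part n z) else \<zero>\<^bsub>lpow k\<^esub>)"
      using f z by (auto simp: tensor_algebra_degree_def embed_def)
  qed
  then show "f \<in> embed ` {z. z upon lgens n}" using z part_keys by blast
next
  fix f assume "f \<in> embed ` {z. z upon lgens n}"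
  then obtain z where z: "f = embed z" "z upon lgens n" by blast
  moreover have "z upon words" using z(2) lgens_subset by blast
  ultimately show "f \<in> gr n"
    using embed_closed[of z] by (simp add: tensor_algebra_degree_def) (simp add: embed_homogeneous)
qed

lemma gr_subset: "gr n \<subseteq> carrier T"
  by (auto simp: tensor_algebra_degree_def)

lemma gr_mult: "x \<in> gr m \<Longrightarrow> y \<in> gr n \<Longrightarrow> x \<otimes>\<^bsub>T\<^esub> y \<in> gr (m + n)"
proof -
  assume "x \<in> gr m" "y \<in> gr n"
  then obtain z w where zw: "x = embed z" "y = embed w"
    "z upon lgens m" "w upon lgens n"
    by (auto simp: gr_eq)
  then have "x \<otimes>\<^bsub>T\<^esub> y = embed (word_mult z w)"
    using lgens_subset by (simp add: T_mult subset_trans)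
  with zw show ?thesis unfolding gr_eq by (simp add: word_mult_keys_degree)
qed

lemma T_finsum_apply:
  assumes "finite I" "f \<in> I \<rightarrow> carrier T"
  shows "(\<Oplus>\<^bsub>T\<^esub>i\<in>I. f i) k = (\<Oplus>\<^bsub>lpow k\<^esub>i\<in>I. f i k)"
proof -
  interpret T: abelian_group T by (rule T_abelian_group)
  show ?thesis
    by (rule T.finsum_additive_hom[of "lpow k" I f "\<lambda>f. f k", OF pow_abelian_group assms])
      (auto simp: tensor_algebra_def)
qed

text \<open>A summand of degree \<open>n\<close> vanishes at every other index, so evaluating at
  \<open>k\<close> leaves one summand. In particular any decomposition is determined by
  \<open>c\<close>.\<close>

lemma T_decomposition_apply:
  assumes "homogeneous_decomposition T gr c f"
  shows "c k = f k k"
proof -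
  interpret pow: abelian_group "lpow k" by (rule pow_abelian_group)
  define I where "I = {n. f n \<noteq> \<zero>\<^bsub>T\<^esub>}"
  have f: "f n \<in> gr n" and I: "finite I" and c: "c = (\<Oplus>\<^bsub>T\<^esub>n\<in>I. f n)" for n
    using assms by (auto simp: homogeneous_decomposition_def I_def)
  have fk: "f n k \<in> carrier (lpow k)" for n
    using f[of n] by (auto simp: tensor_algebra_degree_def tensor_algebra_def)
  have "c k = (\<Oplus>\<^bsub>lpow k\<^esub>n\<in>I. f n k)"
    unfolding c by (rule T_finsum_apply[OF I]) (use f gr_subset in blast)
  also have "\<dots> = (\<Oplus>\<^bsub>lpow k\<^esub>n\<in>I. if k = n then f n k else \<zero>\<^bsub>lpow k\<^esub>)"
    by (rule pow.finsum_cong') (use f fk in \<open>auto simp: tensor_algebra_degree_def\<close>)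
  also have "\<dots> = f k k"
  proof (cases "k \<in> I")
    case True
    then show ?thesis using pow.finsum_singleton[OF True I, of "\<lambda>n. f n k"] fk by simp
  next
    case False
    then have "f k k = \<zero>\<^bsub>lpow k\<^esub>" by (simp add: I_def tensor_algebra_def)
    moreover have "(\<Oplus>\<^bsub>lpow k\<^esub>n\<in>I. if k = n then f n k else \<zero>\<^bsub>lpow k\<^esub>) = (\<Oplus>\<^bsub>lpow k\<^esub>n\<in>I. \<zero>\<^bsub>lpow k\<^esub>)"
      by (rule pow.finsum_cong') (use False in auto)
    ultimately show ?thesis by (simp add: pow.finsum_zero)
  qed
  finally show ?thesis .
qed

lemma T_decomposition_unique:
  assumes "c \<in> carrier T"
  shows "\<exists>!f. homogeneous_decomposition T gr c f"
proof
  define f where "f n = (\<lambda>k. if k = n then c n else \<zero>\<^bsub>lpow k\<^esub>)" for n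
  interpret T: abelian_group T by (rule T_abelian_group)
  have c: "c n \<in> carrier (lpow n)" "finite {n. c n \<noteq> \<zero>\<^bsub>lpow n\<^esub>}" for n
    using assms by (auto simp: tensor_algebra_def)
  have pow0: "\<zero>\<^bsub>lpow k\<^esub> \<in> carrier (lpow k)" for k
    by (rule abelian_monoid.zero_closed) (rule abelian_group.axioms(1)[OF pow_abelian_group])
  have "finite {k. f n k \<noteq> \<zero>\<^bsub>lpow k\<^esub>}" for n
    by (rule finite_subset[of _ "{n}"]) (auto simp: f_def)
  then have f: "f n \<in> gr n" for n
    by (auto simp: tensor_algebra_degree_def tensor_algebra_def f_def c pow0)
  have supp: "{n. f n \<noteq> \<zero>\<^bsub>T\<^esub>} = {n. c n \<noteq> \<zero>\<^bsub>lpow n\<^esub>}"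
    by (auto simp: tensor_algebra_def f_def fun_eq_iff)
  \<comment> \<open>The sum of the candidate components; it is compared with \<open>c\<close> one
    coordinate at a time.\<close>
  define c' where "c' = (\<Oplus>\<^bsub>T\<^esub>n\<in>{n. f n \<noteq> \<zero>\<^bsub>T\<^esub>}. f n)"
  have "homogeneous_decomposition T gr c' f"
    unfolding homogeneous_decomposition_def using f c(2) supp by (simp add: c'_def)
  moreover from T_decomposition_apply[OF this] have "c' = c" by (auto simp: f_def)
  ultimately show "homogeneous_decomposition T gr c f" by simp
  fix g assume g: "homogeneous_decomposition T gr c g"
  show "g = f"
  proof (intro ext)
    fix n k
    have "g n k = (if k = n then g n n else \<zero>\<^bsub>lpow k\<^esub>)"
      using g by (auto simp: homogeneous_decomposition_def tensor_algebra_degree_def)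
    then show "g n k = f n k" using T_decomposition_apply[OF g, of n] by (simp add: f_def)
  qed
qed

lemma T_graded: "graded_algebra T gr"
proof -
  interpret T: complex_algebra T by (rule T_complex_algebra)
  have smult: "c \<odot>\<^bsub>T\<^esub> x \<in> gr n" if "x \<in> gr n" for c x n
  proof -
    obtain z where z: "x = embed z" "z upon lgens n" using \<open>x \<in> gr n\<close> by (auto simp: gr_eq)
    have "embed (gen (Scalar (c \<odot> \<one>))) \<in> gr 0"
      unfolding gr_eq by (rule imageI) (simp add: line_gens_def smult_one_closed)
    from gr_mult[OF this that] show ?thesis
      using z lgens_subset by (simp add: T_smult subset_trans)
  qed
  have zero: "\<zero>\<^bsub>T\<^esub> \<in> gr n" for n unfolding gr_eq T_zero by (rule imageI) simp
  have add: "x \<oplus>\<^bsub>T\<^esub> y \<in> gr n" if "x \<in> gr n" "y \<in> gr n" for x y n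
    using that unfolding gr_eq by (elim imageE) (simp add: T_add keys_add_subset)
  have one: "\<one>\<^bsub>T\<^esub> \<in> gr 0" unfolding gr_eq T_one by (rule imageI) (simp add: line_gens_def)
  show ?thesis
    unfolding graded_algebra_def
    by (intro conjI allI ballI T_complex_algebra gr_subset zero add smult one gr_mult T_decomposition_unique)
qed

section \<open>The degree zero part is the base algebra\<close>

text \<open>The additivity relations merge any integer combination of scalars into one
  scalar.\<close>

lemma degree_zero_scalar:
  assumes "z upon lgens 0"
  shows "\<exists>a\<in>carrier A. words.cl z = words.cl (gen (Scalar a))"
  using assms
proof (induction z rule: frag_induction)
  case zero
  show ?case by (rule bexI[of _ "\<zero>"]) (simp_all add: words.S_zero)
next
  case (one w)
  then show ?case by (auto simp: line_gens_def)
next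
  case (diff x y)
  then obtain a b where ab: "a \<in> carrier A" "b \<in> carrier A"
    "words.cl x = words.cl (gen (Scalar a))" "words.cl y = words.cl (gen (Scalar b))" by blast
  have "(a \<ominus> b) \<oplus> b = a" using ab by (simp add: a_minus_def A.a_assoc A.l_neg)
  then have "words.cl (gen (Scalar a)) = words.cl (gen (Scalar (a \<ominus> b)) + gen (Scalar b))"
    using words.S_add[of "a \<ominus> b" b] ab by simp
  with ab(3) have "words.cl x = words.cl (gen (Scalar (a \<ominus> b)) + gen (Scalar b))" by simp
  from rel_class_diff_cong[OF this ab(4)] ab(1,2) show ?case
    by (intro bexI[of _ "a \<ominus> b"]) simp_all
qed

lemma scalar_inject:
  assumes "a \<in> carrier A" "b \<in> carrier A"
    and "embed (gen (Scalar a)) = embed (gen (Scalar b))"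
  shows "a = b"
proof -
  \<comment> \<open>Additive retraction to \<open>A\<close>. It vanishes on the relations of degree
    zero, so it separates different scalars.\<close>
  define f where "f = (\<lambda>w :: ('a, 'l) simple. case w of Scalar a \<Rightarrow> a | _ \<Rightarrow> \<zero>)"
  have f: "f \<in> lgens 0 \<rightarrow> carrier A" by (auto simp: f_def line_gens_def)
  have gen: "additive_ext A f (gen (Scalar c)) = c" if "c \<in> carrier A" for c
    using that by (simp add: A.additive_ext_gen f_def)
  have keys: "Scalar c \<in> lgens 0" if "c \<in> carrier A" for c
    using that by (simp add: line_gens_def)
  have zero: "additive_ext A f r = \<zero>" if "r \<in> lrels 0" for r
  proof -
    obtain x y where "x \<in> carrier A" "y \<in> carrier A"
      "r = gen (Scalar (x \<oplus> y)) - gen (Scalar x) - gen (Scalar y)"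
      using \<open>r \<in> lrels 0\<close> by (auto simp: line_relations_def)
    moreover from this have "(x \<oplus> y) \<oplus> (\<ominus> x \<oplus> \<ominus> y) = \<zero>"
      using A.r_neg[of "x \<oplus> y"] by (simp add: A.minus_add)
    ultimately show ?thesis
      by (simp add: A.additive_ext_diff[OF _ _ f] keys keys_diff_subset gen a_minus_def A.a_assoc)
  qed
  have span: "gen (Scalar a) - gen (Scalar b) \<in> int_span (lrels 0)"
    using fun_cong[OF assms(3), of 0] keys[OF assms(1)] keys[OF assms(2)]
    by (simp add: embed_def part_def rel_class_eq_iff)
  have "additive_ext A f (gen (Scalar a) - gen (Scalar b)) = \<zero>"
    by (rule A.additive_ext_int_span[OF f lrels_keys zero span])
  then show ?thesis
    using assms(1,2) by (simp add: A.additive_ext_diff[OF _ _ f] keys gen)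
qed

lemma inject_iso: "tensor_algebra_inject A E \<in> ring_iso A (T\<lparr>carrier := gr 0\<rparr>)"
proof (rule ring_iso_memI)
  have keys: "(gen (Scalar a)) upon words" if "a \<in> carrier A" for a
    using that by (simp add: words.S_in_G)
  fix a b assume ab: "a \<in> carrier A" "b \<in> carrier A"
  show "tensor_algebra_inject A E a \<in> carrier (T\<lparr>carrier := gr 0\<rparr>)"
    using ab by (auto simp: inject_eq gr_eq line_gens_def intro!: imageI)
  show "tensor_algebra_inject A E (a \<otimes> b)
      = tensor_algebra_inject A E a \<otimes>\<^bsub>T\<lparr>carrier := gr 0\<rparr>\<^esub> tensor_algebra_inject A E b"
    using ab T_mult[OF keys[of a] keys[of b]] by (simp add: inject_eq word_mult_gen)
  show "tensor_algebra_inject A E (a \<oplus> b)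
      = tensor_algebra_inject A E a \<oplus>\<^bsub>T\<lparr>carrier := gr 0\<rparr>\<^esub> tensor_algebra_inject A E b"
    using ab by (simp add: inject_eq T_add embed_cong[OF words.S_add])
next
  show "tensor_algebra_inject A E \<one> = \<one>\<^bsub>T\<lparr>carrier := gr 0\<rparr>\<^esub>"
    by (simp add: inject_eq T_one)
  show "bij_betw (tensor_algebra_inject A E) (carrier A) (carrier (T\<lparr>carrier := gr 0\<rparr>))"
    unfolding bij_betw_def
  proof
    show "inj_on (tensor_algebra_inject A E) (carrier A)"
      by (rule inj_onI) (simp add: inject_eq scalar_inject)
    show "tensor_algebra_inject A E ` carrier A = carrier (T\<lparr>carrier := gr 0\<rparr>)"
    proof (intro subset_antisym subsetI)
      fix f assume "f \<in> carrier (T\<lparr>carrier := gr 0\<rparr>)"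
      then obtain z where z: "f = embed z" "z upon lgens 0" by (auto simp: gr_eq)
      then obtain a where "a \<in> carrier A" "words.cl z = words.cl (gen (Scalar a))"
        using degree_zero_scalar by blast
      then show "f \<in> tensor_algebra_inject A E ` carrier A"
        using z embed_cong[of z "gen (Scalar a)"] by (intro image_eqI[of _ _ a]) (simp_all add: inject_eq)
    qed (auto simp: inject_eq gr_eq line_gens_def intro!: imageI)
  qed
qed

lemma inject_smult:
  assumes "a \<in> carrier A"
  shows "tensor_algebra_inject A E (c \<odot> a) = c \<odot>\<^bsub>T\<^esub> tensor_algebra_inject A E a"
proof -
  have "c \<odot> a = (c \<odot> \<one>) \<otimes> a" using assms by (simp add: smult_mult_left)
  then show ?thesis
    using assms by (simp add: inject_eq smult_one_closed T_smult T_mult words.S_in_G word_mult_gen)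
qed

end

section \<open>Strongly graded algebras and the canonical map\<close>

text \<open>Removes the integer coefficients: multiplicities become repeated terms, and signs are
  absorbed into the first argument. It serves both for products in the graded algebra and for
  evaluations.\<close>

lemma (in abelian_group) finsum_pairs:
  assumes f: "\<And>x y. x \<in> U \<Longrightarrow> y \<in> V \<Longrightarrow> f x y \<in> carrier G"
    and neg: "\<And>x y. x \<in> U \<Longrightarrow> y \<in> V \<Longrightarrow> \<exists>x'\<in>U. \<ominus> f x y = f x' y"
    and z: "z upon U \<times> V"
  shows "\<exists>n u v. u \<in> {..<n::nat} \<rightarrow> U \<and> v \<in> {..<n} \<rightarrow> V \<and>
    additive_ext G (\<lambda>(x, y). f x y) z = (\<Oplus>i\<in>{..<n}. f (u i) (v i))"
proof -
  define g where "g = (\<lambda>(x, y). f x y)"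
  define P where "P a \<longleftrightarrow> (\<exists>n u v. u \<in> {..<n::nat} \<rightarrow> U \<and> v \<in> {..<n} \<rightarrow> V \<and>
    a = (\<Oplus>i\<in>{..<n}. f (u i) (v i)))" for a
  have g: "g \<in> U \<times> V \<rightarrow> carrier G" by (auto simp: g_def f)
  have P0: "P \<zero>" unfolding P_def by (rule exI[of _ 0]) simp
  have P1: "P (f x y)" if "x \<in> U" "y \<in> V" for x y
    unfolding P_def
    by (rule exI[of _ 1], rule exI[of _ "\<lambda>_. x"], rule exI[of _ "\<lambda>_. y"])
      (use that in \<open>simp add: f lessThan_Suc finsum_insert\<close>)
  have P_add: "P (a \<oplus> b)" if ab: "P a" "P b" for a b
  proof -
    obtain n u v where a: "u \<in> {..<n::nat} \<rightarrow> U" "v \<in> {..<n} \<rightarrow> V"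
      "a = (\<Oplus>i\<in>{..<n}. f (u i) (v i))" using ab(1) unfolding P_def by blast
    obtain m u' v' where b: "u' \<in> {..<m::nat} \<rightarrow> U" "v' \<in> {..<m} \<rightarrow> V"
      "b = (\<Oplus>i\<in>{..<m}. f (u' i) (v' i))" using ab(2) unfolding P_def by blast
    \<comment> \<open>The two families are concatenated, the second one shifted by
      \<open>n\<close>.\<close>
    define s where "s i = (if i < n then u i else u' (i - n))" for i
    define t where "t i = (if i < n then v i else v' (i - n))" for i
    have s: "s \<in> {..<n + m} \<rightarrow> U" "t \<in> {..<n + m} \<rightarrow> V"
      using a b by (auto simp: s_def t_def Pi_iff)
    have cl: "(\<lambda>i. f (s i) (t i)) \<in> {..<n + m} \<rightarrow> carrier G" using s by (auto intro: f)
    have "{..<n + m} = {..<n} \<union> (\<lambda>i. i + n) ` {..<m}"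
    proof (intro subset_antisym subsetI)
      fix i assume "i \<in> {..<n + m}"
      then show "i \<in> {..<n} \<union> (\<lambda>i. i + n) ` {..<m}"
        by (cases "i < n") (auto intro!: image_eqI[of _ _ "i - n"])
    qed auto
    then have "(\<Oplus>i\<in>{..<n + m}. f (s i) (t i))
      = (\<Oplus>i\<in>{..<n}. f (s i) (t i)) \<oplus> (\<Oplus>i\<in>(\<lambda>i. i + n) ` {..<m}. f (s i) (t i))"
      using cl by (simp only:) (rule finsum_Un_disjoint, auto)
    also have "(\<Oplus>i\<in>{..<n}. f (s i) (t i)) = a"
      unfolding a(3) by (rule finsum_cong') (use a in \<open>auto simp: s_def t_def f Pi_iff\<close>)
    also have "(\<Oplus>i\<in>(\<lambda>i. i + n) ` {..<m}. f (s i) (t i)) = (\<Oplus>i\<in>{..<m}. f (s (i + n)) (t (i + n)))"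
      by (rule finsum_reindex) (use cl in \<open>auto simp: Pi_iff\<close>)
    also have "\<dots> = b"
      unfolding b(3) by (rule finsum_cong') (use b in \<open>auto simp: s_def t_def f Pi_iff\<close>)
    finally show ?thesis unfolding P_def using s by metis
  qed
  have P_uminus: "P (\<ominus> a)" if "P a" for a
  proof -
    obtain n u v where a: "u \<in> {..<n::nat} \<rightarrow> U" "v \<in> {..<n} \<rightarrow> V"
      "a = (\<Oplus>i\<in>{..<n}. f (u i) (v i))" using \<open>P a\<close> unfolding P_def by blast
    have "\<forall>i\<in>{..<n}. \<exists>x'\<in>U. \<ominus> f (u i) (v i) = f x' (v i)"
      using a(1,2) by (auto intro!: neg)
    then obtain u' where u': "\<And>i. i \<in> {..<n} \<Longrightarrow> u' i \<in> U \<and> \<ominus> f (u i) (v i) = f (u' i) (v i)" by metis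
    have cl: "(\<lambda>i. f (u i) (v i)) \<in> {..<n} \<rightarrow> carrier G" using a by (auto intro: f)
    have "\<ominus> a = (\<Oplus>i\<in>{..<n}. \<ominus> f (u i) (v i))"
      unfolding a(3) by (rule finsum_additive_hom) (use cl in \<open>auto simp: minus_add abelian_group_axioms\<close>)
    also have "\<dots> = (\<Oplus>i\<in>{..<n}. f (u' i) (v i))"
      by (rule finsum_cong') (use u' a(2) in \<open>auto simp: f Pi_iff\<close>)
    finally show ?thesis unfolding P_def using u' a(2) by (intro exI[of _ n] exI[of _ u'] exI[of _ v]) auto
  qed
  have "P (additive_ext G g z) \<and> z upon U \<times> V"
    using z
  proof (induction z rule: frag_induction)
    case (one xy)
    then show ?case using P1 by (auto simp: additive_ext_gen g_def f)
  next
    case (diff a b)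
    then show ?case
      using P_add P_uminus additive_ext_diff[OF _ _ g, of a b]
      by (simp add: a_minus_def keys_diff_subset)
  qed (simp add: P0)
  then show ?thesis by (simp add: P_def g_def)
qed

section \<open>Homogeneous components in a graded algebra\<close>

locale graded = C: ring C for C :: "(complex, 'c) module" (structure) +
  fixes gr :: "int \<Rightarrow> 'c set"
  assumes graded: "graded_algebra C gr"

sublocale graded \<subseteq> alg: complex_algebra C
  using graded by (simp add: graded_algebra_def)

context graded
begin

lemma gr_carrier: "x \<in> gr n \<Longrightarrow> x \<in> carrier C"
  and gr_zero: "\<zero> \<in> gr n"
  and gr_add: "x \<in> gr n \<Longrightarrow> y \<in> gr n \<Longrightarrow> x \<oplus> y \<in> gr n"
  and gr_smult: "x \<in> gr n \<Longrightarrow> z \<odot> x \<in> gr n"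
  and gr_one: "\<one> \<in> gr 0"
  and gr_mult: "x \<in> gr m \<Longrightarrow> y \<in> gr n \<Longrightarrow> x \<otimes> y \<in> gr (m + n)"
  and decomposition_unique: "c \<in> carrier C \<Longrightarrow> \<exists>!f. homogeneous_decomposition C gr c f"
  using graded unfolding graded_algebra_def by blast+

abbreviation "hcomp \<equiv> homogeneous_component C gr"
abbreviation "decomp \<equiv> homogeneous_decomposition C gr"

lemma decomp_comp: "c \<in> carrier C \<Longrightarrow> decomp c (hcomp c)"
  unfolding homogeneous_component_def by (rule theI'[OF decomposition_unique])

lemma comp_eq: "c \<in> carrier C \<Longrightarrow> decomp c f \<Longrightarrow> hcomp c = f"
  using decomposition_unique decomp_comp by blast

lemma comp_gr: "c \<in> carrier C \<Longrightarrow> hcomp c n \<in> gr n"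
  using decomp_comp by (simp add: homogeneous_decomposition_def)

lemma comp_carrier: "c \<in> carrier C \<Longrightarrow> hcomp c n \<in> carrier C"
  using comp_gr gr_carrier by blast

text \<open>Admits any finite index set containing the support, since for sums and products the
  exact support is not known.\<close>

lemma decompI:
  assumes "finite I" "\<And>n. f n \<in> gr n" "\<And>n. n \<notin> I \<Longrightarrow> f n = \<zero>" "c = (\<Oplus>n\<in>I. f n)"
  shows "decomp c f"
proof -
  have "{n. f n \<noteq> \<zero>} \<subseteq> I" using assms(3) by blast
  moreover have "(\<Oplus>n\<in>{n. f n \<noteq> \<zero>}. f n) = (\<Oplus>n\<in>I. f n)"
    by (rule C.add.finprod_mono_neutral_cong_left)
      (use assms(1,3) calculation gr_carrier[OF assms(2)] in auto)
  ultimately show ?thesis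
    using assms finite_subset unfolding homogeneous_decomposition_def by auto
qed

abbreviation "supp c \<equiv> {n. hcomp c n \<noteq> \<zero>}"

lemma finite_supp: "c \<in> carrier C \<Longrightarrow> finite (supp c)"
  using decomp_comp by (simp add: homogeneous_decomposition_def)

lemma comp_sum:
  assumes "c \<in> carrier C" "finite I" "supp c \<subseteq> I"
  shows "c = (\<Oplus>n\<in>I. hcomp c n)"
proof -
  have "c = (\<Oplus>n\<in>supp c. hcomp c n)"
    using decomp_comp[OF assms(1)] by (simp add: homogeneous_decomposition_def)
  also have "\<dots> = (\<Oplus>n\<in>I. hcomp c n)"
    by (rule C.add.finprod_mono_neutral_cong_left) (use assms comp_carrier in auto)
  finally show ?thesis .
qed

lemma comp_add:
  assumes "x \<in> carrier C" "y \<in> carrier C"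
  shows "hcomp (x \<oplus> y) = (\<lambda>n. hcomp x n \<oplus> hcomp y n)"
proof (rule comp_eq)
  let ?I = "supp x \<union> supp y"
  have cl: "(\<lambda>n. hcomp x n) \<in> ?I \<rightarrow> carrier C" "(\<lambda>n. hcomp y n) \<in> ?I \<rightarrow> carrier C"
    using assms comp_carrier by auto
  have "(\<Oplus>n\<in>?I. hcomp x n \<oplus> hcomp y n) = (\<Oplus>n\<in>?I. hcomp x n) \<oplus> (\<Oplus>n\<in>?I. hcomp y n)"
    by (rule C.finsum_addf[OF cl])
  also have "\<dots> = x \<oplus> y"
    using comp_sum[OF assms(1), of ?I] comp_sum[OF assms(2), of ?I] finite_supp assms by simp
  finally show "decomp (x \<oplus> y) (\<lambda>n. hcomp x n \<oplus> hcomp y n)"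
    using assms finite_supp by (intro decompI[of ?I]) (auto intro: gr_add comp_gr)
qed (use assms in simp)

lemma comp_mult_left:
  assumes "a \<in> gr m" "x \<in> carrier C"
  shows "hcomp (a \<otimes> x) = (\<lambda>n. a \<otimes> hcomp x (n - m))"
proof (rule comp_eq)
  have a: "a \<in> carrier C" using assms(1) gr_carrier by blast
  let ?I = "(\<lambda>n. n + m) ` supp x"
  have cl: "hcomp x n \<in> carrier C" for n using comp_carrier assms(2) by blast
  have "a \<otimes> x = a \<otimes> (\<Oplus>n\<in>supp x. hcomp x n)"
    using comp_sum[OF assms(2) finite_supp[OF assms(2)]] by simp
  also have "\<dots> = (\<Oplus>n\<in>supp x. a \<otimes> hcomp x n)"
    by (rule C.finsum_rdistr) (use finite_supp a cl assms in auto)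
  also have "\<dots> = (\<Oplus>n\<in>supp x. a \<otimes> hcomp x ((n + m) - m))" by simp
  also have "\<dots> = (\<Oplus>n\<in>?I. a \<otimes> hcomp x (n - m))"
    by (rule C.finsum_reindex[symmetric]) (use a cl in \<open>auto simp: inj_on_def\<close>)
  finally have "a \<otimes> x = (\<Oplus>n\<in>?I. a \<otimes> hcomp x (n - m))" .
  moreover have "a \<otimes> hcomp x (n - m) = \<zero>" if "n \<notin> ?I" for n
  proof -
    have "n - m \<notin> supp x" using that image_eqI[of n "\<lambda>n. n + m" "n - m"] by auto
    then show ?thesis using a by simp
  qed
  moreover have "a \<otimes> hcomp x (n - m) \<in> gr n" for n
    using gr_mult[OF assms(1) comp_gr[OF assms(2)], of "n - m"] by simp
  ultimately show "decomp (a \<otimes> x) (\<lambda>n. a \<otimes> hcomp x (n - m))"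
    by (intro decompI[of ?I] finite_imageI finite_supp[OF assms(2)])
qed (use assms gr_carrier in auto)

lemma comp_homogeneous:
  assumes "x \<in> gr m"
  shows "hcomp x = (\<lambda>n. if n = m then x else \<zero>)"
  by (rule comp_eq[OF gr_carrier[OF assms]], rule decompI[of "{m}"])
    (use assms gr_carrier in \<open>auto simp: C.finsum_insert gr_zero\<close>)

lemma comp_zero: "hcomp \<zero> n = \<zero>"
  using comp_homogeneous[OF gr_zero[of 0]] by simp

lemma comp_mult_right:
  assumes "x \<in> carrier C" "y \<in> gr m"
  shows "hcomp (x \<otimes> y) = (\<lambda>n. hcomp x (n - m) \<otimes> y)"
proof (rule comp_eq)
  have y: "y \<in> carrier C" using assms(2) gr_carrier by blast
  let ?I = "(\<lambda>n. n + m) ` supp x"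
  have cl: "hcomp x n \<in> carrier C" for n using comp_carrier assms(1) by blast
  have "x \<otimes> y = (\<Oplus>n\<in>supp x. hcomp x n) \<otimes> y"
    using comp_sum[OF assms(1) finite_supp[OF assms(1)]] by simp
  also have "\<dots> = (\<Oplus>n\<in>supp x. hcomp x n \<otimes> y)"
    by (rule C.finsum_ldistr) (use finite_supp y cl assms in auto)
  also have "\<dots> = (\<Oplus>n\<in>supp x. hcomp x ((n + m) - m) \<otimes> y)" by simp
  also have "\<dots> = (\<Oplus>n\<in>?I. hcomp x (n - m) \<otimes> y)"
    by (rule C.finsum_reindex[symmetric]) (use y cl in \<open>auto simp: inj_on_def\<close>)
  finally have "x \<otimes> y = (\<Oplus>n\<in>?I. hcomp x (n - m) \<otimes> y)" .
  moreover have "hcomp x (n - m) \<otimes> y = \<zero>" if "n \<notin> ?I" for n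
  proof -
    have "n - m \<notin> supp x" using that image_eqI[of n "\<lambda>n. n + m" "n - m"] by auto
    then show ?thesis using y by simp
  qed
  moreover have "hcomp x (n - m) \<otimes> y \<in> gr n" for n
    using gr_mult[OF comp_gr[OF assms(1), of "n - m"] assms(2)] by simp
  ultimately show "decomp (x \<otimes> y) (\<lambda>n. hcomp x (n - m) \<otimes> y)"
    by (intro decompI[of ?I] finite_imageI finite_supp[OF assms(1)])
qed (use assms gr_carrier in auto)

end

section \<open>The group algebra and the two sides of the canonical map\<close>

abbreviation group_algebra_smult ::
    "complex \<Rightarrow> (int \<Rightarrow>\<^sub>0 complex) \<Rightarrow> (int \<Rightarrow>\<^sub>0 complex)" where
  "group_algebra_smult \<equiv> smult int_group_algebra"

lemma group_algebra_smult_lookup: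
  "Poly_Mapping.lookup (group_algebra_smult c f) n = c * Poly_Mapping.lookup f n"
proof -
  have "Poly_Mapping.single 0 c * f = Poly_Mapping.map ((*) c) f"
    by (simp add: mult_map_scale_conv_mult)
  then show ?thesis by (simp add: int_group_algebra_def Poly_Mapping.map.rep_eq when_def)
qed

lemma int_group_algebra_simps:
  "carrier int_group_algebra = UNIV" "\<zero>\<^bsub>int_group_algebra\<^esub> = 0"
  "f \<oplus>\<^bsub>int_group_algebra\<^esub> g = f + g"
  by (simp_all add: int_group_algebra_def)

lemma int_group_algebra_abelian_group: "abelian_group int_group_algebra"
  by (rule abelian_groupI) (auto simp: int_group_algebra_simps ac_simps intro: exI[of _ "- _"] left_minus)

sublocale graded \<subseteq> source: tensor_product C C "gr 0" "monoid.mult C" "monoid.mult C"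
  by unfold_locales (auto dest: gr_carrier)

sublocale graded \<subseteq> target: tensor_product C int_group_algebra UNIV "\<lambda>c z. z \<odot> c" group_algebra_smult
proof -
  interpret G: abelian_group int_group_algebra by (rule int_group_algebra_abelian_group)
  show "tensor_product C int_group_algebra UNIV (\<lambda>c z. z \<odot> c) group_algebra_smult"
    by unfold_locales (simp_all add: int_group_algebra_simps complex_ring_def)
qed

context graded
begin

text \<open>The canonical map on generators, lifted to integer combinations.\<close>

definition can_word :: "'c \<times> 'c \<Rightarrow> ('c \<times> (int \<Rightarrow>\<^sub>0 complex)) \<Rightarrow>\<^sub>0 int" where
  "can_word = (\<lambda>(x, y). \<Sum>m\<in>supp y. gen (x \<otimes> hcomp y m, Poly_Mapping.single m 1))"

abbreviation "tcl \<equiv> rel_class target.rels"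
abbreviation "scl \<equiv> rel_class source.rels"

text \<open>The additional terms have a zero left factor, so their classes vanish.\<close>

lemma can_word_superset:
  assumes "x \<in> carrier C" "y \<in> carrier C" "finite I" "supp y \<subseteq> I"
  shows "tcl (can_word (x, y)) = tcl (\<Sum>m\<in>I. gen (x \<otimes> hcomp y m, Poly_Mapping.single m 1))"
proof -
  let ?h = "\<lambda>m. gen (x \<otimes> hcomp y m, Poly_Mapping.single m (1::complex))"
  have "tcl (sum ?h (I - supp y)) = tcl (\<Sum>m\<in>I - supp y. 0)"
  proof (rule rel_class_sum_cong)
    fix m assume "m \<in> I - supp y"
    then show "tcl (?h m) = tcl 0"
      using assms(1) target.class_zero_left[of "Poly_Mapping.single m 1"]
      by (simp add: int_group_algebra_simps)
  qed
  then have "tcl (sum ?h (I - supp y) + sum ?h (supp y)) = tcl ((\<Sum>m\<in>I - supp y. 0) + sum ?h (supp y))"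
    by (intro rel_class_add_cong refl)
  then show ?thesis
    using sum.subset_diff[OF assms(4,3), of ?h] by (simp add: can_word_def)
qed

lemma canonical_map_class:
  assumes "z upon carrier C \<times> carrier C"
  shows "canonical_map C gr (scl z) = tcl (frag_extend can_word z)"
  unfolding canonical_map_def target.tens_eq
proof (rule source.extend_additively_tens_presented[OF _ _ _ _ assms])
  fix x y assume xy: "x \<in> carrier C" "y \<in> carrier C"
  have "(\<Oplus>\<^bsub>presented_group target.gens target.rels\<^esub>m\<in>supp y.
      galois_target_pure C (x \<otimes> hcomp y m) (Poly_Mapping.single m 1))
    = tcl (\<Sum>m\<in>supp y. gen (x \<otimes> hcomp y m, Poly_Mapping.single m 1))"
    unfolding pure_tensor_def
    by (rule presented_finsum[OF finite_supp[OF xy(2)]])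
      (use xy comp_carrier in \<open>simp add: int_group_algebra_simps\<close>)
  moreover have "(can_word (x, y)) upon target.gens"
    unfolding can_word_def prod.case
    by (rule keys_sum_subset) (use xy comp_carrier in \<open>simp add: int_group_algebra_simps\<close>)
  ultimately show "(case (x, y) of (c, c') \<Rightarrow> \<Oplus>\<^bsub>presented_group target.gens target.rels\<^esub>m\<in>supp c'.
      galois_target_pure C (c \<otimes> hcomp c' m) (Poly_Mapping.single m 1)) = tcl (can_word (x, y)) \<and>
    (can_word (x, y)) upon target.gens"
    by (simp add: can_word_def)
next
  fix x x' y assume *: "x \<in> carrier C" "x' \<in> carrier C" "y \<in> carrier C"
  have hy: "hcomp y m \<in> carrier C" for m using *(3) by (rule comp_carrier)
  have "tcl (can_word (x \<oplus> x', y)) = tcl (\<Sum>m\<in>supp y. gen (x \<otimes> hcomp y m, Poly_Mapping.single m 1)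
      + gen (x' \<otimes> hcomp y m, Poly_Mapping.single m 1))"
    unfolding can_word_def prod.case
    by (rule rel_class_sum_cong)
      (use * in \<open>simp add: hy C.l_distr target.class_add_left int_group_algebra_simps\<close>)
  then show "tcl (can_word (x \<oplus> x', y)) = tcl (can_word (x, y) + can_word (x', y))"
    by (simp add: can_word_def sum.distrib)
next
  fix x y y' assume *: "x \<in> carrier C" "y \<in> carrier C" "y' \<in> carrier C"
  let ?I = "supp y \<union> supp y'"
  have I: "finite ?I" "supp (y \<oplus> y') \<subseteq> ?I" using * finite_supp by (auto simp: comp_add)
  have "tcl (can_word (x, y \<oplus> y'))
      = tcl (\<Sum>m\<in>?I. gen (x \<otimes> hcomp (y \<oplus> y') m, Poly_Mapping.single m 1))"
    using * I by (intro can_word_superset) auto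
  also have "\<dots> = tcl (\<Sum>m\<in>?I. gen (x \<otimes> hcomp y m, Poly_Mapping.single m 1)
      + gen (x \<otimes> hcomp y' m, Poly_Mapping.single m 1))"
    by (rule rel_class_sum_cong)
      (use * comp_carrier target.class_add_left in \<open>simp add: comp_add C.r_distr int_group_algebra_simps\<close>)
  also have "\<dots> = tcl (can_word (x, y) + can_word (x, y'))"
    unfolding sum.distrib
    by (rule rel_class_add_cong; rule can_word_superset[symmetric]) (use * I in auto)
  finally show "tcl (can_word (x, y \<oplus> y')) = tcl (can_word (x, y) + can_word (x, y'))" .
next
  fix x s y assume *: "x \<in> carrier C" "s \<in> gr 0" "y \<in> carrier C"
  have s: "s \<in> carrier C" using *(2) gr_carrier by blast
  \<comment> \<open>Multiplication by \<open>s\<close> of degree 0 does not shift components, but it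
    may annihilate some; hence the sum over the support of \<open>y\<close>.\<close>
  have "tcl (can_word (x, s \<otimes> y))
      = tcl (\<Sum>m\<in>supp y. gen (x \<otimes> hcomp (s \<otimes> y) m, Poly_Mapping.single m 1))"
    by (rule can_word_superset) (use * s finite_supp in \<open>auto simp: comp_mult_left\<close>)
  also have "\<dots> = tcl (can_word (x \<otimes> s, y))"
    using * s comp_carrier by (simp add: can_word_def comp_mult_left C.m_assoc)
  finally show "tcl (can_word (x \<otimes> s, y)) = tcl (can_word (x, s \<otimes> y))" by simp
qed

text \<open>Says that \<open>\<one>\<close> lies in the span of the products of degree
  \<open>- m\<close> with degree \<open>m\<close>; holding for all \<open>m\<close>, this is the
  condition that the algebra is strongly graded.\<close>

definition has_unit :: "int \<Rightarrow> bool" where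
  "has_unit m \<longleftrightarrow> (\<exists>n u v. u \<in> {..<n::nat} \<rightarrow> gr (- m) \<and> v \<in> {..<n} \<rightarrow> gr m \<and>
    \<one> = (\<Oplus>i\<in>{..<n}. u i \<otimes> v i))"

lemma mult_span:
  assumes "z upon gr (- m) \<times> gr m"
    and "\<one> = additive_ext C (\<lambda>(x, y). x \<otimes> y) z"
  shows "has_unit m"
proof -
  have "\<exists>n u v. u \<in> {..<n::nat} \<rightarrow> gr (- m) \<and> v \<in> {..<n} \<rightarrow> gr m \<and>
      additive_ext C (\<lambda>(x, y). x \<otimes> y) z = (\<Oplus>i\<in>{..<n}. u i \<otimes> v i)"
  proof (rule C.finsum_pairs[OF _ _ assms(1)])
    fix x y assume xy: "x \<in> gr (- m)" "y \<in> gr m"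
    then have "x \<in> carrier C" "y \<in> carrier C" using gr_carrier by blast+
    then show "x \<otimes> y \<in> carrier C" by simp
    \<comment> \<open>The graded pieces are assumed closed under scalars, not under negation, so the
      negative is written as a scalar multiple.\<close>
    have "(- 1) \<odot> x \<oplus> x = \<zero>" "(- 1) \<odot> x \<in> carrier C"
      using alg.smult_l_distr[of "- 1" 1 x] alg.smult_one[of x] alg.smult_l_null[of x]
        alg.smult_closed[of "- 1" x] \<open>x \<in> carrier C\<close>
      by (simp_all add: complex_ring_def)
    then have "\<ominus> x = (- 1) \<odot> x" using \<open>x \<in> carrier C\<close> by (intro C.minus_equality)
    then have "\<ominus> x \<in> gr (- m)" using gr_smult[OF xy(1)] by simp
    moreover have "\<ominus> (x \<otimes> y) = \<ominus> x \<otimes> y"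
      using \<open>x \<in> carrier C\<close> \<open>y \<in> carrier C\<close> by (simp add: C.l_minus)
    ultimately show "\<exists>x'\<in>gr (- m). \<ominus> (x \<otimes> y) = x' \<otimes> y" by blast
  qed
  then show ?thesis unfolding has_unit_def using assms(2) by metis
qed

text \<open>Representative of the coordinate map of the target tensor product at the basis element
  of \<open>m\<close>.\<close>

definition coefficient :: "int \<Rightarrow> 'c \<times> (int \<Rightarrow>\<^sub>0 complex) \<Rightarrow> 'c" where
  "coefficient m = (\<lambda>(c, f). Poly_Mapping.lookup f m \<odot> c)"

text \<open>A preimage of \<open>\<one>\<close> tensored with the basis element of \<open>m\<close>
  is used. Its image has \<open>m\<close>-th coordinate \<Sum> x y_m over the pairs (x, y) in the
  preimage, so this sum is \<open>\<one>\<close>; taking the component of degree 0 replaces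
  \<open>x\<close> by its component of degree \<open>- m\<close>.\<close>

lemma unit_of_surjective:
  assumes "canonical_map C gr ` carrier source.tens = carrier target.tens"
  shows "has_unit m"
proof -
  let ?X = "gr (- m)" and ?Y = "gr m"
  define t where "t = gen (\<one>, Poly_Mapping.single m (1::complex))"
  have t: "t upon target.gens" by (simp add: t_def int_group_algebra_simps)
  then have "tcl t \<in> canonical_map C gr ` carrier source.tens"
    unfolding assms target.tens_eq by (rule presented_closed)
  then obtain z where z: "z upon carrier C \<times> carrier C" "tcl t = tcl (frag_extend can_word z)"
    unfolding source.tens_eq presented_carrier by (auto simp: canonical_map_class)
  have cf: "coefficient m \<in> target.gens \<rightarrow> carrier C"
    by (auto simp: coefficient_def complex_ring_def)
  have keys: "(can_word g) upon target.gens" if "g \<in> carrier C \<times> carrier C" for g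
    using that unfolding can_word_def
    by (cases g) (auto intro!: keys_sum_subset simp: int_group_algebra_simps comp_carrier)
  have ext: "extend_additively C (coefficient m) (tcl w) = additive_ext C (coefficient m) w"
    if "w upon target.gens" for w
    by (rule target.extend_additively_tens[OF C.abelian_group_axioms _ _ _ _ that])
      (simp_all add: coefficient_def complex_ring_def int_group_algebra_simps lookup_add
        alg.smult_r_distr alg.smult_l_distr[unfolded complex_ring_def, simplified]
        alg.smult_assoc1[unfolded complex_ring_def, simplified, symmetric]
        group_algebra_smult_lookup mult.commute)
  \<comment> \<open>What the \<open>m\<close>-th coordinate leaves of the image of a
    generator.\<close>
  define h where "h = (\<lambda>(x, y). x \<otimes> hcomp y m)"
  have h: "h \<in> carrier C \<times> carrier C \<rightarrow> carrier C" using comp_carrier by (auto simp: h_def)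
  have word: "additive_ext C (coefficient m) (can_word (x, y)) = h (x, y)"
    if "x \<in> carrier C" "y \<in> carrier C" for x y
  proof -
    have cl: "x \<otimes> hcomp y k \<in> carrier C" for k using that comp_carrier by simp
    have g: "additive_ext C (coefficient m) (gen (c, Poly_Mapping.single k 1)) = (if m = k then c else \<zero>)"
      if "c \<in> carrier C" for c k
      using that cf alg.smult_one[unfolded complex_ring_def, simplified]
        alg.smult_l_null[unfolded complex_ring_def, simplified]
      by (subst C.additive_ext_gen) (auto simp: coefficient_def int_group_algebra_simps lookup_single when_def)
    have "additive_ext C (coefficient m) (can_word (x, y))
      = (\<Oplus>k\<in>supp y. additive_ext C (coefficient m) (gen (x \<otimes> hcomp y k, Poly_Mapping.single k 1)))"
      unfolding can_word_def prod.case
      by (rule C.additive_ext_sum[OF finite_supp[OF that(2)] _ cf]) (use cl in \<open>simp add: int_group_algebra_simps\<close>)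
    also have "\<dots> = (\<Oplus>k\<in>supp y. if m = k then x \<otimes> hcomp y k else \<zero>)"
      by (rule C.finsum_cong') (use cl in \<open>simp_all add: g\<close>)
    also have "\<dots> = h (x, y)"
    proof (cases "m \<in> supp y")
      case True
      then show ?thesis
        using C.finsum_singleton[OF True finite_supp[OF that(2)], of "\<lambda>k. x \<otimes> hcomp y k"] cl
        by (simp add: h_def)
    next
      case False
      have "(\<Oplus>k\<in>supp y. if m = k then x \<otimes> hcomp y k else \<zero>) = (\<Oplus>k\<in>supp y. \<zero>)"
        by (rule C.finsum_cong') (use False in auto)
      then show ?thesis using False that by (simp add: h_def C.finsum_zero)
    qed
    finally show ?thesis .
  qed
  have "additive_ext C (coefficient m) (frag_extend can_word z) = additive_ext C h z
      \<and> z upon carrier C \<times> carrier C"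
    using z(1)
  proof (induction z rule: frag_induction)
    case (one g)
    then show ?case using word h by (cases g) (simp add: C.additive_ext_gen h_def comp_carrier)
  next
    case (diff a b)
    have ab: "(frag_extend can_word a) upon target.gens"
      by (rule frag_extend_subset[OF diff(1)[THEN conjunct2] keys])
    have ab': "(frag_extend can_word b) upon target.gens"
      by (rule frag_extend_subset[OF diff(2)[THEN conjunct2] keys])
    from diff show ?case
      using C.additive_ext_diff[OF _ _ cf, of "frag_extend can_word a" "frag_extend can_word b"]
        C.additive_ext_diff[OF _ _ h, of a b] ab ab'
      by (simp add: frag_extend_diff keys_diff_subset)
  qed simp
  moreover have "additive_ext C (coefficient m) t = additive_ext C (coefficient m) (frag_extend can_word z)"
    using ext[OF t] ext[OF frag_extend_subset[OF z(1) keys]] z(2) by simp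
  moreover have "additive_ext C (coefficient m) t = \<one>"
    using alg.smult_one[unfolded complex_ring_def, simplified] unfolding t_def
    by (subst C.additive_ext_gen) (simp_all add: coefficient_def)
  ultimately have one: "\<one> = additive_ext C h z" by simp
  \<comment> \<open>Both factors are cut down to the required degrees. The degree 0 component of the
    sum is unchanged by this.\<close>
  define w where "w = frag_extend (\<lambda>(x, y). gen (hcomp x (- m), hcomp y m)) z"
  have h': "(\<lambda>(x, y). x \<otimes> y) \<in> ?X \<times> ?Y \<rightarrow> carrier C" using gr_carrier by auto
  have wk: "(case g of (x, y) \<Rightarrow> gen (hcomp x (- m), hcomp y m)) upon ?X \<times> ?Y"
    if "g \<in> carrier C \<times> carrier C" for g
    using that by (auto simp: comp_gr)
  have w: "w upon ?X \<times> ?Y" unfolding w_def by (rule frag_extend_subset[OF z(1) wk])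
  have "hcomp (additive_ext C h z) 0 = additive_ext C (\<lambda>(x, y). x \<otimes> y) w
      \<and> z upon carrier C \<times> carrier C"
    using z(1) unfolding w_def
  proof (induction z rule: frag_induction)
    case zero
    then show ?case by (simp add: comp_zero)
  next
    case (one g)
    then obtain x y where g: "g = (x, y)" "x \<in> carrier C" "y \<in> carrier C" by auto
    have "hcomp (additive_ext C h (gen g)) 0 = hcomp (x \<otimes> hcomp y m) 0"
      using g h by (subst C.additive_ext_gen) (auto simp: h_def comp_carrier)
    also have "\<dots> = hcomp x (- m) \<otimes> hcomp y m"
      using comp_mult_right[OF g(2) comp_gr[OF g(3)], of m] by simp
    also have "\<dots> = additive_ext C (\<lambda>(x, y). x \<otimes> y) (gen (hcomp x (- m), hcomp y m))"
      using g by (subst C.additive_ext_gen) (auto simp: comp_carrier)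
    finally show ?case using g by simp
  next
    case (diff a b)
    have cl: "additive_ext C h a \<in> carrier C" "additive_ext C h b \<in> carrier C"
      using diff h C.additive_ext_closed by blast+
    \<comment> \<open>Components are known to be additive on sums, so the difference is treated as a
      sum first.\<close>
    have "additive_ext C h (a - b) \<oplus> additive_ext C h b = additive_ext C h a"
      using diff cl C.additive_ext_diff[OF _ _ h, of a b] by (simp add: a_minus_def C.a_assoc C.l_neg)
    moreover have dcl: "additive_ext C h (a - b) \<in> carrier C"
      using diff h by (intro C.additive_ext_closed[OF keys_diff_subset]) auto
    ultimately have "hcomp (additive_ext C h (a - b)) 0 \<oplus> hcomp (additive_ext C h b) 0 = hcomp (additive_ext C h a) 0"
      using comp_add[OF dcl cl(2)] by metis
    then have "hcomp (additive_ext C h (a - b)) 0 = hcomp (additive_ext C h a) 0 \<ominus> hcomp (additive_ext C h b) 0"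
      using cl dcl comp_carrier
      by (metis C.add.inv_solve_right a_minus_def)
    then show ?case
      using diff C.additive_ext_diff[OF frag_extend_subset[OF diff(1)[THEN conjunct2] wk]
          frag_extend_subset[OF diff(2)[THEN conjunct2] wk] h']
      by (simp add: frag_extend_diff keys_diff_subset)
  qed
  then have "\<one> = additive_ext C (\<lambda>(x, y). x \<otimes> y) w"
    using one comp_homogeneous[OF gr_one] by simp
  with mult_span[OF w] show ?thesis by blast
qed

end

lemma poly_mapping_sum_single:
  fixes f :: "'i \<Rightarrow>\<^sub>0 'b::comm_monoid_add"
  shows "(\<Sum>m\<in>Poly_Mapping.keys f. Poly_Mapping.single m (Poly_Mapping.lookup f m)) = f"
proof (rule poly_mapping_eqI)
  fix k
  have "(\<Sum>m\<in>Poly_Mapping.keys f. Poly_Mapping.lookup (Poly_Mapping.single m (Poly_Mapping.lookup f m)) k)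
      = (\<Sum>m\<in>Poly_Mapping.keys f. if m = k then Poly_Mapping.lookup f k else 0)"
    by (rule sum.cong) (auto simp: lookup_single when_def)
  also have "\<dots> = Poly_Mapping.lookup f k" by (simp add: in_keys_iff)
  finally show "Poly_Mapping.lookup (\<Sum>m\<in>Poly_Mapping.keys f. Poly_Mapping.single m (Poly_Mapping.lookup f m)) k
      = Poly_Mapping.lookup f k"
    by (simp add: lookup_sum)
qed

lemma int_group_algebra_finsum:
  "finite I \<Longrightarrow> (\<Oplus>\<^bsub>int_group_algebra\<^esub>i\<in>I. f i) = (\<Sum>i\<in>I. f i)"
proof (induction I rule: finite_induct)
  case empty
  interpret G: abelian_group int_group_algebra by (rule int_group_algebra_abelian_group)
  show ?case by (simp add: int_group_algebra_simps)
next
  case (insert i I)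
  interpret G: abelian_group int_group_algebra by (rule int_group_algebra_abelian_group)
  from insert show ?case
    by (subst G.finsum_insert) (auto simp: int_group_algebra_simps)
qed

context graded
begin

text \<open>One expression of the unit is inserted in the middle of the other: \<Sum> (s_j u_i) (v_i
  t_j) = \<Sum> s_j t_j = 1.\<close>

lemma has_unit_add:
  assumes "has_unit a" "has_unit b"
  shows "has_unit (a + b)"
proof -
  obtain n u v where uv: "u \<in> {..<n::nat} \<rightarrow> gr (- a)" "v \<in> {..<n} \<rightarrow> gr a"
    "\<one> = (\<Oplus>i\<in>{..<n}. u i \<otimes> v i)" using assms(1) unfolding has_unit_def by blast
  obtain k s t where st: "s \<in> {..<k::nat} \<rightarrow> gr (- b)" "t \<in> {..<k} \<rightarrow> gr b"
    "\<one> = (\<Oplus>j\<in>{..<k}. s j \<otimes> t j)" using assms(2) unfolding has_unit_def by blast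
  have cl: "u i \<in> carrier C" "v i \<in> carrier C" if "i < n" for i
    using uv gr_carrier that by (auto simp: Pi_iff)
  have cl': "s j \<in> carrier C" "t j \<in> carrier C" if "j < k" for j
    using st gr_carrier that by (auto simp: Pi_iff)
  let ?U = "gr (- (a + b))" and ?V = "gr (a + b)"
  define f where "f = (\<lambda>(x, y). x \<otimes> y)"
  \<comment> \<open>The double sum is encoded as a combination of pairs, which
    \<open>mult_span\<close> turns back into a single indexed sum.\<close>
  define w where "w j = (\<Sum>i<n. gen (s j \<otimes> u i, v i \<otimes> t j))" for j
  have f: "f \<in> ?U \<times> ?V \<rightarrow> carrier C" using gr_carrier by (auto simp: f_def)
  have g: "s j \<otimes> u i \<in> ?U" "v i \<otimes> t j \<in> ?V" if "i < n" "j < k" for i j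
    using gr_mult[of "s j" "- b" "u i" "- a"] gr_mult[of "v i" a "t j" b] uv st that
    by (auto simp: Pi_iff ac_simps)
  have w: "(w j) upon ?U \<times> ?V" if "j < k" for j
    unfolding w_def by (rule keys_sum_subset) (use g that in auto)
  have ext: "additive_ext C f (w j) = s j \<otimes> t j" if j: "j < k" for j
  proof -
    have "additive_ext C f (w j) = (\<Oplus>i\<in>{..<n}. additive_ext C f (gen (s j \<otimes> u i, v i \<otimes> t j)))"
      unfolding w_def by (rule C.additive_ext_sum[OF _ _ f]) (use g j in auto)
    also have "\<dots> = (\<Oplus>i\<in>{..<n}. s j \<otimes> (u i \<otimes> v i) \<otimes> t j)"
    proof (rule C.finsum_cong')
      fix i assume i: "i \<in> {..<n}"
      then have "additive_ext C f (gen (s j \<otimes> u i, v i \<otimes> t j)) = (s j \<otimes> u i) \<otimes> (v i \<otimes> t j)"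
        using cl cl' j by (subst C.additive_ext_gen) (auto simp: f_def)
      then show "additive_ext C f (gen (s j \<otimes> u i, v i \<otimes> t j)) = s j \<otimes> (u i \<otimes> v i) \<otimes> t j"
        using cl cl' i j by (simp add: C.m_assoc)
    qed (use cl cl' j in auto)
    also have "\<dots> = (\<Oplus>i\<in>{..<n}. s j \<otimes> (u i \<otimes> v i)) \<otimes> t j"
      by (rule C.finsum_ldistr[symmetric]) (use cl cl' j in auto)
    also have "(\<Oplus>i\<in>{..<n}. s j \<otimes> (u i \<otimes> v i)) = s j \<otimes> (\<Oplus>i\<in>{..<n}. u i \<otimes> v i)"
      by (rule C.finsum_rdistr[symmetric]) (use cl cl' j in auto)
    finally show ?thesis using cl' j by (simp add: uv(3)[symmetric])
  qed
  have "additive_ext C f (\<Sum>j<k. w j) = (\<Oplus>j\<in>{..<k}. additive_ext C f (w j))"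
    by (rule C.additive_ext_sum[OF _ _ f]) (use w in auto)
  also have "\<dots> = (\<Oplus>j\<in>{..<k}. s j \<otimes> t j)"
    by (rule C.finsum_cong') (use ext cl' in auto)
  finally have "\<one> = additive_ext C f (\<Sum>j<k. w j)" using st(3) by simp
  moreover have "(\<Sum>j<k. w j) upon ?U \<times> ?V"
    by (rule keys_sum_subset) (use w in auto)
  ultimately show ?thesis using mult_span[of "\<Sum>j<k. w j" "a + b"] by (simp add: f_def)
qed

lemma has_unit_all:
  assumes "has_unit 1" "has_unit (- 1)"
  shows "has_unit m"
proof (induction m rule: int_induct[of _ 0])
  case base
  show ?case using has_unit_add[OF assms] by simp
next
  case (step1 i)
  then show ?case using has_unit_add[OF _ assms(1)] by blast
next
  case (step2 i)
  then show ?case using has_unit_add[OF _ assms(2), of i] by simp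
qed

text \<open>Both composites are computed on generators. One returns to its argument because degree
  zero elements cross the tensor sign in the source, the other because complex numbers cross it in
  the target.\<close>

lemma canonical_map_bij:
  assumes "\<And>m. has_unit m"
  shows "bij_betw (canonical_map C gr) (carrier source.tens) (carrier target.tens)"
proof -
  have "\<forall>m. \<exists>n u v. u \<in> {..<n::nat} \<rightarrow> gr (- m) \<and> v \<in> {..<n} \<rightarrow> gr m \<and>
      \<one> = (\<Oplus>i\<in>{..<n}. u i \<otimes> v i)"
    using assms unfolding has_unit_def by (rule allI)
  from choice[OF this] obtain N where "\<forall>m. \<exists>u v. u \<in> {..<N m::nat} \<rightarrow> gr (- m) \<and> v \<in> {..<N m} \<rightarrow> gr m \<and>
      \<one> = (\<Oplus>i\<in>{..<N m}. u i \<otimes> v i)" ..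
  from choice[OF this] obtain u where "\<forall>m. \<exists>v. u m \<in> {..<N m::nat} \<rightarrow> gr (- m) \<and> v \<in> {..<N m} \<rightarrow> gr m \<and>
      \<one> = (\<Oplus>i\<in>{..<N m}. u m i \<otimes> v i)" ..
  from choice[OF this] obtain v where uv': "\<forall>m. u m \<in> {..<N m::nat} \<rightarrow> gr (- m) \<and> v m \<in> {..<N m} \<rightarrow> gr m \<and>
      \<one> = (\<Oplus>i\<in>{..<N m}. u m i \<otimes> v m i)" ..
  have uv: "u m \<in> {..<N m} \<rightarrow> gr (- m)" "v m \<in> {..<N m} \<rightarrow> gr m"
    "\<one> = (\<Oplus>i\<in>{..<N m}. u m i \<otimes> v m i)" for m
    using uv' by auto
  have ugr: "u m i \<in> gr (- m)" and vgr: "v m i \<in> gr m" if "i < N m" for m i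
    using uv that by (auto simp: Pi_iff)
  have u: "u m i \<in> carrier C" and v: "v m i \<in> carrier C" if "i < N m" for m i
    using ugr vgr that gr_carrier by blast+
  have smult: "c \<odot> x \<in> carrier C" if "x \<in> carrier C" for c x
    using that by (simp add: complex_ring_def)
  \<comment> \<open>The inverse on \<open>c\<close> tensored with the basis element of
    \<open>m\<close>.\<close>
  define h where "h m c = (\<Sum>i<N m. gen (c \<otimes> u m i, v m i))" for m c
  \<comment> \<open>A general \<open>f\<close> is expanded in the group basis and its coefficients
    are moved to the left factor.\<close>
  define inv_word where "inv_word = (\<lambda>(c, f :: int \<Rightarrow>\<^sub>0 complex).
    \<Sum>m\<in>Poly_Mapping.keys f. h m (Poly_Mapping.lookup f m \<odot> c))"
  have h_keys: "(h m c) upon source.gens" if "c \<in> carrier C" for m c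
    unfolding h_def by (rule keys_sum_subset) (use that u v in auto)
  have h_add: "scl (h m (c \<oplus> d)) = scl (h m c + h m d)" if "c \<in> carrier C" "d \<in> carrier C" for m c d
    unfolding h_def sum.distrib[symmetric]
    by (rule rel_class_sum_cong) (use that u v in \<open>simp add: C.l_distr source.class_add_left\<close>)
  have h_zero: "scl (h m \<zero>) = scl 0" for m
  proof -
    have "scl (h m \<zero>) = scl (\<Sum>i<N m. 0)"
      unfolding h_def by (rule rel_class_sum_cong) (use u v source.class_zero_left in simp)
    then show ?thesis by simp
  qed
  have inv_keys: "(inv_word (c, f)) upon source.gens" if "c \<in> carrier C" for c f
    unfolding inv_word_def prod.case by (rule keys_sum_subset) (rule h_keys[OF smult[OF that]])
  have inv_superset: "scl (inv_word (c, f)) = scl (\<Sum>m\<in>I. h m (Poly_Mapping.lookup f m \<odot> c))"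
    if "c \<in> carrier C" "finite I" "f upon I" for c f I
  proof -
    let ?h = "\<lambda>m. h m (Poly_Mapping.lookup f m \<odot> c)"
    have "scl (sum ?h (I - Poly_Mapping.keys f)) = scl (\<Sum>m\<in>I - Poly_Mapping.keys f. 0)"
    proof (rule rel_class_sum_cong)
      fix m assume "m \<in> I - Poly_Mapping.keys f"
      then have "Poly_Mapping.lookup f m \<odot> c = \<zero>"
        using alg.smult_l_null[OF that(1)] by (simp add: in_keys_iff complex_ring_def)
      then show "scl (?h m) = scl 0" by (simp add: h_zero)
    qed
    then have "scl (sum ?h (I - Poly_Mapping.keys f) + sum ?h (Poly_Mapping.keys f))
        = scl ((\<Sum>m\<in>I - Poly_Mapping.keys f. 0) + sum ?h (Poly_Mapping.keys f))"
      by (intro rel_class_add_cong refl)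
    then show ?thesis using sum.subset_diff[OF that(3,2), of ?h] by (simp add: inv_word_def)
  qed
  define psi where "psi = extend_additively source.tens (\<lambda>g. scl (inv_word g))"
  have psi_class: "psi (tcl z) = scl (frag_extend inv_word z)"
    if "z upon target.gens" for z
    unfolding psi_def source.tens_eq
  proof (rule target.extend_additively_tens_presented[OF _ _ _ _ that])
    fix c and f :: "int \<Rightarrow>\<^sub>0 complex" assume "c \<in> carrier C"
    then show "scl (inv_word (c, f)) = scl (inv_word (c, f)) \<and>
        (inv_word (c, f)) upon source.gens" using inv_keys by blast
  next
    fix c d and f :: "int \<Rightarrow>\<^sub>0 complex" assume cd: "c \<in> carrier C" "d \<in> carrier C"
    show "scl (inv_word (c \<oplus> d, f)) = scl (inv_word (c, f) + inv_word (d, f))"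
      unfolding inv_word_def prod.case sum.distrib[symmetric]
      by (rule rel_class_sum_cong) (use cd smult h_add in \<open>simp add: alg.smult_r_distr complex_ring_def\<close>)
  next
    fix c and f g :: "int \<Rightarrow>\<^sub>0 complex" assume c: "c \<in> carrier C"
    let ?I = "Poly_Mapping.keys f \<union> Poly_Mapping.keys g"
    have "scl (inv_word (c, f + g)) = scl (\<Sum>m\<in>?I. h m (Poly_Mapping.lookup (f + g) m \<odot> c))"
      by (rule inv_superset[OF c]) (auto simp: Poly_Mapping.keys_add)
    also have "\<dots> = scl (\<Sum>m\<in>?I. h m (Poly_Mapping.lookup f m \<odot> c) + h m (Poly_Mapping.lookup g m \<odot> c))"
    proof (rule rel_class_sum_cong)
      fix m
      have "Poly_Mapping.lookup (f + g) m \<odot> c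
          = Poly_Mapping.lookup f m \<odot> c \<oplus> Poly_Mapping.lookup g m \<odot> c"
        using alg.smult_l_distr[OF _ _ c, of "Poly_Mapping.lookup f m" "Poly_Mapping.lookup g m"]
        by (simp add: lookup_add complex_ring_def)
      then show "scl (h m (Poly_Mapping.lookup (f + g) m \<odot> c))
          = scl (h m (Poly_Mapping.lookup f m \<odot> c) + h m (Poly_Mapping.lookup g m \<odot> c))"
        using h_add smult c by simp
    qed
    also have "\<dots> = scl (inv_word (c, f) + inv_word (c, g))"
      unfolding sum.distrib
      by (intro rel_class_add_cong inv_superset[symmetric] c) auto
    finally show "scl (inv_word (c, f \<oplus>\<^bsub>int_group_algebra\<^esub> g)) = scl (inv_word (c, f) + inv_word (c, g))"
      by (simp add: int_group_algebra_simps)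
  next
    fix c and s :: complex and f :: "int \<Rightarrow>\<^sub>0 complex" assume c: "c \<in> carrier C"
    have "(group_algebra_smult s f) upon Poly_Mapping.keys f"
      by (auto simp: in_keys_iff group_algebra_smult_lookup)
    from inv_superset[OF c _ this]
    have "scl (inv_word (c, group_algebra_smult s f))
        = scl (\<Sum>m\<in>Poly_Mapping.keys f. h m (Poly_Mapping.lookup (group_algebra_smult s f) m \<odot> c))" by simp
    also have "\<dots> = scl (inv_word (s \<odot> c, f))"
    proof -
      have "Poly_Mapping.lookup (group_algebra_smult s f) m \<odot> c = Poly_Mapping.lookup f m \<odot> (s \<odot> c)" for m
        using alg.smult_assoc1[OF _ _ c, of "Poly_Mapping.lookup f m" s]
        by (simp add: group_algebra_smult_lookup complex_ring_def mult.commute)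
      then show ?thesis by (simp add: inv_word_def)
    qed
    finally show "scl (inv_word (s \<odot> c, f)) = scl (inv_word (c, group_algebra_smult s f))" by simp
  qed
  have can_keys: "(can_word g) upon target.gens" if "g \<in> source.gens" for g
    using that unfolding can_word_def
    by (cases g) (auto intro!: keys_sum_subset simp: int_group_algebra_simps comp_carrier)
  have inv_can: "scl (frag_extend inv_word (frag_extend can_word z)) = scl z"
    if "z upon source.gens" for z
    using that
  proof (induction z rule: frag_induction)
    case (one g)
    then obtain x y where g: "g = (x, y)" "x \<in> carrier C" "y \<in> carrier C" by auto
    have cy: "hcomp y m \<in> carrier C" "hcomp y m \<in> gr m" for m using g(3) comp_carrier comp_gr by blast+
    have "frag_extend inv_word (can_word (x, y)) = (\<Sum>m\<in>supp y. h m (x \<otimes> hcomp y m))"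
    proof -
      have "inv_word (c, Poly_Mapping.single m 1) = h m c" if "c \<in> carrier C" for m c
        using alg.smult_one[OF that] by (simp add: inv_word_def complex_ring_def)
      then show ?thesis
        using g cy by (simp add: can_word_def frag_extend_sum finite_supp)
    qed
    also have "scl \<dots> = scl (\<Sum>m\<in>supp y. gen (x, hcomp y m))"
    proof (rule rel_class_sum_cong)
      fix m
      have "scl (h m (x \<otimes> hcomp y m)) = scl (\<Sum>i<N m. gen (x, hcomp y m \<otimes> (u m i \<otimes> v m i)))"
        unfolding h_def
      proof (rule rel_class_sum_cong)
        fix i assume "i \<in> {..<N m}"
        then have i: "i < N m" by simp
        \<comment> \<open>The degrees \<open>m\<close> and \<open>- m\<close> cancel, so this
          product is among the scalars over which the source is balanced.\<close>
        have "hcomp y m \<otimes> u m i \<in> gr 0" using gr_mult[OF cy(2)[of m] ugr[OF i]] by simp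
        then show "scl (gen (x \<otimes> hcomp y m \<otimes> u m i, v m i))
            = scl (gen (x, hcomp y m \<otimes> (u m i \<otimes> v m i)))"
          using source.class_balanced[OF g(2) _ v[OF i], of "hcomp y m \<otimes> u m i"] g cy u[OF i] v[OF i]
          by (simp add: C.m_assoc)
      qed
      also have "\<dots> = scl (gen (x, \<Oplus>i\<in>{..<N m}. hcomp y m \<otimes> (u m i \<otimes> v m i)))"
        by (rule source.class_finsum_right[symmetric]) (use g cy u v in auto)
      also have "(\<Oplus>i\<in>{..<N m}. hcomp y m \<otimes> (u m i \<otimes> v m i)) = hcomp y m \<otimes> \<one>"
        unfolding uv(3)[of m] by (rule C.finsum_rdistr[symmetric]) (use cy u v in auto)
      finally show "scl (h m (x \<otimes> hcomp y m)) = scl (gen (x, hcomp y m))" using cy by simp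
    qed
    also have "\<dots> = scl (gen (x, \<Oplus>m\<in>supp y. hcomp y m))"
      by (rule source.class_finsum_right[symmetric]) (use g cy finite_supp in auto)
    also have "(\<Oplus>m\<in>supp y. hcomp y m) = y"
      using comp_sum[OF g(3) finite_supp[OF g(3)]] by simp
    finally show ?case using g by simp
  next
    case (diff a b)
    then show ?case by (simp only: frag_extend_diff) (rule rel_class_diff_cong)
  qed simp
  have can_inv: "tcl (frag_extend can_word (frag_extend inv_word z)) = tcl z"
    if "z upon target.gens" for z
    using that
  proof (induction z rule: frag_induction)
    case (one g)
    then obtain c f where g: "g = (c, f)" "c \<in> carrier C" by auto
    define c' where "c' m = Poly_Mapping.lookup f m \<odot> c" for m
    have c': "c' m \<in> carrier C" for m using g smult by (simp add: c'_def)
    have "frag_extend can_word (inv_word (c, f))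
        = (\<Sum>m\<in>Poly_Mapping.keys f. \<Sum>i<N m. can_word (c' m \<otimes> u m i, v m i))"
      by (simp add: inv_word_def h_def c'_def frag_extend_sum)
    also have "tcl \<dots> = tcl (\<Sum>m\<in>Poly_Mapping.keys f. gen (c, Poly_Mapping.single m (Poly_Mapping.lookup f m)))"
    proof (rule rel_class_sum_cong)
      fix m :: int
      let ?s = "Poly_Mapping.single m (1::complex)"
      have "tcl (\<Sum>i<N m. can_word (c' m \<otimes> u m i, v m i)) = tcl (\<Sum>i<N m. gen (c' m \<otimes> (u m i \<otimes> v m i), ?s))"
      proof (rule rel_class_sum_cong)
        fix i assume "i \<in> {..<N m}"
        then have i: "i < N m" by simp
        \<comment> \<open>Homogeneity of \<open>v m i\<close> reduces its canonical image to a
          single term, at the group element \<open>m\<close>.\<close>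
        have sub: "supp (v m i) \<subseteq> {m}" by (auto simp: comp_homogeneous[OF vgr[OF i]])
        show "tcl (can_word (c' m \<otimes> u m i, v m i)) = tcl (gen (c' m \<otimes> (u m i \<otimes> v m i), ?s))"
          using can_word_superset[of "c' m \<otimes> u m i" "v m i" "{m}", OF _ _ _ sub]
            c' u[OF i] v[OF i] by (simp add: comp_homogeneous[OF vgr[OF i]] C.m_assoc)
      qed
      also have "\<dots> = tcl (gen (\<Oplus>i\<in>{..<N m}. c' m \<otimes> (u m i \<otimes> v m i), ?s))"
        by (rule target.class_finsum_left[symmetric]) (use c' u v in \<open>auto simp: int_group_algebra_simps\<close>)
      also have "(\<Oplus>i\<in>{..<N m}. c' m \<otimes> (u m i \<otimes> v m i)) = c' m \<otimes> \<one>"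
        unfolding uv(3)[of m] by (rule C.finsum_rdistr[symmetric]) (use c' u v in auto)
      also have "c' m \<otimes> \<one> = Poly_Mapping.lookup f m \<odot> c" using c'[of m] by (simp add: c'_def)
      \<comment> \<open>The coefficient returns to the right factor, where the terms are reassembled
        to \<open>f\<close>.\<close>
      also have "tcl (gen (Poly_Mapping.lookup f m \<odot> c, ?s)) = tcl (gen (c, group_algebra_smult (Poly_Mapping.lookup f m) ?s))"
        by (rule target.class_balanced) (use g in \<open>auto simp: int_group_algebra_simps\<close>)
      also have "group_algebra_smult (Poly_Mapping.lookup f m) ?s = Poly_Mapping.single m (Poly_Mapping.lookup f m)"
        by (simp add: int_group_algebra_def mult_single)
      finally show "tcl (\<Sum>i<N m. can_word (c' m \<otimes> u m i, v m i))
          = tcl (gen (c, Poly_Mapping.single m (Poly_Mapping.lookup f m)))" .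
    qed
    also have "\<dots> = tcl (gen (c, \<Oplus>\<^bsub>int_group_algebra\<^esub>m\<in>Poly_Mapping.keys f. Poly_Mapping.single m (Poly_Mapping.lookup f m)))"
      by (rule target.class_finsum_right[symmetric]) (use g in \<open>auto simp: int_group_algebra_simps\<close>)
    also have "\<dots> = tcl (gen (c, f))"
      by (simp add: int_group_algebra_finsum poly_mapping_sum_single)
    finally show ?case using g by simp
  next
    case (diff a b)
    then show ?case by (simp only: frag_extend_diff) (rule rel_class_diff_cong)
  qed simp
  have inv_keys': "(inv_word g) upon source.gens" if "g \<in> target.gens" for g
    using that inv_keys by (cases g) auto
  show ?thesis
  proof (rule bij_betw_byWitness[where f' = psi])
    show "\<forall>x\<in>carrier source.tens. psi (canonical_map C gr x) = x"
      unfolding source.tens_eq presented_carrier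
      by (auto simp: canonical_map_class psi_class[OF frag_extend_subset[OF _ can_keys]] inv_can)
    show "\<forall>x\<in>carrier target.tens. canonical_map C gr (psi x) = x"
      unfolding target.tens_eq presented_carrier
      by (auto simp: psi_class canonical_map_class[OF frag_extend_subset[OF _ inv_keys']] can_inv)
    show "canonical_map C gr ` carrier source.tens \<subseteq> carrier target.tens"
    proof (intro image_subsetI)
      fix x assume "x \<in> carrier source.tens"
      then obtain z where z: "x = scl z" "z upon source.gens"
        unfolding source.tens_eq presented_carrier by blast
      show "canonical_map C gr x \<in> carrier target.tens"
        unfolding z(1) canonical_map_class[OF z(2)] target.tens_eq
        by (rule presented_closed[OF frag_extend_subset[OF z(2) can_keys]])
    qed
    show "psi ` carrier target.tens \<subseteq> carrier source.tens"
    proof (intro image_subsetI)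
      fix x assume "x \<in> carrier target.tens"
      then obtain z where z: "x = tcl z" "z upon target.gens"
        unfolding target.tens_eq presented_carrier by blast
      show "psi x \<in> carrier source.tens"
        unfolding z(1) psi_class[OF z(2)] source.tens_eq
        by (rule presented_closed[OF frag_extend_subset[OF z(2) inv_keys']])
    qed
  qed
qed

end

section \<open>Line modules\<close>

context weak_line
begin

section \<open>Bijectivity of evaluation\<close>

abbreviation "ev_pair \<equiv> (\<lambda>(x, \<alpha>). \<alpha> x) :: 'l \<times> ('l \<Rightarrow> 'a) \<Rightarrow> 'a"

lemma ev_pair_closed: "ev_pair \<in> carrier E \<times> carrier D \<rightarrow> carrier A"
  by (auto simp: dual_closed)

lemma ev_pair_ext_closed:
  "z upon carrier E \<times> carrier D \<Longrightarrow> additive_ext A ev_pair z \<in> carrier A"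
  by (rule A.additive_ext_closed[OF _ ev_pair_closed])

lemma ev_unit:
  assumes "z upon carrier E \<times> carrier D" "additive_ext A ev_pair z = \<one>"
  obtains n x \<alpha> where "x \<in> {..<n::nat} \<rightarrow> carrier E" "\<alpha> \<in> {..<n} \<rightarrow> carrier D"
    "\<one> = (\<Oplus>i\<in>{..<n}. \<alpha> i (x i))"
proof -
  have "\<exists>n x \<alpha>. x \<in> {..<n::nat} \<rightarrow> carrier E \<and> \<alpha> \<in> {..<n} \<rightarrow> carrier D \<and>
      additive_ext A (\<lambda>(x, \<alpha>). \<alpha> x) z = (\<Oplus>i\<in>{..<n}. \<alpha> i (x i))"
  proof (rule A.finsum_pairs[OF _ _ assms(1)])
    fix x \<alpha> assume *: "x \<in> carrier E" "\<alpha> \<in> carrier D"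
    then show "\<alpha> x \<in> carrier A" by (simp add: dual_closed)
    have m: "\<ominus> \<one> \<in> carrier A" by simp
    \<comment> \<open>By left linearity, \<open>\<ominus> \<one>\<close> acting on the vector
      supplies the sign.\<close>
    show "\<exists>x'\<in>carrier E. \<ominus> \<alpha> x = \<alpha> x'"
      by (rule bexI[of _ "(\<ominus> \<one>) \<odot>\<^bsub>E\<^esub> x"])
        (use * dual_left[OF *(2) m *(1)] in \<open>simp_all add: left_closed A.l_minus dual_closed\<close>)
  qed
  then show thesis using that assms(2) by auto
qed

text \<open>The Morita argument: y \<otimes> \<beta> = \<Sum> y \<otimes> \<beta>.\<alpha>_i(x_i) =
  \<Sum> y \<otimes> \<langle>\<beta>, x_i\<rangle>.\<alpha>_i = \<Sum> y.\<langle>\<beta>,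
  x_i\<rangle> \<otimes> \<alpha>_i = \<Sum> \<beta>(y).x_i \<otimes> \<alpha>_i. So a tensor is
  determined by its evaluation, and the last expression shows the inverse \<open>h\<close>.\<close>

lemma ev_bij:
  assumes x: "x \<in> {..<n::nat} \<rightarrow> carrier E" and \<alpha>: "\<alpha> \<in> {..<n} \<rightarrow> carrier D"
    and one: "\<one> = (\<Oplus>i\<in>{..<n}. \<alpha> i (x i))"
  shows "bij_betw (ev A E) (carrier ED.tens) (carrier A)"
proof -
  have xi: "x i \<in> carrier E" and \<alpha>i: "\<alpha> i \<in> carrier D" if "i < n" for i using x \<alpha> that by auto
  define h where "h a = (\<Sum>i<n. gen (a \<odot>\<^bsub>E\<^esub> x i, \<alpha> i))" for a
  let ?cl = "rel_class ED.rels"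
  have h_keys: "(h a) upon carrier E \<times> carrier D" if "a \<in> carrier A" for a
    unfolding h_def by (rule keys_sum_subset) (use that xi \<alpha>i left_closed in auto)
  have h_add: "?cl (h (a \<oplus> b)) = ?cl (h a + h b)" if "a \<in> carrier A" "b \<in> carrier A" for a b
    unfolding h_def sum.distrib[symmetric]
    by (rule rel_class_sum_cong) (use that xi \<alpha>i in \<open>simp add: left_add_scalar ED.class_add_left left_closed\<close>)
  have h_diff: "?cl (h (a \<ominus> b)) = ?cl (h a - h b)" if "a \<in> carrier A" "b \<in> carrier A" for a b
  proof -
    have "(a \<ominus> b) \<oplus> b = a" using that by (simp add: a_minus_def A.a_assoc A.l_neg)
    then have "?cl (h a) = ?cl (h (a \<ominus> b) + h b)" using h_add[of "a \<ominus> b" b] that by simp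
    from rel_class_diff_cong[OF this refl, of "h b"] show ?thesis by simp
  qed
  have h_ev: "?cl (h (additive_ext A ev_pair z)) = ?cl z \<and> z upon carrier E \<times> carrier D"
    if "z upon carrier E \<times> carrier D" for z
    using that
  proof (induction z rule: frag_induction)
    case zero
    have "?cl (h \<zero>) = ?cl (h \<zero> - h \<zero>)"
      using h_diff[of "\<zero>" "\<zero>"] by (simp add: a_minus_def)
    then show ?case by simp
  next
    case (one g)
    then obtain y \<beta> where g: "g = (y, \<beta>)" "y \<in> carrier E" "\<beta> \<in> carrier D" by auto
    \<comment> \<open>Reads the chain of the Morita argument backwards, by \<open>p_q\<close>,
      balancing and \<open>q_p\<close> in turn.\<close>
    have "?cl (h (\<beta> y)) = ?cl (\<Sum>i<n. gen (y, \<beta> \<triangleleft>\<^bsub>D\<^esub> \<alpha> i (x i)))"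
      unfolding h_def
    proof (rule rel_class_sum_cong)
      fix i assume "i \<in> {..<n}"
      then have i: "x i \<in> carrier E" "\<alpha> i \<in> carrier D" using xi \<alpha>i by auto
      have "?cl (gen (\<beta> y \<odot>\<^bsub>E\<^esub> x i, \<alpha> i)) = ?cl (gen (y \<triangleleft>\<^bsub>E\<^esub> pairing \<beta> (x i), \<alpha> i))"
        using p_q[OF g(2,3) i(1)] by simp
      also have "\<dots> = ?cl (gen (y, pairing \<beta> (x i) \<odot>\<^bsub>D\<^esub> \<alpha> i))"
        by (rule ED.class_balanced) (use g i in \<open>simp_all add: pairing_closed\<close>)
      finally show "?cl (gen (\<beta> y \<odot>\<^bsub>E\<^esub> x i, \<alpha> i)) = ?cl (gen (y, \<beta> \<triangleleft>\<^bsub>D\<^esub> \<alpha> i (x i)))"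
        using q_p[OF g(3) i] by simp
    qed
    also have "\<dots> = ?cl (gen (y, \<Oplus>\<^bsub>D\<^esub>i\<in>{..<n}. \<beta> \<triangleleft>\<^bsub>D\<^esub> \<alpha> i (x i)))"
      by (rule ED.class_finsum_right[symmetric])
        (use g xi \<alpha>i in \<open>auto simp: dual_closed dual_right_closed\<close>)
    also have "(\<Oplus>\<^bsub>D\<^esub>i\<in>{..<n}. \<beta> \<triangleleft>\<^bsub>D\<^esub> \<alpha> i (x i)) = \<beta> \<triangleleft>\<^bsub>D\<^esub> \<one>"
      unfolding assms(3) by (rule DE.M.right_finsum[symmetric]) (use g xi \<alpha>i in \<open>auto simp: dual_closed\<close>)
    also have "\<beta> \<triangleleft>\<^bsub>D\<^esub> \<one> = \<beta>" by (rule DE.M.right_one[OF g(3)])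
    finally show ?case using g by (simp add: A.additive_ext_gen dual_closed)
  next
    case (diff a b)
    then have cl: "additive_ext A ev_pair a \<in> carrier A" "additive_ext A ev_pair b \<in> carrier A"
      by (simp_all add: ev_pair_ext_closed)
    have "?cl (h (additive_ext A ev_pair (a - b))) = ?cl (h (additive_ext A ev_pair a) - h (additive_ext A ev_pair b))"
      using A.additive_ext_diff[OF _ _ ev_pair_closed, of a b] diff h_diff[OF cl] by simp
    also have "\<dots> = ?cl (a - b)" using diff by (intro rel_class_diff_cong) auto
    finally show ?case using diff by (simp add: keys_diff_subset)
  qed
  have ev_h: "additive_ext A ev_pair (h a) = a" if a: "a \<in> carrier A" for a
  proof -
    have "additive_ext A ev_pair (h a) = (\<Oplus>i\<in>{..<n}. additive_ext A ev_pair (gen (a \<odot>\<^bsub>E\<^esub> x i, \<alpha> i)))"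
      unfolding h_def by (rule A.additive_ext_sum[OF _ _ ev_pair_closed]) (use a xi \<alpha>i left_closed in auto)
    also have "\<dots> = (\<Oplus>i\<in>{..<n}. a \<otimes> \<alpha> i (x i))"
      by (rule A.finsum_cong')
        (use a xi \<alpha>i in \<open>auto simp: A.additive_ext_gen dual_closed left_closed dual_left\<close>)
    also have "\<dots> = a \<otimes> \<one>"
      unfolding one by (rule A.finsum_rdistr[symmetric]) (use a xi \<alpha>i in \<open>auto simp: dual_closed\<close>)
    finally show ?thesis using a by simp
  qed
  show ?thesis
  proof (rule bij_betw_byWitness[where f' = "\<lambda>a. ?cl (h a)"])
    show "\<forall>t\<in>carrier ED.tens. ?cl (h (ev A E t)) = t"
      unfolding ED.tens_eq presented_carrier using h_ev by (auto simp: ev_class)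
    show "\<forall>a\<in>carrier A. ev A E (?cl (h a)) = a"
      by (simp add: ev_class[OF h_keys] ev_h)
    show "ev A E ` carrier ED.tens \<subseteq> carrier A"
      unfolding ED.tens_eq presented_carrier
      using ev_pair_ext_closed by (auto simp: ev_class)
    show "(\<lambda>a. ?cl (h a)) ` carrier A \<subseteq> carrier ED.tens"
      unfolding ED.tens_eq by (intro image_subsetI presented_closed h_keys)
  qed
qed

section \<open>Units in degrees one and minus one\<close>

interpretation gr: graded T gr
  using T_ring T_graded by (simp add: graded_def graded_axioms_def)

lemma embed_vector_gr: "x \<in> carrier E \<Longrightarrow> embed (gen (Vectors [x])) \<in> gr 1"
  unfolding gr_eq by (rule imageI) (simp add: line_gens_def power_gens_def)

lemma embed_covector_gr: "\<alpha> \<in> carrier D \<Longrightarrow> embed (gen (Covectors [\<alpha>])) \<in> gr (- 1)"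
  unfolding gr_eq by (rule imageI) (simp add: line_gens_def power_gens_def)

lemma vector_mult_covector:
  assumes "x \<in> carrier E" "\<alpha> \<in> carrier D"
  shows "embed (gen (Vectors [x])) \<otimes>\<^bsub>T\<^esub> embed (gen (Covectors [\<alpha>])) = tensor_algebra_inject A E (\<alpha> x)"
    and "embed (gen (Covectors [\<alpha>])) \<otimes>\<^bsub>T\<^esub> embed (gen (Vectors [x])) = tensor_algebra_inject A E (pairing \<alpha> x)"
  using assms
  by (simp_all add: T_mult words.P_in_G words.Q_in_G word_mult_gen inject_eq dual_closed pairing_closed)

lemma inject_unit:
  assumes "f \<in> {..<n::nat} \<rightarrow> carrier A" "\<one> = (\<Oplus>i\<in>{..<n}. f i)"
  shows "\<one>\<^bsub>T\<^esub> = (\<Oplus>\<^bsub>T\<^esub>i\<in>{..<n}. tensor_algebra_inject A E (f i))"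
proof -
  have "tensor_algebra_inject A E (\<Oplus>i\<in>{..<n}. f i) = (\<Oplus>\<^bsub>T\<^esub>i\<in>{..<n}. tensor_algebra_inject A E (f i))"
    by (rule A.finsum_additive_hom[OF T_abelian_group _ assms(1)])
      (auto simp: inject_eq T_add embed_cong[OF words.S_add] embed_closed words.S_in_G)
  then show ?thesis using assms(2) by (simp add: tensor_algebra_def)
qed

text \<open>Covectors have degree -1 and vectors degree 1; their products in this order are
  pairings, and \<open>pairing_unit\<close> expresses the unit by them.\<close>

lemma T_unit_one: "gr.has_unit 1"
proof -
  obtain n u d where ud: "u \<in> {..<n::nat} \<rightarrow> carrier E" "d \<in> {..<n} \<rightarrow> carrier D"
    "\<one> = (\<Oplus>i\<in>{..<n}. pairing (d i) (u i))" by (rule pairing_unit)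
  have "(\<lambda>i. pairing (d i) (u i)) \<in> {..<n} \<rightarrow> carrier A"
    using ud(1,2) pairing_closed by (auto simp: Pi_iff)
  from inject_unit[OF this ud(3)]
  have "\<one>\<^bsub>T\<^esub> = (\<Oplus>\<^bsub>T\<^esub>i\<in>{..<n}. tensor_algebra_inject A E (pairing (d i) (u i)))" .
  also have "\<dots> = (\<Oplus>\<^bsub>T\<^esub>i\<in>{..<n}. embed (gen (Covectors [d i])) \<otimes>\<^bsub>T\<^esub> embed (gen (Vectors [u i])))"
    by (rule gr.C.finsum_cong')
      (use ud(1,2) vector_mult_covector(2) in \<open>simp_all add: Pi_iff inject_eq dual_closed pairing_closed embed_closed words.S_in_G\<close>)
  finally show ?thesis
    unfolding gr.has_unit_def using ud(1,2) embed_vector_gr embed_covector_gr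
    by (intro exI[of _ n] exI[of _ "\<lambda>i. embed (gen (Covectors [d i]))"] exI[of _ "\<lambda>i. embed (gen (Vectors [u i]))"])
      (auto simp: Pi_iff)
qed

lemma T_unit_minus_one:
  assumes x: "x \<in> {..<n::nat} \<rightarrow> carrier E" and \<alpha>: "\<alpha> \<in> {..<n} \<rightarrow> carrier D"
    and one: "\<one> = (\<Oplus>i\<in>{..<n}. \<alpha> i (x i))"
  shows "gr.has_unit (- 1)"
proof -
  have "(\<lambda>i. \<alpha> i (x i)) \<in> {..<n} \<rightarrow> carrier A"
    using x \<alpha> by (auto simp: Pi_iff dual_closed)
  from inject_unit[OF this one]
  have "\<one>\<^bsub>T\<^esub> = (\<Oplus>\<^bsub>T\<^esub>i\<in>{..<n}. tensor_algebra_inject A E (\<alpha> i (x i)))" .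
  also have "\<dots> = (\<Oplus>\<^bsub>T\<^esub>i\<in>{..<n}. embed (gen (Vectors [x i])) \<otimes>\<^bsub>T\<^esub> embed (gen (Covectors [\<alpha> i])))"
    by (rule gr.C.finsum_cong')
      (use x \<alpha> vector_mult_covector(1) in \<open>simp_all add: Pi_iff inject_eq dual_closed pairing_closed embed_closed words.S_in_G\<close>)
  finally show ?thesis
    unfolding gr.has_unit_def using x \<alpha> embed_vector_gr embed_covector_gr
    by (intro exI[of _ n] exI[of _ "\<lambda>i. embed (gen (Vectors [x i]))"] exI[of _ "\<lambda>i. embed (gen (Covectors [\<alpha> i]))"])
      (auto simp: Pi_iff)
qed

text \<open>In degrees 1 and -1 the words are single letters, so a product of such elements is the
  class of a scalar obtained by evaluation. Injectivity of \<open>A\<close> in the tensor algebra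
  brings the equation with the unit back to \<open>A\<close>.\<close>

lemma ev_unit_of_T_unit:
  assumes "gr.has_unit (- 1)"
  shows "\<exists>t. t upon carrier E \<times> carrier D \<and> additive_ext A ev_pair t = \<one>"
proof -
  \<comment> \<open>The combinations congruent to one scalar in the image of evaluation. They are
    closed under differences, as bilinear induction on both factors requires.\<close>
  define P where "P s \<longleftrightarrow> (\<exists>t. t upon carrier E \<times> carrier D \<and>
    words.cl s = words.cl (gen (Scalar (additive_ext A ev_pair t))))" for s
  have P_diff: "P (r - s)" if "P r" "P s" for r s
  proof -
    obtain t where t: "t upon carrier E \<times> carrier D"
      "words.cl r = words.cl (gen (Scalar (additive_ext A ev_pair t)))" using \<open>P r\<close> unfolding P_def by blast
    obtain t' where t': "t' upon carrier E \<times> carrier D"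
      "words.cl s = words.cl (gen (Scalar (additive_ext A ev_pair t')))" using \<open>P s\<close> unfolding P_def by blast
    note cl = ev_pair_ext_closed[OF t(1)] ev_pair_ext_closed[OF t'(1)]
      ev_pair_ext_closed[OF keys_diff_subset[OF t(1) t'(1)]]
    have "additive_ext A ev_pair (t - t') \<oplus> additive_ext A ev_pair t' = additive_ext A ev_pair t"
      using A.additive_ext_add[OF keys_diff_subset[OF t(1) t'(1)] t'(1) ev_pair_closed] by simp
    then have "words.cl r = words.cl (gen (Scalar (additive_ext A ev_pair (t - t'))) + gen (Scalar (additive_ext A ev_pair t')))"
      using words.S_add[OF cl(3,2)] t(2) by simp
    from rel_class_diff_cong[OF this t'(2)]
    have "words.cl (r - s) = words.cl (gen (Scalar (additive_ext A ev_pair (t - t'))))" by simp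
    then show ?thesis unfolding P_def using keys_diff_subset[OF t(1) t'(1)] by blast
  qed
  have P_gen: "P (gen (Scalar (\<alpha> x)))" if "x \<in> carrier E" "\<alpha> \<in> carrier D" for x \<alpha>
    unfolding P_def
    by (rule exI[of _ "gen (x, \<alpha>)"]) (use that in \<open>simp add: A.additive_ext_gen dual_closed\<close>)
  have P_zero: "P 0"
    unfolding P_def by (rule exI[of _ 0]) (simp add: words.S_zero)
  have P_mult: "P (word_mult z w)" if "z upon lgens 1" "w upon lgens (- 1)" for z w
    using that(1)
  proof (induction z rule: frag_induction)
    case (one v)
    show ?case using that(2)
    proof (induction w rule: frag_induction)
      case (one w)
      from \<open>v \<in> lgens 1\<close> obtain x where "v = Vectors [x]" "x \<in> carrier E"
        by (auto simp: line_gens_def power_gens_def length_Suc_conv)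
      moreover from one obtain \<alpha> where "w = Covectors [\<alpha>]" "\<alpha> \<in> carrier D"
        by (auto simp: line_gens_def power_gens_def length_Suc_conv)
      ultimately show ?case by (simp add: word_mult_gen P_gen)
    qed (simp_all add: P_zero word_mult_diff_right P_diff)
  qed (simp_all add: P_zero word_mult_diff_left P_diff)
  have P_sum: "P (sum f I)" if "finite I" "\<And>i. i \<in> I \<Longrightarrow> P (f i)" for f and I :: "nat set"
    using that
  proof (induction I rule: finite_induct)
    case (insert i I)
    \<comment> \<open>Closure is available for differences only, so the sum is written as a double
      difference.\<close>
    then have "P (f i - (0 - sum f I))" by (intro P_diff P_zero) auto
    then show ?case using insert by simp
  qed (simp add: P_zero)
  obtain n u v where uv: "u \<in> {..<n::nat} \<rightarrow> gr 1" "v \<in> {..<n} \<rightarrow> gr (- 1)"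
    "\<one>\<^bsub>T\<^esub> = (\<Oplus>\<^bsub>T\<^esub>i\<in>{..<n}. u i \<otimes>\<^bsub>T\<^esub> v i)" using assms unfolding gr.has_unit_def by auto
  have "\<forall>i\<in>{..<n}. \<exists>z. u i = embed z \<and> z upon lgens 1"
    using uv(1) by (auto simp: gr_eq Pi_iff image_iff)
  then obtain z where z: "\<And>i. i < n \<Longrightarrow> u i = embed (z i) \<and> (z i) upon lgens 1" by (metis lessThan_iff)
  have "\<forall>i\<in>{..<n}. \<exists>z. v i = embed z \<and> z upon lgens (- 1)"
    using uv(2) by (auto simp: gr_eq Pi_iff image_iff)
  then obtain w where w: "\<And>i. i < n \<Longrightarrow> v i = embed (w i) \<and> (w i) upon lgens (- 1)" by (metis lessThan_iff)
  have zw: "(z i) upon words" "(w i) upon words" if "i < n" for i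
    using z[OF that] w[OF that] lgens_subset by blast+
  have embed_sum: "(\<Oplus>\<^bsub>T\<^esub>i\<in>I. embed (f i)) = embed (sum f I)"
    if "finite I" "\<And>i. i \<in> I \<Longrightarrow> (f i) upon words" for f and I :: "nat set"
    using that
    by (induction I rule: finite_induct)
      (simp_all add: T_zero gr.C.finsum_insert embed_closed T_add Pi_iff)
  have "\<one>\<^bsub>T\<^esub> = (\<Oplus>\<^bsub>T\<^esub>i\<in>{..<n}. embed (word_mult (z i) (w i)))"
    unfolding uv(3)
    by (rule gr.C.finsum_cong') (use z w zw in \<open>simp_all add: T_mult embed_closed word_mult_keys\<close>)
  also have "\<dots> = embed (\<Sum>i<n. word_mult (z i) (w i))"
    by (rule embed_sum) (use zw word_mult_keys in auto)
  finally have one: "\<one>\<^bsub>T\<^esub> = embed (\<Sum>i<n. word_mult (z i) (w i))" .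
  have "P (\<Sum>i<n. word_mult (z i) (w i))"
    by (rule P_sum) (use z w P_mult in auto)
  then obtain t where t: "t upon carrier E \<times> carrier D"
    "words.cl (\<Sum>i<n. word_mult (z i) (w i)) = words.cl (gen (Scalar (additive_ext A ev_pair t)))"
    unfolding P_def by blast
  have "embed (gen (Scalar (additive_ext A ev_pair t))) = embed (gen (Scalar \<one>))"
    using embed_cong[OF t(2)] one by (simp add: T_one)
  then have "additive_ext A ev_pair t = \<one>"
    by (intro scalar_inject ev_pair_ext_closed[OF t(1)]) simp_all
  with t(1) show ?thesis by blast
qed

theorem hopf_galois_iff:
  "hopf_galois_extension A (tensor_algebra_inject A E) T gr \<longleftrightarrow> left_line_module A E"
proof
  assume "hopf_galois_extension A (tensor_algebra_inject A E) T gr"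
  then have "canonical_map T gr ` carrier gr.source.tens = carrier gr.target.tens"
    by (simp add: hopf_galois_extension_def bij_betw_def)
  then have "gr.has_unit (- 1)" by (rule gr.unit_of_surjective)
  from ev_unit_of_T_unit[OF this] obtain t where
    t: "t upon carrier E \<times> carrier D" "additive_ext A ev_pair t = \<one>" by blast
  obtain n x \<alpha> where "x \<in> {..<n::nat} \<rightarrow> carrier E" "\<alpha> \<in> {..<n} \<rightarrow> carrier D"
    "\<one> = (\<Oplus>i\<in>{..<n}. \<alpha> i (x i))" by (rule ev_unit[OF t])
  then have "bij_betw (ev A E) (carrier ED.tens) (carrier A)" by (rule ev_bij)
  with weak show "left_line_module A E" by (simp add: left_line_module_def)
next
  assume "left_line_module A E"
  then have "bij_betw (ev A E) (carrier ED.tens) (carrier A)" by (simp add: left_line_module_def)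
  then have "\<one> \<in> ev A E ` carrier ED.tens" by (simp add: bij_betw_def)
  then obtain t where t: "t upon carrier E \<times> carrier D" "additive_ext A ev_pair t = \<one>"
    unfolding ED.tens_eq presented_carrier by (auto simp: ev_class)
  obtain n x \<alpha> where "x \<in> {..<n::nat} \<rightarrow> carrier E" "\<alpha> \<in> {..<n} \<rightarrow> carrier D"
    "\<one> = (\<Oplus>i\<in>{..<n}. \<alpha> i (x i))" by (rule ev_unit[OF t])
  then have "gr.has_unit (- 1)" by (rule T_unit_minus_one)
  then have "bij_betw (canonical_map T gr) (carrier gr.source.tens) (carrier gr.target.tens)"
    by (rule gr.canonical_map_bij[OF gr.has_unit_all[OF T_unit_one]])
  then show "hopf_galois_extension A (tensor_algebra_inject A E) T gr"
    using T_graded inject_iso inject_smult by (simp add: hopf_galois_extension_def)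
qed

end

theorem proposition7p2:
  fixes A :: "(complex, 'a) module" and L :: "('a, 'l) bimodule"
  assumes "complex_algebra A"
    and "weak_left_line_module A L"
  shows "hopf_galois_extension A (tensor_algebra_inject A L)
           (tensor_algebra A L) (tensor_algebra_degree A L)
         \<longleftrightarrow> left_line_module A L"
proof -
  interpret weak_line A L
    using assms(2) by (simp add: weak_line_def weak_line_axioms_def weak_left_line_module_def)
  show ?thesis by (rule hopf_galois_iff)
qed

end
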